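(* 1) The set $\{X_w\mid w\in W\}$ is a $\mathbb Z$-graded cellular basis of the coinvariant algebra $C$ which makes $C$ into a $\mathbb Z$-graded cellular algebra. Moreover, each cell module of $C$ is one-dimensional. 2) The map $X_w\mapsto\delta_{w,w_0}$, $w\in W$, extends uniquely to a $\mathbb C$-linear homogeneous symmetrizing form $\operatorname{tr}$ of degree $-2\ell(w_0)$ on $C$.
   Context: $W$ is the Weyl group of a finite dimensional complex semisimple Lie algebra $\mathfrak g$ with Cartan subalgebra $\mathfrak h$, simple roots $\Pi$, positive roots $\Phi^+$, length function $\ell$ and longest element $w_0$. $R:=S(\mathfrak h^* )$ is graded with $\mathfrak h^*$ in degree $2$; $I_W$ is the homogeneous ideal generated by the $W$-invariants of positive degree and $C:=R/I_W$ (the coinvariant algebra; it is identified with the cohomology algebra $H^*(G/B)$ over $\mathbb C$). For $\alpha\in\Pi$ the Demazure operator is $\Delta_{s_\alpha}(f):=(f-s_\alpha f)/\alpha$ on $R$; for a reduced expression $w=s_{j_1}\cdots s_{j_k}$, $\Delta_w:=\Delta_{s_{j_1}}\cdots\Delta_{s_{j_k}}$ (independent of the reduced expression). It induces an endomorphism of $C$, also denoted $\Delta_w$. Put $D:=\frac1{|W|}\prod_{\alpha\in\Phi^+}\alpha\in R$ with image $\overline D\in C$, and $X_w:=\Delta_{w^{-1}w_0}\overline D\in C$; it is homogeneous of degree $2\ell(w)$, and $\{X_w\mid w\in W\}$ is a $\mathbb C$-basis of $C$. Graded cellular algebra (Hu–Mathas): a graded algebra $A$ with a finite poset $(\mathcal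 P,\rhd)$, finite sets $T(p)$ for $p\in\mathcal P$, a homogeneous basis $\{c^p_{st}\mid p\in\mathcal P,\ s,t\in T(p)\}$ and a degree function $\deg:\coprod_pT(p)\to\mathbb Z$ with $\deg c^p_{st}=\deg s+\deg t$, such that for $a\in A$ one has $a\,c^p_{st}\equiv\sum_{u}r_{u}(a,s)c^p_{ut}$ modulo the span of the $c^{q}_{uv}$ with $q\rhd p$, where $r_u(a,s)$ does not depend on $t$, and the linear map $c^p_{st}\mapsto c^p_{ts}$ is an anti-automorphism of $A$. The cell module of $p$ has basis indexed by $T(p)$ and action given by the coefficients $r_u(a,s)$. Here the anti-involution is the identity map of $C$. A symmetrizing form on a finite dimensional algebra $A$ is a linear map $\operatorname{tr}:A\to\mathbb C$ with $\operatorname{tr}(ab)=\operatorname{tr}(ba)$ such that $(a,b)\mapsto\operatorname{tr}(ab)$ is non-degenerate; homogeneous of degree $-k$ means it is a homogeneous map of degree $-k$ to $\mathbb C$ placed in degree $0$. *)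

theory Defs
  imports Complex_Main "HOL-Algebra.QuotRing" "HOL-Algebra.Module" "HOL-Algebra.Generated_Groups" "HOL-Algebra.Bij"
begin

section \<open>Graded cellular algebras and symmetrizing forms over the complex numbers\<close>

definition complex_ring :: "complex ring" where
  "complex_ring = \<lparr>carrier = UNIV, mult = (*), one = 1, zero = 0, add = (+)\<rparr>"

text \<open>Not necessarily commutative, unlike the locale \<open>algebra\<close> of HOL-Algebra.\<close>

definition complex_algebra :: "(complex, 'a) module \<Rightarrow> bool" where
  "complex_algebra A \<longleftrightarrow> ring A \<and> module complex_ring A \<and>
     (\<forall>k. \<forall>x\<in>carrier A. \<forall>y\<in>carrier A.
        (k \<odot>\<^bsub>A\<^esub> x) \<otimes>\<^bsub>A\<^esub> y = k \<odot>\<^bsub>A\<^esub> (x \<otimes>\<^bsub>A\<^esub> y) \<and>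
        x \<otimes>\<^bsub>A\<^esub> (k \<odot>\<^bsub>A\<^esub> y) = k \<odot>\<^bsub>A\<^esub> (x \<otimes>\<^bsub>A\<^esub> y))"

text \<open>A finite basis, as an indexed family; a basis in this sense is automatically injective on \<open>I\<close>.\<close>

definition lin_basis :: "(complex, 'a, 'z) module_scheme \<Rightarrow> 'i set \<Rightarrow> ('i \<Rightarrow> 'a) \<Rightarrow> bool" where
  "lin_basis V I b \<longleftrightarrow> finite I \<and> b \<in> I \<rightarrow> carrier V \<and>
     (\<forall>x\<in>carrier V. \<exists>!k. k \<in> extensional I \<and> x = (\<Oplus>\<^bsub>V\<^esub>i\<in>I. k i \<odot>\<^bsub>V\<^esub> b i))"

definition has_dim :: "(complex, 'a, 'z) module_scheme \<Rightarrow> nat \<Rightarrow> bool" where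
  "has_dim V n \<longleftrightarrow> (\<exists>b. lin_basis V {..<n} b)"

definition lin_span :: "(complex, 'a, 'z) module_scheme \<Rightarrow> 'a set \<Rightarrow> 'a set" where
  "lin_span V S = {x. \<exists>F k. finite F \<and> F \<subseteq> S \<and> x = (\<Oplus>\<^bsub>V\<^esub>v\<in>F. k v \<odot>\<^bsub>V\<^esub> v)}"

definition graded_algebra :: "(complex, 'a) module \<Rightarrow> (int \<Rightarrow> 'a set) \<Rightarrow> bool" where
  "graded_algebra A gr \<longleftrightarrow> complex_algebra A \<and>
     (\<forall>d. submodule (gr d) complex_ring A) \<and>
     (\<forall>x\<in>carrier A. \<exists>!f. (\<forall>d. f d \<in> gr d) \<and> finite {d. f d \<noteq> \<zero>\<^bsub>A\<^esub>} \<and>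
        x = (\<Oplus>\<^bsub>A\<^esub>d\<in>{d. f d \<noteq> \<zero>\<^bsub>A\<^esub>}. f d)) \<and>
     (\<forall>i j. \<forall>x\<in>gr i. \<forall>y\<in>gr j. x \<otimes>\<^bsub>A\<^esub> y \<in> gr (i + j))"

definition anti_automorphism :: "(complex, 'a) module \<Rightarrow> ('a \<Rightarrow> 'a) \<Rightarrow> bool" where
  "anti_automorphism A \<iota> \<longleftrightarrow> bij_betw \<iota> (carrier A) (carrier A) \<and>
     (\<forall>x\<in>carrier A. \<forall>y\<in>carrier A.
        \<iota> (x \<oplus>\<^bsub>A\<^esub> y) = \<iota> x \<oplus>\<^bsub>A\<^esub> \<iota> y \<and> \<iota> (x \<otimes>\<^bsub>A\<^esub> y) = \<iota> y \<otimes>\<^bsub>A\<^esub> \<iota> x) \<and>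
     (\<forall>k. \<forall>x\<in>carrier A. \<iota> (k \<odot>\<^bsub>A\<^esub> x) = k \<odot>\<^bsub>A\<^esub> \<iota> x)"

text \<open>In the following, \<open>gt q p\<close> is the strict order \<open>q \<rhd> p\<close> of the poset \<open>P\<close>.\<close>

definition higher_span ::
  "(complex, 'a) module \<Rightarrow> 'p set \<Rightarrow> ('p \<Rightarrow> 'p \<Rightarrow> bool) \<Rightarrow> ('p \<Rightarrow> 't set) \<Rightarrow>
   ('p \<Rightarrow> 't \<Rightarrow> 't \<Rightarrow> 'a) \<Rightarrow> 'p \<Rightarrow> 'a set" where
  "higher_span A P gt T c p =
     lin_span A {c q u v | q u v. q \<in> P \<and> gt q p \<and> u \<in> T q \<and> v \<in> T q}"

text \<open>\<open>r\<close> is the family \<open>u \<mapsto> r\<^sub>u(a,s)\<close>: the same \<open>r\<close> has to work for all \<open>t\<close>.\<close>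

definition is_cell_coeff ::
  "(complex, 'a) module \<Rightarrow> 'p set \<Rightarrow> ('p \<Rightarrow> 'p \<Rightarrow> bool) \<Rightarrow> ('p \<Rightarrow> 't set) \<Rightarrow>
   ('p \<Rightarrow> 't \<Rightarrow> 't \<Rightarrow> 'a) \<Rightarrow> 'p \<Rightarrow> 'a \<Rightarrow> 't \<Rightarrow> ('t \<Rightarrow> complex) \<Rightarrow> bool" where
  "is_cell_coeff A P gt T c p a s r \<longleftrightarrow> r \<in> extensional (T p) \<and>
     (\<forall>t\<in>T p. (a \<otimes>\<^bsub>A\<^esub> c p s t) \<ominus>\<^bsub>A\<^esub> (\<Oplus>\<^bsub>A\<^esub>u\<in>T p. r u \<odot>\<^bsub>A\<^esub> c p u t) \<in> higher_span A P gt T c p)"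

definition graded_cellular ::
  "(complex, 'a) module \<Rightarrow> (int \<Rightarrow> 'a set) \<Rightarrow> 'p set \<Rightarrow> ('p \<Rightarrow> 'p \<Rightarrow> bool) \<Rightarrow> ('p \<Rightarrow> 't set) \<Rightarrow>
   ('p \<Rightarrow> 't \<Rightarrow> 't \<Rightarrow> 'a) \<Rightarrow> ('p \<Rightarrow> 't \<Rightarrow> int) \<Rightarrow> ('a \<Rightarrow> 'a) \<Rightarrow> bool" where
  "graded_cellular A gr P gt T c dg \<iota> \<longleftrightarrow>
     graded_algebra A gr \<and>
     finite P \<and> irreflp_on P gt \<and> transp_on P gt \<and> (\<forall>p\<in>P. finite (T p)) \<and>
     lin_basis A {(p, s, t). p \<in> P \<and> s \<in> T p \<and> t \<in> T p} (\<lambda>(p, s, t). c p s t) \<and>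
     (\<forall>p\<in>P. \<forall>s\<in>T p. \<forall>t\<in>T p. c p s t \<in> gr (dg p s + dg p t)) \<and>
     (\<forall>a\<in>carrier A. \<forall>p\<in>P. \<forall>s\<in>T p. \<exists>r. is_cell_coeff A P gt T c p a s r) \<and>
     anti_automorphism A \<iota> \<and>
     (\<forall>p\<in>P. \<forall>s\<in>T p. \<forall>t\<in>T p. \<iota> (c p s t) = c p t s)"

record ('a, 'v) alg_module = "(complex, 'v) module" +
  act :: "'a \<Rightarrow> 'v \<Rightarrow> 'v"

text \<open>
  The cell module of \<open>p\<close>: the vector space of formal combinations of elements of \<open>T p\<close>, realised as
  functions vanishing off \<open>T p\<close>, with \<open>a s = (\<Sum>u\<in>T p. r\<^sub>u(a,s) u)\<close>. The coefficients are unique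
  because the \<open>c p s t\<close> form a basis. The fields \<open>mult\<close> and \<open>one\<close> of the record carry no meaning
  for a module.
\<close>

definition cell_module ::
  "(complex, 'a) module \<Rightarrow> 'p set \<Rightarrow> ('p \<Rightarrow> 'p \<Rightarrow> bool) \<Rightarrow> ('p \<Rightarrow> 't set) \<Rightarrow>
   ('p \<Rightarrow> 't \<Rightarrow> 't \<Rightarrow> 'a) \<Rightarrow> 'p \<Rightarrow> ('a, 't \<Rightarrow> complex) alg_module" where
  "cell_module A P gt T c p =
     \<lparr>carrier = {f. \<forall>u. u \<notin> T p \<longrightarrow> f u = 0},
      mult = undefined, one = undefined,
      zero = (\<lambda>u. 0), add = (\<lambda>f g u. f u + g u), smult = (\<lambda>k f u. k * f u),
      act = (\<lambda>a f u. if u \<in> T p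
               then \<Sum>s\<in>T p. f s * (THE r. is_cell_coeff A P gt T c p a s r) u else 0)\<rparr>"

definition linear_form :: "(complex, 'a) module \<Rightarrow> ('a \<Rightarrow> complex) \<Rightarrow> bool" where
  "linear_form A tr \<longleftrightarrow>
     (\<forall>x\<in>carrier A. \<forall>y\<in>carrier A. tr (x \<oplus>\<^bsub>A\<^esub> y) = tr x + tr y) \<and>
     (\<forall>k. \<forall>x\<in>carrier A. tr (k \<odot>\<^bsub>A\<^esub> x) = k * tr x)"

definition symmetrizing_form :: "(complex, 'a) module \<Rightarrow> ('a \<Rightarrow> complex) \<Rightarrow> bool" where
  "symmetrizing_form A tr \<longleftrightarrow> linear_form A tr \<and>
     (\<forall>a\<in>carrier A. \<forall>b\<in>carrier A. tr (a \<otimes>\<^bsub>A\<^esub> b) = tr (b \<otimes>\<^bsub>A\<^esub> a)) \<and>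
     (\<forall>a\<in>carrier A. (\<forall>b\<in>carrier A. tr (a \<otimes>\<^bsub>A\<^esub> b) = 0) \<longrightarrow> a = \<zero>\<^bsub>A\<^esub>)"

text \<open>Homogeneity of degree \<open>k\<close>, the target being the complex numbers placed in degree \<open>0\<close>.\<close>

definition homogeneous_form :: "(int \<Rightarrow> 'a set) \<Rightarrow> int \<Rightarrow> ('a \<Rightarrow> complex) \<Rightarrow> bool" where
  "homogeneous_form gr k tr \<longleftrightarrow> (\<forall>d. \<forall>x\<in>gr d. d + k \<noteq> 0 \<longrightarrow> tr x = 0)"


section \<open>The Weyl group and the coinvariant algebra\<close>

text \<open>
  The type \<open>'h\<close> is the Cartan subalgebra, a complex vector space with scalar multiplication
  \<open>scale\<close>. Roots are linear functionals on it, and \<open>coroot \<alpha>\<close> is meaningful only for roots \<open>\<alpha>\<close>.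
\<close>

record 'h root_datum =
  scale :: "complex \<Rightarrow> 'h \<Rightarrow> 'h"
  roots :: "('h \<Rightarrow> complex) set"
  coroot :: "('h \<Rightarrow> complex) \<Rightarrow> 'h"
  simple_roots :: "('h \<Rightarrow> complex) set"

definition dual :: "'h::ab_group_add root_datum \<Rightarrow> ('h \<Rightarrow> complex) set" where
  "dual D = {f. Vector_Spaces.linear (scale D) (*) f}"

definition pos_roots :: "'h root_datum \<Rightarrow> ('h \<Rightarrow> complex) set" where
  "pos_roots D = {\<beta>\<in>roots D. \<exists>n :: ('h \<Rightarrow> complex) \<Rightarrow> nat.
     \<beta> = (\<lambda>x. \<Sum>\<alpha>\<in>simple_roots D. of_nat (n \<alpha>) * \<alpha> x)}"

text \<open>
  The roots form a reduced root system in the dual space of \<open>'h\<close>, in the sense of Bourbaki over the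
  field of complex numbers, and the simple roots are a base of it. Such data are exactly those
  attached to a finite dimensional complex semisimple Lie algebra with a Cartan subalgebra and
  a choice of simple roots.
\<close>

definition semisimple_root_datum :: "'h::ab_group_add root_datum \<Rightarrow> bool" where
  "semisimple_root_datum D \<longleftrightarrow>
     vector_space (scale D) \<and>
     (\<exists>B. finite B \<and> (\<forall>x. \<exists>k. x = (\<Sum>b\<in>B. scale D (k b) b))) \<and>
     finite (roots D) \<and> roots D \<subseteq> dual D \<and>
     (\<forall>f\<in>dual D. \<exists>k. f = (\<lambda>x. \<Sum>\<alpha>\<in>roots D. k \<alpha> * \<alpha> x)) \<and>
     (\<forall>\<alpha>\<in>roots D. \<alpha> (coroot D \<alpha>) = 2) \<and>
     (\<forall>\<alpha>\<in>roots D. \<forall>\<beta>\<in>roots D.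
        \<beta> (coroot D \<alpha>) \<in> \<int> \<and> (\<lambda>x. \<beta> x - \<beta> (coroot D \<alpha>) * \<alpha> x) \<in> roots D) \<and>
     (\<forall>\<alpha>\<in>roots D. \<forall>k. (\<lambda>x. k * \<alpha> x) \<in> roots D \<longrightarrow> k = 1 \<or> k = -1) \<and>
     simple_roots D \<subseteq> roots D \<and>
     (\<forall>k. (\<forall>x. (\<Sum>\<alpha>\<in>simple_roots D. k \<alpha> * \<alpha> x) = 0) \<longrightarrow> (\<forall>\<alpha>\<in>simple_roots D. k \<alpha> = 0)) \<and>
     (\<forall>\<beta>\<in>roots D. \<beta> \<in> pos_roots D \<or> (\<lambda>x. - \<beta> x) \<in> pos_roots D)"

definition reflection :: "'h::ab_group_add root_datum \<Rightarrow> ('h \<Rightarrow> complex) \<Rightarrow> 'h \<Rightarrow> 'h" where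
  "reflection D \<alpha> x = x - scale D (\<alpha> x) (coroot D \<alpha>)"

text \<open>The Weyl group is realised as a group of linear maps on \<open>'h\<close>; its product is composition.\<close>

definition weyl :: "'h::ab_group_add root_datum \<Rightarrow> ('h \<Rightarrow> 'h) set" where
  "weyl D = generate (BijGroup UNIV) (reflection D ` roots D)"

text \<open>
  The contragredient action on functions. On linear functionals \<open>reflection D \<alpha>\<close> acts by
  \<open>\<lambda> \<mapsto> \<lambda> - \<lambda>(coroot \<alpha>) \<alpha>\<close>.
\<close>

definition weyl_act :: "('h \<Rightarrow> 'h) \<Rightarrow> ('h \<Rightarrow> complex) \<Rightarrow> 'h \<Rightarrow> complex" where
  "weyl_act w f = f \<circ> inv_into UNIV w"

definition word :: "'h::ab_group_add root_datum \<Rightarrow> ('h \<Rightarrow> complex) list \<Rightarrow> 'h \<Rightarrow> 'h" where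
  "word D js = foldr (\<lambda>\<alpha> w. reflection D \<alpha> \<circ> w) js id"

definition len :: "'h::ab_group_add root_datum \<Rightarrow> ('h \<Rightarrow> 'h) \<Rightarrow> nat" where
  "len D w = (LEAST n. \<exists>js. set js \<subseteq> simple_roots D \<and> length js = n \<and> word D js = w)"

definition reduced_expression ::
  "'h::ab_group_add root_datum \<Rightarrow> ('h \<Rightarrow> 'h) \<Rightarrow> ('h \<Rightarrow> complex) list \<Rightarrow> bool" where
  "reduced_expression D w js \<longleftrightarrow>
     set js \<subseteq> simple_roots D \<and> word D js = w \<and> length js = len D w"

definition longest :: "'h::ab_group_add root_datum \<Rightarrow> 'h \<Rightarrow> 'h" where
  "longest D = (THE w. w \<in> weyl D \<and> (\<forall>v\<in>weyl D. len D v \<le> len D w))"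

text \<open>
  The symmetric algebra of the dual space is realised as the algebra of polynomial functions on \<open>'h\<close>
  (the two are canonically isomorphic, the base field being infinite). \<open>sym_power D k\<close> is
  the span of all products of \<open>k\<close> linear functionals.
\<close>

inductive homogeneous_poly :: "'h::ab_group_add root_datum \<Rightarrow> nat \<Rightarrow> ('h \<Rightarrow> complex) \<Rightarrow> bool"
  for D where
  const: "homogeneous_poly D 0 (\<lambda>x. k)"
| mult: "f \<in> dual D \<Longrightarrow> homogeneous_poly D n g \<Longrightarrow> homogeneous_poly D (Suc n) (\<lambda>x. f x * g x)"
| add: "homogeneous_poly D n f \<Longrightarrow> homogeneous_poly D n g \<Longrightarrow> homogeneous_poly D n (\<lambda>x. f x + g x)"

definition sym_power :: "'h::ab_group_add root_datum \<Rightarrow> nat \<Rightarrow> ('h \<Rightarrow> complex) set" where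
  "sym_power D n = {f. homogeneous_poly D n f}"

definition sym_algebra :: "'h::ab_group_add root_datum \<Rightarrow> ('h \<Rightarrow> complex) ring" where
  "sym_algebra D =
     \<lparr>carrier = {f. \<exists>n g. (\<forall>k\<le>n. g k \<in> sym_power D k) \<and> f = (\<lambda>x. \<Sum>k\<le>n. g k x)},
      mult = (\<lambda>f g x. f x * g x), one = (\<lambda>x. 1), zero = (\<lambda>x. 0), add = (\<lambda>f g x. f x + g x)\<rparr>"

text \<open>
  The quotient \<open>(f - s\<^sub>\<alpha> f) / \<alpha>\<close> is taken in the ring of polynomial functions; pointwise division
  would give a wrong value where \<open>\<alpha>\<close> vanishes.
\<close>

definition demazure_simple ::
  "'h::ab_group_add root_datum \<Rightarrow> ('h \<Rightarrow> complex) \<Rightarrow> ('h \<Rightarrow> complex) \<Rightarrow> 'h \<Rightarrow> complex" where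
  "demazure_simple D \<alpha> f = (THE g. g \<in> carrier (sym_algebra D) \<and>
     (\<forall>x. \<alpha> x * g x = f x - weyl_act (reflection D \<alpha>) f x))"

text \<open>The result does not depend on the chosen reduced expression, by the braid relations.\<close>

definition demazure ::
  "'h::ab_group_add root_datum \<Rightarrow> ('h \<Rightarrow> 'h) \<Rightarrow> ('h \<Rightarrow> complex) \<Rightarrow> 'h \<Rightarrow> complex" where
  "demazure D w = foldr (\<lambda>\<alpha> F. demazure_simple D \<alpha> \<circ> F) (SOME js. reduced_expression D w js) id"

definition invariant_ideal :: "'h::ab_group_add root_datum \<Rightarrow> ('h \<Rightarrow> complex) set" where
  "invariant_ideal D = Idl\<^bsub>sym_algebra D\<^esub>
     {f. (\<exists>k>0. f \<in> sym_power D k) \<and> (\<forall>w\<in>weyl D. weyl_act w f = f)}"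

definition coinv_class ::
  "'h::ab_group_add root_datum \<Rightarrow> ('h \<Rightarrow> complex) \<Rightarrow> ('h \<Rightarrow> complex) set" where
  "coinv_class D f = invariant_ideal D +>\<^bsub>sym_algebra D\<^esub> f"

text \<open>The quotient ring, with scalars acting through the classes of constant functions.\<close>

definition coinvariant_algebra ::
  "'h::ab_group_add root_datum \<Rightarrow> (complex, ('h \<Rightarrow> complex) set) module" where
  "coinvariant_algebra D = ring.extend (sym_algebra D Quot invariant_ideal D)
     \<lparr>smult = (\<lambda>k X. coinv_class D (\<lambda>x. k) \<otimes>\<^bsub>sym_algebra D Quot invariant_ideal D\<^esub> X)\<rparr>"

text \<open>The dual space of \<open>'h\<close> sits in degree \<open>2\<close>.\<close>

definition coinvariant_grading ::
  "'h::ab_group_add root_datum \<Rightarrow> int \<Rightarrow> ('h \<Rightarrow> complex) set set" where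
  "coinvariant_grading D d =
     (if 0 \<le> d \<and> even d then coinv_class D ` sym_power D (nat (d div 2))
      else {\<zero>\<^bsub>coinvariant_algebra D\<^esub>})"

text \<open>The induced endomorphism: the common class of all \<open>\<Delta>\<^sub>w f\<close>, for \<open>f\<close> in the coset \<open>X\<close>.\<close>

definition demazure_coinv ::
  "'h::ab_group_add root_datum \<Rightarrow> ('h \<Rightarrow> 'h) \<Rightarrow> ('h \<Rightarrow> complex) set \<Rightarrow> ('h \<Rightarrow> complex) set" where
  "demazure_coinv D w X = the_elem ((\<lambda>f. coinv_class D (demazure D w f)) ` X)"

definition top_poly :: "'h::ab_group_add root_datum \<Rightarrow> 'h \<Rightarrow> complex" where
  "top_poly D x = (1 / of_nat (card (weyl D))) * (\<Prod>\<alpha>\<in>pos_roots D. \<alpha> x)"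

definition schubert :: "'h::ab_group_add root_datum \<Rightarrow> ('h \<Rightarrow> 'h) \<Rightarrow> ('h \<Rightarrow> complex) set" where
  "schubert D w =
     demazure_coinv D (inv_into UNIV w \<circ> longest D) (coinv_class D (top_poly D))"

end

theory Submission
  imports Defs "HOL-Computational_Algebra.Polynomial"
begin

text \<open>
  Everything is read off from the constant terms \<open>f \<mapsto> (\<Delta>\<^sub>w f)(0)\<close> of the Demazure operators.
  By the twisted Leibniz rule they vanish on \<open>I\<^sub>W\<close>; conversely, if all of them vanish on \<open>f\<close>, then
  inductively \<open>\<Delta>\<^sub>\<alpha> f \<in> I\<^sub>W\<close> for all simple \<open>\<alpha>\<close>, so \<open>f\<close> is congruent to its average over \<open>W\<close> and lies
  in \<open>I\<^sub>W\<close>. So they are coordinates on the coinvariant algebra. As \<open>\<Delta>\<^sub>v \<Delta>\<^sub>w\<close> is \<open>\<Delta>\<^sub>v\<^sub>w\<close> or zero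
  according to whether the lengths add up, the \<open>X\<^sub>w\<close> form the dual basis up to a constant factor,
  which is not zero because the product \<open>d\<close> of the positive roots is not in \<open>I\<^sub>W\<close>:
  antisymmetrization takes \<open>I\<^sub>W\<close> into the multiples \<open>d h\<close> with \<open>h(0) = 0\<close>, but multiplies \<open>d\<close> by
  \<open>|W|\<close>. Multiplication by an element without constant term raises the degree, which gives the
  cellular structure with \<open>W\<close> ordered by length. Up to a factor, the form is the constant term of
  \<open>\<Delta>\<^sub>w f\<close> for the longest \<open>w\<close>. With respect to it \<open>\<Delta>\<^sub>w\<close> is adjoint to the Demazure operator of the
  inverse of \<open>w\<close>; so pairing \<open>f\<close> with the \<open>X\<^sub>w\<close> recovers all coordinates of \<open>f\<close>.
\<close>

text \<open>The datum supplies a root system over the complex numbers together with a coroot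
  function, and \<open>demazure\<close> rests on an arbitrary choice of a reduced word. So before
  constant terms can be used, coroots must be shown to be determined by the roots, length must be
  identified with the number of inversions, and the operator must be shown not to depend on the
  word. The last two come from one device. Each one-letter deletion of a word carries a root, and
  the sum over all deletions of an odd function of this root depends only on the product of the
  word, even if the word is not reduced, because a root and its negative cancel. With an indicator
  as the function this yields the exchange property; with Demazure operators of shorter words,
  weighted by coroot values, it yields independence of the word. The latter is proved for all words
  of equal length and product, so that a nonreduced word can be compared with a reduced one padded
  by repetitions of a single letter, whose operator visibly vanishes.\<close>

locale root_system =
  fixes D :: "'h::ab_group_add root_datum"
  assumes datum: "semisimple_root_datum D"
begin

abbreviation "polys \<equiv> carrier (sym_algebra D)"
abbreviation "hom_polys \<equiv> sym_power D"

section \<open>Linear functionals and linear maps\<close>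

lemma vs: "vector_space (scale D)"
  using datum by (simp add: semisimple_root_datum_def)

sublocale V: vector_space "scale D" by (rule vs)
lemma dual_pair: "vector_space_pair (scale D) ((*) :: complex \<Rightarrow> complex \<Rightarrow> complex)"
  by (intro vector_space_pair.intro vs) (unfold_locales, simp_all add: algebra_simps)

lemma dual_iff: "f \<in> dual D \<longleftrightarrow> (\<forall>x y. f (x + y) = f x + f y) \<and> (\<forall>k x. f (scale D k x) = k * f x)"
  using dual_pair by (auto simp: dual_def Vector_Spaces.linear_iff vector_space_pair_def)

lemma dual_add: "f \<in> dual D \<Longrightarrow> f (x + y) = f x + f y"
  and dual_scale: "f \<in> dual D \<Longrightarrow> f (scale D k x) = k * f x"
  by (auto simp: dual_iff)

lemma dual_0: "f \<in> dual D \<Longrightarrow> f 0 = 0"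
  using dual_add[of f 0 0] by simp

lemma dual_diff: "f \<in> dual D \<Longrightarrow> f (x - y) = f x - f y"
  using dual_add[of f "x - y" y] by simp

lemma dual_uminus: "f \<in> dual D \<Longrightarrow> f (- x) = - f x"
  using dual_diff[of f 0 x] by (simp add: dual_0)

text \<open>The difference of two distinct points is an independent singleton, on which a functional
  may be prescribed. As the roots span the dual space, vectors and linear maps can therefore be
  compared by testing them against roots.\<close>

lemma dual_separates:
  assumes "\<And>f. f \<in> dual D \<Longrightarrow> f x = f y" shows "x = y"
proof (rule ccontr)
  assume "x \<noteq> y"
  then have "V.independent {x - y}" by simp
  from vector_space_pair.linear_independent_extend[OF dual_pair this, of "\<lambda>_. 1"] obtain g where
    "Vector_Spaces.linear (scale D) (*) g" "g (x - y) = (1::complex)" by auto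
  then have "g \<in> dual D" by (simp add: dual_def)
  with assms[OF this] \<open>g (x - y) = 1\<close> dual_diff show False by fastforce
qed

definition linear_map :: "('h \<Rightarrow> 'h) \<Rightarrow> bool" where
  "linear_map u \<longleftrightarrow> (\<forall>x y. u (x + y) = u x + u y) \<and> (\<forall>k x. u (scale D k x) = scale D k (u x))"

lemma dual_comp: "f \<in> dual D \<Longrightarrow> linear_map u \<Longrightarrow> f \<circ> u \<in> dual D"
  by (simp add: dual_iff linear_map_def)

lemma linear_map_comp: "linear_map u \<Longrightarrow> linear_map v \<Longrightarrow> linear_map (u \<circ> v)"
  by (simp add: linear_map_def)

lemma linear_map_transvection: "f \<in> dual D \<Longrightarrow> linear_map (\<lambda>x. x - scale D (f x) v)"
  by (simp add: linear_map_def dual_iff V.scale_left_distrib V.scale_right_diff_distrib)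


subsection \<open>Polynomial functions\<close>

lemma hom_polys_const: "(\<lambda>x. k) \<in> hom_polys 0"
  by (simp add: sym_power_def homogeneous_poly.const)

lemma hom_polys_dual_mult:
  "f \<in> dual D \<Longrightarrow> g \<in> hom_polys n \<Longrightarrow> (\<lambda>x. f x * g x) \<in> hom_polys (Suc n)"
  by (simp add: sym_power_def homogeneous_poly.mult)

lemma hom_polys_add:
  "f \<in> hom_polys n \<Longrightarrow> g \<in> hom_polys n \<Longrightarrow> (\<lambda>x. f x + g x) \<in> hom_polys n"
  by (simp add: sym_power_def homogeneous_poly.add)

lemma hom_polys_induct [consumes 1, case_names const mult add]:
  assumes "f \<in> hom_polys n"
    and "\<And>k. Q 0 (\<lambda>x. k)"
    and "\<And>l n g. l \<in> dual D \<Longrightarrow> g \<in> hom_polys n \<Longrightarrow> Q n g \<Longrightarrow> Q (Suc n) (\<lambda>x. l x * g x)"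
    and "\<And>n f g. f \<in> hom_polys n \<Longrightarrow> g \<in> hom_polys n \<Longrightarrow> Q n f \<Longrightarrow> Q n g \<Longrightarrow> Q n (\<lambda>x. f x + g x)"
  shows "Q n f"
proof -
  have "homogeneous_poly D n f" using assms(1) by (simp add: sym_power_def)
  then show ?thesis
    by (induction rule: homogeneous_poly.induct) (use assms in \<open>auto simp: sym_power_def\<close>)
qed

lemma hom_polys_zero: "(\<lambda>x. 0) \<in> hom_polys n"
proof (induction n)
  case (Suc n)
  have "(\<lambda>x. 0) \<in> dual D" by (simp add: dual_iff)
  from hom_polys_dual_mult[OF this Suc] show ?case by simp
qed (rule hom_polys_const)

lemma hom_polys_smult: "f \<in> hom_polys n \<Longrightarrow> (\<lambda>x. k * f x) \<in> hom_polys n"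
proof (induction rule: hom_polys_induct)
  case (const c)
  show ?case by (rule hom_polys_const)
next
  case (mult l n g)
  from hom_polys_dual_mult[OF mult(1,3)] show ?case by (simp add: algebra_simps)
next
  case (add n f g)
  from hom_polys_add[OF add(3,4)] show ?case by (simp add: algebra_simps)
qed

lemma hom_polys_mult:
  "f \<in> hom_polys m \<Longrightarrow> g \<in> hom_polys n \<Longrightarrow> (\<lambda>x. f x * g x) \<in> hom_polys (m + n)"
proof (induction rule: hom_polys_induct)
  case (const k)
  then show ?case by (simp add: hom_polys_smult)
next
  case (mult l m f)
  from hom_polys_dual_mult[OF mult(1) mult(3)[OF mult(4)]] show ?case by (simp add: algebra_simps)
next
  case (add m f f')
  from hom_polys_add[OF add(3)[OF add(5)] add(4)[OF add(5)]] show ?case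
    by (simp add: algebra_simps)
qed

lemma hom_polys_sum:
  "(\<And>i. i \<in> A \<Longrightarrow> f i \<in> hom_polys n) \<Longrightarrow> (\<lambda>x. \<Sum>i\<in>A. f i x) \<in> hom_polys n"
  by (induction A rule: infinite_finite_induct) (auto simp: hom_polys_zero hom_polys_add)

lemma hom_polys_comp: "f \<in> hom_polys n \<Longrightarrow> linear_map u \<Longrightarrow> f \<circ> u \<in> hom_polys n"
proof (induction rule: hom_polys_induct)
  case (const c)
  show ?case by (simp add: o_def hom_polys_const)
next
  case (mult l n g)
  from hom_polys_dual_mult[OF dual_comp[OF mult(1,4)] mult(3)[OF mult(4)]] show ?case
    by (simp add: o_def)
next
  case (add n f g)
  then show ?case using hom_polys_add[of "f \<circ> u" n "g \<circ> u"] by (simp add: o_def)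
qed

lemma dual_hom_polys: "f \<in> dual D \<Longrightarrow> f \<in> hom_polys 1"
  using hom_polys_dual_mult[OF _ hom_polys_const[of 1], of f] by simp

lemma hom_polys_prod:
  "finite A \<Longrightarrow> (\<And>i. i \<in> A \<Longrightarrow> f i \<in> dual D) \<Longrightarrow> (\<lambda>x. \<Prod>i\<in>A. f i x) \<in> hom_polys (card A)"
  by (induction A rule: finite_induct) (auto simp: hom_polys_const intro!: hom_polys_dual_mult)

lemma hom_polys_const_iff: "f \<in> hom_polys 0 \<Longrightarrow> f = (\<lambda>x. f 0)"
proof -
  have "f \<in> hom_polys n \<Longrightarrow> n = 0 \<longrightarrow> (\<exists>c. f = (\<lambda>x. c))" for n
    by (induction rule: hom_polys_induct) auto
  then show "f \<in> hom_polys 0 \<Longrightarrow> f = (\<lambda>x. f 0)" by fastforce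
qed

lemma hom_polys_at_0: "f \<in> hom_polys n \<Longrightarrow> 0 < n \<Longrightarrow> f 0 = 0"
  by (induction rule: hom_polys_induct) (auto simp: dual_0)

text \<open>The definition constrains only the components up to the bound. Replacing the others by
  zero gives a total family and removes the side condition.\<close>

lemma polys_iff:
  "f \<in> polys \<longleftrightarrow> (\<exists>n g. (\<forall>k. g k \<in> hom_polys k) \<and> f = (\<lambda>x. \<Sum>k\<le>n. g k x))"
proof -
  have "f \<in> polys \<longleftrightarrow> (\<exists>n g. (\<forall>k\<le>n. g k \<in> hom_polys k) \<and> f = (\<lambda>x. \<Sum>k\<le>n. g k x))"
    by (simp add: sym_algebra_def)
  also have "\<dots> \<longleftrightarrow> (\<exists>n g. (\<forall>k. g k \<in> hom_polys k) \<and> f = (\<lambda>x. \<Sum>k\<le>n. g k x))"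
  proof
    assume "\<exists>n g. (\<forall>k\<le>n. g k \<in> hom_polys k) \<and> f = (\<lambda>x. \<Sum>k\<le>n. g k x)"
    then obtain n g where g: "\<forall>k\<le>n. g k \<in> hom_polys k" "f = (\<lambda>x. \<Sum>k\<le>n. g k x)" by blast
    define g' where "g' k = (if k \<le> n then g k else (\<lambda>x. 0))" for k
    have "(\<forall>k. g' k \<in> hom_polys k) \<and> f = (\<lambda>x. \<Sum>k\<le>n. g' k x)"
      using g by (simp add: g'_def hom_polys_zero)
    then show "\<exists>n g. (\<forall>k. g k \<in> hom_polys k) \<and> f = (\<lambda>x. \<Sum>k\<le>n. g k x)" by blast
  qed blast
  finally show ?thesis .
qed

lemma hom_polys_polys: "f \<in> hom_polys n \<Longrightarrow> f \<in> polys"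
  unfolding polys_iff
  by (rule exI[of _ n], rule exI[of _ "\<lambda>k. if k = n then f else (\<lambda>x. 0)"])
    (auto simp: hom_polys_zero if_distrib[of "\<lambda>f. f _"] cong: if_cong)

lemma polys_add:
  assumes "f \<in> polys" "g \<in> polys" shows "(\<lambda>x. f x + g x) \<in> polys"
proof -
  obtain m f' n g' where f: "\<forall>k. f' k \<in> hom_polys k" "f = (\<lambda>x. \<Sum>k\<le>m. f' k x)"
    and g: "\<forall>k. g' k \<in> hom_polys k" "g = (\<lambda>x. \<Sum>k\<le>n. g' k x)"
    using assms unfolding polys_iff by blast
  define h where "h k x = (if k \<le> m then f' k x else 0) + (if k \<le> n then g' k x else 0)" for k x
  have "h k \<in> hom_polys k" for k
    using f(1) g(1) unfolding h_def
    by (cases "k \<le> m"; cases "k \<le> n") (auto intro: hom_polys_add hom_polys_zero)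
  moreover have "f x + g x = (\<Sum>k\<le>max m n. h k x)" for x
  proof -
    have "f x = (\<Sum>k\<le>max m n. if k \<le> m then f' k x else 0)"
      unfolding f(2) by (rule sum.mono_neutral_cong_left) auto
    moreover have "g x = (\<Sum>k\<le>max m n. if k \<le> n then g' k x else 0)"
      unfolding g(2) by (rule sum.mono_neutral_cong_left) auto
    ultimately show ?thesis by (simp add: h_def sum.distrib)
  qed
  ultimately show ?thesis unfolding polys_iff by blast
qed

lemma polys_const: "(\<lambda>x. k) \<in> polys"
  using hom_polys_const by (rule hom_polys_polys)

lemma polys_sum:
  "(\<And>i. i \<in> A \<Longrightarrow> f i \<in> polys) \<Longrightarrow> (\<lambda>x. \<Sum>i\<in>A. f i x) \<in> polys"
  by (induction A rule: infinite_finite_induct) (auto simp: polys_const polys_add)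

lemma polys_induct [consumes 1, case_names hom add]:
  assumes "f \<in> polys"
    and "\<And>n f. f \<in> hom_polys n \<Longrightarrow> Q f"
    and "\<And>f g. f \<in> polys \<Longrightarrow> g \<in> polys \<Longrightarrow> Q f \<Longrightarrow> Q g \<Longrightarrow> Q (\<lambda>x. f x + g x)"
  shows "Q f"
proof -
  obtain n g where g: "\<And>k. g k \<in> hom_polys k" "f = (\<lambda>x. \<Sum>k\<le>n. g k x)"
    using assms(1) unfolding polys_iff by blast
  have "Q (\<lambda>x. \<Sum>k\<le>n. g k x)"
  proof (induction n)
    case 0
    then show ?case using assms(2)[OF g(1)] by simp
  next
    case (Suc n)
    have "(\<lambda>x. \<Sum>k\<le>n. g k x) \<in> polys" using g(1) unfolding polys_iff by blast
    then show ?case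
      using assms(3)[OF _ hom_polys_polys[OF g(1)] Suc assms(2)[OF g(1)]] by simp
  qed
  then show ?thesis by (simp add: g(2))
qed

lemma polys_mult: "f \<in> polys \<Longrightarrow> g \<in> polys \<Longrightarrow> (\<lambda>x. f x * g x) \<in> polys"
proof (induction f rule: polys_induct)
  case (hom m f)
  from hom(2) show ?case
  proof (induction g rule: polys_induct)
    case (hom n g)
    then show ?case using hom_polys_mult \<open>f \<in> _\<close> hom_polys_polys by blast
  next
    case (add g g')
    from polys_add[OF add(3,4)] show ?case by (simp add: algebra_simps)
  qed
next
  case (add f f')
  from polys_add[OF add(3,4)] add show ?case by (simp add: algebra_simps)
qed

lemma polys_smult: "f \<in> polys \<Longrightarrow> (\<lambda>x. k * f x) \<in> polys"
  using polys_mult[OF polys_const] by simp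

lemma polys_diff: "f \<in> polys \<Longrightarrow> g \<in> polys \<Longrightarrow> (\<lambda>x. f x - g x) \<in> polys"
  using polys_add[OF _ polys_smult[of g "-1"]] by simp

lemma polys_comp: "f \<in> polys \<Longrightarrow> linear_map u \<Longrightarrow> f \<circ> u \<in> polys"
proof (induction rule: polys_induct)
  case (hom n f)
  then show ?case using hom_polys_comp hom_polys_polys by blast
next
  case (add f g)
  then show ?case using polys_add[of "f \<circ> u" "g \<circ> u"] by (simp add: o_def)
qed

lemma dual_polys: "f \<in> dual D \<Longrightarrow> f \<in> polys"
  using dual_hom_polys hom_polys_polys by blast

text \<open>Components of positive degree vanish at 0, so the component of degree 0 is the value
  there. This isolates the constant term of a multiplier from the part that raises degrees.\<close>

lemma polys_split:
  assumes "f \<in> polys"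
  obtains n g where "\<And>k. g k \<in> hom_polys (Suc k)" "f = (\<lambda>x. f 0 + (\<Sum>k<n. g k x))"
proof -
  obtain n g where g: "\<And>k. g k \<in> hom_polys k" "f = (\<lambda>x. \<Sum>k\<le>n. g k x)"
    using assms(1) unfolding polys_iff by blast
  have f: "f x = g 0 x + (\<Sum>k<n. g (Suc k) x)" for x
    using g(2) by (simp add: sum.atMost_shift)
  have "f 0 = g 0 0" using f[of 0] hom_polys_at_0[OF g(1)] by simp
  moreover have "g 0 x = g 0 0" for x using hom_polys_const_iff[OF g(1)[of 0]] by metis
  ultimately have "f = (\<lambda>x. f 0 + (\<Sum>k<n. g (Suc k) x))" using f by fastforce
  then show ?thesis using that[of "\<lambda>k. g (Suc k)"] g(1) by blast
qed

section \<open>Zeros and divisibility of polynomial functions\<close>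

lemma polys_on_line:
  assumes "f \<in> polys" shows "\<exists>p. \<forall>t. f (x + scale D t y) = poly p t"
  using assms
proof (induction rule: polys_induct)
  case (hom n f)
  then show ?case
  proof (induction rule: hom_polys_induct)
    case (const k)
    then show ?case by (intro exI[of _ "[:k:]"]) simp
  next
    case (mult l n g)
    then obtain p where "\<forall>t. g (x + scale D t y) = poly p t" by blast
    then show ?case using mult(1)
      by (intro exI[of _ "[:l x, l y:] * p"]) (simp add: dual_add dual_scale algebra_simps)
  next
    case (add n f g)
    then show ?case by (metis poly_add)
  qed
next
  case (add f g)
  then show ?case by (metis poly_add)
qed

text \<open>Restricting to the line through two points reduces this to one variable.\<close>

lemma polys_mult_eq_0_on_subspace:
  assumes f: "f \<in> polys" and g: "g \<in> polys" and U: "V.subspace U"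
    and fg: "\<And>x. x \<in> U \<Longrightarrow> f x * g x = 0" and x: "x \<in> U" "f x \<noteq> 0" and y: "y \<in> U"
  shows "g y = 0"
proof (rule ccontr)
  assume gy: "g y \<noteq> 0"
  obtain p q where p: "\<And>t. f (x + scale D t (y - x)) = poly p t"
    and q: "\<And>t. g (x + scale D t (y - x)) = poly q t"
    using polys_on_line[OF f] polys_on_line[OF g] by metis
  have "poly (p * q) t = 0" for t
  proof -
    have "x + scale D t (y - x) \<in> U"
      using U x(1) y by (intro V.subspace_add V.subspace_scale V.subspace_diff)
    from fg[OF this] show ?thesis by (simp add: p q)
  qed
  then have "p * q = 0" using poly_all_0_iff_0 by blast
  moreover have "poly p 0 \<noteq> 0" using p[of 0] x(2) by simp
  moreover have "poly q 1 \<noteq> 0" using q[of 1] gy by simp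
  ultimately show False by auto
qed

lemma polys_cancel:
  assumes "f \<in> polys" "g \<in> polys" "h \<in> polys" "\<And>x. f x * g x = f x * h x" "f x \<noteq> 0"
  shows "g = h"
proof
  fix y
  show "g y = h y"
    using polys_mult_eq_0_on_subspace[OF assms(1) polys_diff[OF assms(2,3)] V.subspace_UNIV, of x y]
      assms(4,5) by (simp add: algebra_simps)
qed

text \<open>Demazure operators are the case where \<open>v\<close> is the coroot of \<open>a\<close>. With half the coroot,
  \<open>x \<mapsto> x - a(x) v\<close> is a projection onto the kernel of \<open>a\<close>, so that the quotient divides \<open>f\<close> by \<open>a\<close>
  if \<open>f\<close> vanishes there.\<close>

lemma hom_polys_transvection_quotient:
  assumes "f \<in> hom_polys n" "a \<in> dual D"
  shows "\<exists>g. (n = 0 \<longrightarrow> g = (\<lambda>x. 0)) \<and> (0 < n \<longrightarrow> g \<in> hom_polys (n - 1)) \<and>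
    (\<forall>x. a x * g x = f x - f (x - scale D (a x) v))"
  using assms
proof (induction rule: hom_polys_induct)
  case (const k)
  then show ?case by auto
next
  case (mult l n g)
  then obtain q where q: "n = 0 \<Longrightarrow> q = (\<lambda>x. 0)" "0 < n \<Longrightarrow> q \<in> hom_polys (n - 1)"
    and qe: "\<And>x. a x * q x = g x - g (x - scale D (a x) v)" by blast
  \<comment> \<open>Twisted Leibniz rule, with the transvection applied to \<open>g\<close>; the
    number \<open>l v\<close> is the quotient belonging to the linear factor
    \<open>l\<close>.\<close>
  define q' where "q' x = l v * (g \<circ> (\<lambda>x. x - scale D (a x) v)) x + l x * q x" for x
  have "a x * q' x = l x * g x - l (x - scale D (a x) v) * g (x - scale D (a x) v)" for x
  proof -
    have "a x * q' x = a x * l v * g (x - scale D (a x) v) + l x * (a x * q x)"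
      by (simp add: q'_def algebra_simps)
    then show ?thesis using mult(1) by (simp add: qe dual_diff dual_scale algebra_simps)
  qed
  moreover have "q' \<in> hom_polys n"
  proof -
    have "(\<lambda>x. l x * q x) \<in> hom_polys n"
      using q hom_polys_dual_mult[OF mult(1), of q "n - 1"] by (cases n) (auto simp: hom_polys_zero)
    then show ?thesis unfolding q'_def
      by (intro hom_polys_add hom_polys_smult hom_polys_comp mult(2) linear_map_transvection mult(4))
  qed
  ultimately show ?case by (intro exI[of _ q']) auto
next
  case (add n f g)
  then obtain p q where "n = 0 \<Longrightarrow> p = (\<lambda>x. 0)" "0 < n \<Longrightarrow> p \<in> hom_polys (n - 1)"
    "\<And>x. a x * p x = f x - f (x - scale D (a x) v)"
    "n = 0 \<Longrightarrow> q = (\<lambda>x. 0)" "0 < n \<Longrightarrow> q \<in> hom_polys (n - 1)"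
    "\<And>x. a x * q x = g x - g (x - scale D (a x) v)" by blast
  then show ?case
    by (intro exI[of _ "\<lambda>x. p x + q x"]) (auto simp: hom_polys_add algebra_simps)
qed

lemma polys_transvection_quotient:
  assumes "f \<in> polys" "a \<in> dual D"
  shows "\<exists>g\<in>polys. \<forall>x. a x * g x = f x - f (x - scale D (a x) v)"
  using assms(1)
proof (induction rule: polys_induct)
  case (hom n f)
  obtain g where "n = 0 \<longrightarrow> g = (\<lambda>x. 0)" "0 < n \<longrightarrow> g \<in> hom_polys (n - 1)"
    "\<forall>x. a x * g x = f x - f (x - scale D (a x) v)"
    using hom_polys_transvection_quotient[OF hom assms(2)] by blast
  then show ?case using hom_polys_polys polys_const by (cases n) auto
next
  case (add f g)
  then obtain p q where "p \<in> polys" "\<And>x. a x * p x = f x - f (x - scale D (a x) v)"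
    "q \<in> polys" "\<And>x. a x * q x = g x - g (x - scale D (a x) v)" by blast
  then show ?case
    by (intro bexI[of _ "\<lambda>x. p x + q x"]) (auto simp: polys_add algebra_simps)
qed


subsection \<open>Roots and reflections\<close>

abbreviation "\<Phi> \<equiv> roots D"
abbreviation "\<Delta> \<equiv> simple_roots D"
abbreviation "\<Phi>\<^sub>p \<equiv> pos_roots D"
abbreviation "\<sigma> \<equiv> reflection D"
abbreviation neg :: "('h \<Rightarrow> complex) \<Rightarrow> 'h \<Rightarrow> complex" where "neg \<beta> \<equiv> (\<lambda>x. - \<beta> x)"

lemma finite_roots: "finite \<Phi>"
  and root_dual: "\<alpha> \<in> \<Phi> \<Longrightarrow> \<alpha> \<in> dual D"
  and dual_root_span: "f \<in> dual D \<Longrightarrow> \<exists>k. f = (\<lambda>x. \<Sum>\<alpha>\<in>\<Phi>. k \<alpha> * \<alpha> x)"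
  and coroot_2: "\<alpha> \<in> \<Phi> \<Longrightarrow> \<alpha> (coroot D \<alpha>) = 2"
  and cartan_Ints: "\<alpha> \<in> \<Phi> \<Longrightarrow> \<beta> \<in> \<Phi> \<Longrightarrow> \<beta> (coroot D \<alpha>) \<in> \<int>"
  and root_reflect: "\<alpha> \<in> \<Phi> \<Longrightarrow> \<beta> \<in> \<Phi> \<Longrightarrow> (\<lambda>x. \<beta> x - \<beta> (coroot D \<alpha>) * \<alpha> x) \<in> \<Phi>"
  and reduced_roots: "\<alpha> \<in> \<Phi> \<Longrightarrow> (\<lambda>x. c * \<alpha> x) \<in> \<Phi> \<Longrightarrow> c = 1 \<or> c = -1"
  and simple_root: "\<alpha> \<in> \<Delta> \<Longrightarrow> \<alpha> \<in> \<Phi>"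
  and simple_indep: "(\<And>x. (\<Sum>\<alpha>\<in>\<Delta>. k \<alpha> * \<alpha> x) = 0) \<Longrightarrow> \<alpha> \<in> \<Delta> \<Longrightarrow> k \<alpha> = 0"
  and pos_or_neg: "\<beta> \<in> \<Phi> \<Longrightarrow> \<beta> \<in> \<Phi>\<^sub>p \<or> neg \<beta> \<in> \<Phi>\<^sub>p"
  using datum unfolding semisimple_root_datum_def by blast+

lemma finite_simple: "finite \<Delta>"
  using finite_roots simple_root by (meson finite_subset subsetI)

lemma pos_root: "\<beta> \<in> \<Phi>\<^sub>p \<Longrightarrow> \<beta> \<in> \<Phi>"
  by (simp add: pos_roots_def)

lemma finite_pos: "finite \<Phi>\<^sub>p"
  using finite_roots pos_root by (meson finite_subset subsetI)

lemma simple_dual: "\<alpha> \<in> \<Delta> \<Longrightarrow> \<alpha> \<in> dual D"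
  by (simp add: root_dual simple_root)

lemma dual_comp_refl:
  "f \<in> dual D \<Longrightarrow> f \<circ> \<sigma> \<alpha> = (\<lambda>x. f x - f (coroot D \<alpha>) * \<alpha> x)"
  by (auto simp: reflection_def dual_diff dual_scale)

lemma root_comp_refl: "\<alpha> \<in> \<Phi> \<Longrightarrow> \<beta> \<in> \<Phi> \<Longrightarrow> \<beta> \<circ> \<sigma> \<alpha> \<in> \<Phi>"
  by (simp add: dual_comp_refl root_dual root_reflect)

lemma linear_refl: "\<alpha> \<in> \<Phi> \<Longrightarrow> linear_map (\<sigma> \<alpha>)"
  using linear_map_transvection[OF root_dual] by (simp add: reflection_def[abs_def])

lemma refl_refl: "\<alpha> \<in> \<Phi> \<Longrightarrow> \<sigma> \<alpha> (\<sigma> \<alpha> x) = x"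
  by (simp add: reflection_def dual_diff dual_scale root_dual coroot_2)

lemma refl_o_refl: "\<alpha> \<in> \<Phi> \<Longrightarrow> \<sigma> \<alpha> \<circ> \<sigma> \<alpha> = id"
  by (auto simp: refl_refl)

lemma root_comp_refl_self: "\<alpha> \<in> \<Phi> \<Longrightarrow> \<alpha> \<circ> \<sigma> \<alpha> = neg \<alpha>"
  by (simp add: dual_comp_refl root_dual coroot_2)

lemma root_neg: "\<alpha> \<in> \<Phi> \<Longrightarrow> neg \<alpha> \<in> \<Phi>"
  using root_comp_refl[of \<alpha> \<alpha>] by (simp add: root_comp_refl_self)

lemma root_nonzero: "(\<lambda>x. 0) \<notin> \<Phi>"
  using coroot_2 by force

text \<open>The difference of two candidates for the coroot gives a transvection permuting the roots.
  It has finite order, so it is the identity.\<close>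

lemma coroot_unique:
  assumes \<alpha>: "\<alpha> \<in> \<Phi>" and v: "\<alpha> v = 2"
    and perm: "\<And>\<beta>. \<beta> \<in> \<Phi> \<Longrightarrow> \<beta> \<circ> (\<lambda>x. x - scale D (\<alpha> x) v) \<in> \<Phi>"
  shows "coroot D \<alpha> = v"
proof (rule dual_separates)
  let ?u = "coroot D \<alpha>"
  have root: "\<beta> ?u = \<beta> v" if \<beta>: "\<beta> \<in> \<Phi>" for \<beta>
  proof (rule ccontr)
    assume ne: "\<beta> ?u \<noteq> \<beta> v"
    define d where "d = \<beta> v - \<beta> ?u"
    \<comment> \<open>The orbit of \<beta> under the transvection: each application adds
      \<open>d\<close> times \<alpha>, so a nonzero \<open>d\<close> would produce infinitely many
      roots.\<close>
    define b where "b n = (\<lambda>x. \<beta> x + of_nat n * d * \<alpha> x)" for n :: nat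
    have b: "b n \<in> \<Phi>" for n
    proof (induction n)
      case 0
      then show ?case using \<beta> by (simp add: b_def)
    next
      case (Suc n)
      have "b n \<circ> (\<lambda>x. x - scale D (\<alpha> x) v) \<circ> \<sigma> \<alpha> \<in> \<Phi>"
        using Suc \<alpha> by (intro root_comp_refl perm)
      moreover have "b n \<circ> (\<lambda>x. x - scale D (\<alpha> x) v) \<circ> \<sigma> \<alpha> = b (Suc n)"
      proof
        fix x
        have a: "\<alpha> (\<sigma> \<alpha> x) = - \<alpha> x"
          using root_comp_refl_self[OF \<alpha>] by (metis comp_apply)
        have "(b n \<circ> (\<lambda>x. x - scale D (\<alpha> x) v) \<circ> \<sigma> \<alpha>) x = b n (\<sigma> \<alpha> x) + \<alpha> x * b n v"
          using root_dual[OF Suc] by (simp add: a dual_diff dual_scale dual_uminus dual_add)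
        also have "\<dots> = b n x - \<alpha> x * b n ?u + \<alpha> x * b n v"
          using root_dual[OF Suc] by (simp add: reflection_def dual_diff dual_scale)
        also have "\<dots> = b (Suc n) x"
          using v \<alpha> by (simp add: b_def coroot_2 d_def algebra_simps)
        finally show "(b n \<circ> (\<lambda>x. x - scale D (\<alpha> x) v) \<circ> \<sigma> \<alpha>) x = b (Suc n) x" .
      qed
      ultimately show ?case by simp
    qed
    have "inj b"
    proof (rule injI)
      fix m n assume "b m = b n"
      then have "b m v = b n v" by simp
      then show "m = n" using ne v by (simp add: b_def d_def)
    qed
    then have "infinite (range b)" by (simp add: finite_image_iff)
    then show False using b finite_roots by (meson finite_subset image_subsetI)
  qed
  fix f assume "f \<in> dual D"
  then obtain k where "f = (\<lambda>x. \<Sum>\<gamma>\<in>\<Phi>. k \<gamma> * \<gamma> x)" using dual_root_span by blast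
  then show "f ?u = f v" using root by (auto intro!: sum.cong)
qed

text \<open>Conjugating the reflection in \<beta> by the reflection in \<alpha> again permutes the
  roots, and it is the transvection given by \<open>\<beta> \<circ> \<sigma> \<alpha>\<close> and
  the reflected coroot. Uniqueness of coroots does the rest.\<close>

lemma coroot_comp_refl:
  assumes "\<alpha> \<in> \<Phi>" "\<beta> \<in> \<Phi>" shows "coroot D (\<beta> \<circ> \<sigma> \<alpha>) = \<sigma> \<alpha> (coroot D \<beta>)"
proof (rule coroot_unique)
  show "(\<beta> \<circ> \<sigma> \<alpha>) (\<sigma> \<alpha> (coroot D \<beta>)) = 2"
    using assms by (simp add: refl_refl coroot_2)
  fix \<gamma> assume \<gamma>: "\<gamma> \<in> \<Phi>"
  have "(\<lambda>x. x - scale D ((\<beta> \<circ> \<sigma> \<alpha>) x) (\<sigma> \<alpha> (coroot D \<beta>)))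
      = (\<lambda>x. \<sigma> \<alpha> (\<sigma> \<beta> (\<sigma> \<alpha> x)))"
  proof
    fix x
    have lin: "\<sigma> \<alpha> (y - scale D k z) = \<sigma> \<alpha> y - scale D k (\<sigma> \<alpha> z)" for y z k
      using linear_refl[OF assms(1)] unfolding linear_map_def
      by (metis add_diff_cancel diff_add_cancel)
    show "x - scale D ((\<beta> \<circ> \<sigma> \<alpha>) x) (\<sigma> \<alpha> (coroot D \<beta>)) = \<sigma> \<alpha> (\<sigma> \<beta> (\<sigma> \<alpha> x))"
      unfolding reflection_def[of D \<beta>] lin using assms by (simp add: refl_refl)
  qed
  then have "\<gamma> \<circ> (\<lambda>x. x - scale D ((\<beta> \<circ> \<sigma> \<alpha>) x) (\<sigma> \<alpha> (coroot D \<beta>)))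
      = \<gamma> \<circ> \<sigma> \<alpha> \<circ> \<sigma> \<beta> \<circ> \<sigma> \<alpha>" by auto
  then show "\<gamma> \<circ> (\<lambda>x. x - scale D ((\<beta> \<circ> \<sigma> \<alpha>) x) (\<sigma> \<alpha> (coroot D \<beta>))) \<in> \<Phi>"
    using assms \<gamma> by (simp add: root_comp_refl)
qed (use assms in \<open>rule root_comp_refl\<close>)

lemma coroot_neg: "\<beta> \<in> \<Phi> \<Longrightarrow> coroot D (neg \<beta>) = - coroot D \<beta>"
  using coroot_comp_refl[of \<beta> \<beta>]
  by (simp add: root_comp_refl_self reflection_def coroot_2 V.scale_left_distrib[of 1 1, simplified])

lemma refl_neg: "\<beta> \<in> \<Phi> \<Longrightarrow> \<sigma> (neg \<beta>) = \<sigma> \<beta>"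
  by (auto simp: reflection_def coroot_neg)

lemma refl_comp_refl:
  assumes "\<alpha> \<in> \<Phi>" "\<beta> \<in> \<Phi>" shows "\<sigma> (\<beta> \<circ> \<sigma> \<alpha>) = \<sigma> \<alpha> \<circ> \<sigma> \<beta> \<circ> \<sigma> \<alpha>"
proof
  fix x
  have lin: "\<sigma> \<alpha> (y - scale D k z) = \<sigma> \<alpha> y - scale D k (\<sigma> \<alpha> z)" for y z k
    using linear_refl[OF assms(1)] unfolding linear_map_def
    by (metis add_diff_cancel diff_add_cancel)
  show "\<sigma> (\<beta> \<circ> \<sigma> \<alpha>) x = (\<sigma> \<alpha> \<circ> \<sigma> \<beta> \<circ> \<sigma> \<alpha>) x"
    unfolding o_apply reflection_def[of D \<beta>] lin
    using assms by (simp add: refl_refl reflection_def[of D "\<beta> \<circ> \<sigma> \<alpha>"] coroot_comp_refl[unfolded o_def] o_def)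
      (simp add: reflection_def[of D "\<lambda>x. \<beta> (\<sigma> \<alpha> x)"] coroot_comp_refl[unfolded o_def])
qed


subsection \<open>Positive roots\<close>

lemma simple_pos: assumes "\<alpha> \<in> \<Delta>" shows "\<alpha> \<in> \<Phi>\<^sub>p"
proof -
  have "\<alpha> x = (\<Sum>\<gamma>\<in>\<Delta>. of_nat (if \<gamma> = \<alpha> then 1 else 0) * \<gamma> x)" for x
    using assms finite_simple by (simp add: if_distrib[of of_nat] if_distrib[of "\<lambda>k. k * _"] cong: if_cong)
  then have "\<exists>n :: _ \<Rightarrow> nat. \<alpha> = (\<lambda>x. \<Sum>\<gamma>\<in>\<Delta>. of_nat (n \<gamma>) * \<gamma> x)"
    by (intro exI[of _ "\<lambda>\<gamma>. if \<gamma> = \<alpha> then 1 else 0"]) blast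
  then show ?thesis using simple_root[OF assms] by (simp add: pos_roots_def)
qed

text \<open>Adding the two expansions gives a linear relation between simple roots with natural
  coefficients. Independence makes all of them zero, but a root is not zero.\<close>

lemma not_pos_neg: assumes "\<beta> \<in> \<Phi>\<^sub>p" shows "neg \<beta> \<notin> \<Phi>\<^sub>p"
proof
  assume "neg \<beta> \<in> \<Phi>\<^sub>p"
  then obtain n where n: "neg \<beta> = (\<lambda>x. \<Sum>\<alpha>\<in>\<Delta>. of_nat (n \<alpha> :: nat) * \<alpha> x)"
    by (auto simp: pos_roots_def)
  obtain m where m: "\<beta> = (\<lambda>x. \<Sum>\<alpha>\<in>\<Delta>. of_nat (m \<alpha> :: nat) * \<alpha> x)"
    using assms by (auto simp: pos_roots_def)
  have "(\<Sum>\<alpha>\<in>\<Delta>. of_nat (n \<alpha> + m \<alpha>) * \<alpha> x) = 0" for x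
  proof -
    have "(\<Sum>\<alpha>\<in>\<Delta>. of_nat (n \<alpha> + m \<alpha>) * \<alpha> x)
        = (\<Sum>\<alpha>\<in>\<Delta>. of_nat (n \<alpha>) * \<alpha> x) + (\<Sum>\<alpha>\<in>\<Delta>. of_nat (m \<alpha>) * \<alpha> x)"
      by (simp add: sum.distrib distrib_right)
    also have "\<dots> = - \<beta> x + \<beta> x" using fun_cong[OF n, of x] fun_cong[OF m, of x] by metis
    finally show ?thesis by simp
  qed
  from simple_indep[OF this] have "m \<alpha> = 0" if "\<alpha> \<in> \<Delta>" for \<alpha>
    using that by (metis add_is_0 of_nat_eq_0_iff)
  then have "\<beta> = (\<lambda>x. 0)" using m by simp
  then show False using pos_root[OF assms] root_nonzero by simp
qed

lemma neg_pos_iff: "\<beta> \<in> \<Phi> \<Longrightarrow> neg \<beta> \<in> \<Phi>\<^sub>p \<longleftrightarrow> \<beta> \<notin> \<Phi>\<^sub>p"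
  using pos_or_neg not_pos_neg by blast

text \<open>The reflection changes only the coefficient of \<alpha>. If the result were negative,
  all other coefficients of \<beta> would vanish, so \<beta> would be a multiple of \<alpha>, hence
  equal to it because the system is reduced and natural numbers are not -1.\<close>

lemma pos_comp_simple_refl:
  assumes \<alpha>: "\<alpha> \<in> \<Delta>" and \<beta>: "\<beta> \<in> \<Phi>\<^sub>p" "\<beta> \<noteq> \<alpha>" shows "\<beta> \<circ> \<sigma> \<alpha> \<in> \<Phi>\<^sub>p"
proof (rule ccontr)
  have root: "\<beta> \<circ> \<sigma> \<alpha> \<in> \<Phi>" using \<alpha> \<beta> by (simp add: pos_root simple_root root_comp_refl)
  assume "\<beta> \<circ> \<sigma> \<alpha> \<notin> \<Phi>\<^sub>p"
  then have "neg (\<beta> \<circ> \<sigma> \<alpha>) \<in> \<Phi>\<^sub>p" using pos_or_neg[OF root] by blast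
  then obtain n where n: "neg (\<beta> \<circ> \<sigma> \<alpha>) = (\<lambda>x. \<Sum>\<gamma>\<in>\<Delta>. of_nat (n \<gamma> :: nat) * \<gamma> x)"
    by (auto simp: pos_roots_def)
  obtain m where m: "\<beta> = (\<lambda>x. \<Sum>\<gamma>\<in>\<Delta>. of_nat (m \<gamma> :: nat) * \<gamma> x)"
    using \<beta>(1) by (auto simp: pos_roots_def)
  define k where "k = \<beta> (coroot D \<alpha>)"
  have "(\<Sum>\<gamma>\<in>\<Delta>. (of_nat (n \<gamma> + m \<gamma>) - (if \<gamma> = \<alpha> then k else 0)) * \<gamma> x) = 0" for x
  proof -
    have "- (\<beta> x - k * \<alpha> x) = (\<Sum>\<gamma>\<in>\<Delta>. of_nat (n \<gamma>) * \<gamma> x)"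
      using fun_cong[OF n, of x] root_dual[OF pos_root[OF \<beta>(1)]] by (simp add: dual_comp_refl k_def)
    moreover have "(\<Sum>\<gamma>\<in>\<Delta>. (if \<gamma> = \<alpha> then k else 0) * \<gamma> x) = k * \<alpha> x"
      using \<alpha> finite_simple by (simp add: if_distrib[of "\<lambda>k. k * _"] cong: if_cong)
    ultimately show ?thesis
      using fun_cong[OF m, of x] by (simp add: sum.distrib sum_subtractf algebra_simps)
  qed
  note indep = simple_indep[OF this]
  have "of_nat (n \<gamma> + m \<gamma>) = (0::complex)" if "\<gamma> \<in> \<Delta>" "\<gamma> \<noteq> \<alpha>" for \<gamma>
    using indep[OF that(1)] that(2) by simp
  then have "m \<gamma> = 0" if "\<gamma> \<in> \<Delta>" "\<gamma> \<noteq> \<alpha>" for \<gamma>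
    using that by (metis add_is_0 of_nat_eq_0_iff)
  then have "\<beta> x = (\<Sum>\<gamma>\<in>\<Delta>. if \<gamma> = \<alpha> then of_nat (m \<alpha>) * \<alpha> x else 0)" for x
    unfolding fun_cong[OF m, of x] by (intro sum.cong) auto
  then have eq: "\<beta> = (\<lambda>x. of_nat (m \<alpha>) * \<alpha> x)" using \<alpha> finite_simple by auto
  then have "of_nat (m \<alpha>) = (1::complex) \<or> of_nat (m \<alpha>) = (-1::complex)"
    using reduced_roots[OF simple_root[OF \<alpha>]] pos_root[OF \<beta>(1)] by metis
  then have "of_nat (m \<alpha>) = (1::complex)"
    by (auto dest: arg_cong[where f = Re])
  then show False using \<beta>(2) eq by simp
qed

lemma comp_refl_refl: "\<alpha> \<in> \<Phi> \<Longrightarrow> f \<circ> \<sigma> \<alpha> \<circ> \<sigma> \<alpha> = f"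
  by (auto simp: refl_refl)

text \<open>Positivity of the invariant form \<open>(x, y) \<mapsto> \<Sum>\<^sub>\<gamma> x(\<gamma>\<^sup>\<or>) y(\<gamma>\<^sup>\<or>)\<close> on the roots.\<close>

lemma pos_root_not_antidominant:
  assumes \<beta>: "\<beta> \<in> \<Phi>\<^sub>p" shows "\<exists>\<alpha>\<in>\<Delta>. 0 < Re (\<beta> (coroot D \<alpha>))"
proof (rule ccontr)
  assume neg: "\<not> (\<exists>\<alpha>\<in>\<Delta>. 0 < Re (\<beta> (coroot D \<alpha>)))"
  define B where "B f g = (\<Sum>\<gamma>\<in>\<Phi>. f (coroot D \<gamma>) * g (coroot D \<gamma>))" for f g :: "'h \<Rightarrow> complex"
  have inv: "B (f \<circ> \<sigma> \<alpha>) (g \<circ> \<sigma> \<alpha>) = B f g" if \<alpha>: "\<alpha> \<in> \<Phi>" for f g \<alpha>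
    unfolding B_def
    by (rule sum.reindex_bij_witness[of _ "\<lambda>\<gamma>. \<gamma> \<circ> \<sigma> \<alpha>" "\<lambda>\<gamma>. \<gamma> \<circ> \<sigma> \<alpha>"])
      (use \<alpha> in \<open>simp_all add: comp_refl_refl root_comp_refl coroot_comp_refl\<close>)
  have lin: "B (\<lambda>x. f x - k * h x) g = B f g - k * B h g" for f g h k
    by (simp add: B_def sum_subtractf sum_distrib_left algebra_simps)
  have cartan: "2 * B \<beta> \<alpha> = \<beta> (coroot D \<alpha>) * B \<alpha> \<alpha>" if \<alpha>: "\<alpha> \<in> \<Phi>" for \<alpha>
  proof -
    have "B \<beta> \<alpha> = B (\<beta> \<circ> \<sigma> \<alpha>) (\<alpha> \<circ> \<sigma> \<alpha>)" using inv[OF \<alpha>] by simp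
    also have "\<dots> = - B (\<beta> \<circ> \<sigma> \<alpha>) \<alpha>"
      by (simp add: root_comp_refl_self[OF \<alpha>] B_def sum_negf)
    also have "\<dots> = - B \<beta> \<alpha> + \<beta> (coroot D \<alpha>) * B \<alpha> \<alpha>"
      by (simp add: dual_comp_refl root_dual[OF pos_root[OF \<beta>]] lin)
    finally show ?thesis by simp
  qed
  \<comment> \<open>Values of roots at coroots are integers, so \<open>B \<alpha> \<alpha>\<close>
    is a sum of squares of real numbers, in which \<alpha> itself contributes 4.\<close>
  have posdef: "\<exists>r>0. B \<alpha> \<alpha> = complex_of_real r" if \<alpha>: "\<alpha> \<in> \<Phi>" for \<alpha>
  proof -
    define r where "r = (\<Sum>\<gamma>\<in>\<Phi>. (Re (\<alpha> (coroot D \<gamma>)))\<^sup>2)"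
    have "\<alpha> (coroot D \<gamma>) = complex_of_real (Re (\<alpha> (coroot D \<gamma>)))" if "\<gamma> \<in> \<Phi>" for \<gamma>
      using cartan_Ints[OF that \<alpha>] by (metis Ints_cases Re_complex_of_real of_real_of_int_eq)
    then have "B \<alpha> \<alpha> = complex_of_real r"
      unfolding B_def r_def of_real_sum by (intro sum.cong) (simp_all add: power2_eq_square)
    moreover have "(Re (\<alpha> (coroot D \<alpha>)))\<^sup>2 \<le> r"
      unfolding r_def using finite_roots \<alpha> by (intro member_le_sum) auto
    ultimately show ?thesis using \<alpha> by (intro exI[of _ r]) (auto simp: coroot_2)
  qed
  obtain n where n: "\<beta> = (\<lambda>x. \<Sum>\<gamma>\<in>\<Delta>. of_nat (n \<gamma> :: nat) * \<gamma> x)"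
    using \<beta>(1) by (auto simp: pos_roots_def)
  have "B \<beta> \<beta> = (\<Sum>\<alpha>\<in>\<Delta>. of_nat (n \<alpha>) * B \<beta> \<alpha>)"
  proof -
    have "B \<beta> \<beta> = (\<Sum>\<gamma>\<in>\<Phi>. \<Sum>\<alpha>\<in>\<Delta>. \<beta> (coroot D \<gamma>) * (of_nat (n \<alpha>) * \<alpha> (coroot D \<gamma>)))"
      unfolding B_def by (intro sum.cong refl) (simp add: n flip: sum_distrib_left)
    also have "\<dots> = (\<Sum>\<alpha>\<in>\<Delta>. of_nat (n \<alpha>) * B \<beta> \<alpha>)"
      by (subst sum.swap) (simp add: B_def sum_distrib_left algebra_simps)
    finally show ?thesis .
  qed
  also have "Re \<dots> = (\<Sum>\<alpha>\<in>\<Delta>. real (n \<alpha>) * Re (B \<beta> \<alpha>))" by simp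
  also have "\<dots> \<le> 0"
  proof (intro sum_nonpos mult_nonneg_nonpos)
    fix \<alpha> assume \<alpha>: "\<alpha> \<in> \<Delta>"
    obtain r where "r > 0" "B \<alpha> \<alpha> = complex_of_real r" using posdef[OF simple_root[OF \<alpha>]] by blast
    then have "2 * Re (B \<beta> \<alpha>) = Re (\<beta> (coroot D \<alpha>)) * r"
      using arg_cong[OF cartan[OF simple_root[OF \<alpha>]], of Re] by simp
    moreover have "\<dots> \<le> 0" using neg \<alpha> \<open>r > 0\<close> by (simp add: mult_nonpos_nonneg not_less)
    ultimately show "Re (B \<beta> \<alpha>) \<le> 0" by linarith
  qed simp
  finally show False using posdef[OF pos_root[OF \<beta>]] by auto
qed


subsection \<open>The Weyl group\<close>


lemma word_Nil [simp]: "word D [] = id"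
  and word_Cons [simp]: "word D (\<alpha> # js) = \<sigma> \<alpha> \<circ> word D js"
  by (simp_all add: word_def)

lemma word_append: "word D (js @ ks) = word D js \<circ> word D ks"
  by (induction js) auto

lemma word_rev: "set js \<subseteq> \<Delta> \<Longrightarrow> word D (rev js) \<circ> word D js = id"
  by (induction js) (auto simp: word_append fun_eq_iff refl_refl simple_root)

lemma word_rev': "set js \<subseteq> \<Delta> \<Longrightarrow> word D js \<circ> word D (rev js) = id"
  using word_rev[of "rev js"] by simp

lemma bij_word: "set js \<subseteq> \<Delta> \<Longrightarrow> bij (word D js)"
  using word_rev word_rev' o_bij by blast

lemma inv_word: "set js \<subseteq> \<Delta> \<Longrightarrow> inv_into UNIV (word D js) = word D (rev js)"
  using word_rev word_rev' inv_unique_comp by blast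

lemma linear_word: "set js \<subseteq> \<Delta> \<Longrightarrow> linear_map (word D js)"
  by (induction js) (auto simp: linear_map_comp linear_refl simple_root, simp add: linear_map_def)

lemma root_comp_word: "set js \<subseteq> \<Delta> \<Longrightarrow> \<beta> \<in> \<Phi> \<Longrightarrow> \<beta> \<circ> word D js \<in> \<Phi>"
  by (induction js arbitrary: \<beta>) (auto simp: root_comp_refl simple_root simp flip: comp_assoc)

lemma refl_comp_word:
  "set js \<subseteq> \<Delta> \<Longrightarrow> \<beta> \<in> \<Phi> \<Longrightarrow> \<sigma> (\<beta> \<circ> word D js) = word D (rev js) \<circ> \<sigma> \<beta> \<circ> word D js"
proof (induction js arbitrary: \<beta>)
  case (Cons \<alpha> js)
  then have "\<sigma> ((\<beta> \<circ> \<sigma> \<alpha>) \<circ> word D js) = word D (rev js) \<circ> \<sigma> (\<beta> \<circ> \<sigma> \<alpha>) \<circ> word D js"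
    by (intro Cons.IH root_comp_refl) (auto simp: simple_root)
  moreover have "\<sigma> (\<beta> \<circ> \<sigma> \<alpha>) = \<sigma> \<alpha> \<circ> \<sigma> \<beta> \<circ> \<sigma> \<alpha>"
    using Cons.prems by (simp add: refl_comp_refl simple_root)
  ultimately show ?case
    by (simp only: rev.simps word_append word_Cons word_Nil comp_id comp_assoc)
qed simp

text \<open>Induction on the height of a positive root. A simple root pairing positively with it
  gives a simple reflection that lowers the height, and conjugating by that reflection adds two
  letters. The odd length later makes antisymmetric functions change sign under every
  reflection.\<close>

lemma refl_is_word:
  assumes "\<beta> \<in> \<Phi>" shows "\<exists>js. set js \<subseteq> \<Delta> \<and> word D js = \<sigma> \<beta> \<and> odd (length js)"
proof -
  have pos: "\<exists>js. set js \<subseteq> \<Delta> \<and> word D js = \<sigma> \<beta> \<and> odd (length js)"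
    if "\<beta> \<in> \<Phi>\<^sub>p" "\<beta> = (\<lambda>x. \<Sum>\<alpha>\<in>\<Delta>. of_nat (n \<alpha> :: nat) * \<alpha> x)" for \<beta> n
    using that
  proof (induction "sum n \<Delta>" arbitrary: n \<beta> rule: less_induct)
    case less
    obtain \<alpha> where \<alpha>: "\<alpha> \<in> \<Delta>" "0 < Re (\<beta> (coroot D \<alpha>))"
      using pos_root_not_antidominant less(2) by blast
    show ?case
    proof (cases "\<beta> = \<alpha>")
      case True
      then show ?thesis using \<alpha> by (intro exI[of _ "[\<alpha>]"]) simp
    next
      case False
      let ?\<beta> = "\<beta> \<circ> \<sigma> \<alpha>"
      have pos: "?\<beta> \<in> \<Phi>\<^sub>p" using pos_comp_simple_refl \<alpha>(1) less(2) False by blast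
      then obtain m where m: "?\<beta> = (\<lambda>x. \<Sum>\<gamma>\<in>\<Delta>. of_nat (m \<gamma> :: nat) * \<gamma> x)"
        by (auto simp: pos_roots_def)
      define k where "k = \<beta> (coroot D \<alpha>)"
      \<comment> \<open>Comparing the expansions of \<beta> and its reflection: they differ by
        \<open>k\<close> in the coefficient of \<alpha> and nowhere else, and \<open>k\<close> has
        positive real part.\<close>
      have "(\<Sum>\<gamma>\<in>\<Delta>. (of_nat (n \<gamma>) - of_nat (m \<gamma>) - (if \<gamma> = \<alpha> then k else 0)) * \<gamma> x) = 0" for x
      proof -
        have "\<beta> x - k * \<alpha> x = (\<Sum>\<gamma>\<in>\<Delta>. of_nat (m \<gamma>) * \<gamma> x)"
          using fun_cong[OF m, of x] root_dual[OF pos_root[OF less(2)]]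
          by (simp add: dual_comp_refl k_def)
        moreover have "(\<Sum>\<gamma>\<in>\<Delta>. (if \<gamma> = \<alpha> then k else 0) * \<gamma> x) = k * \<alpha> x"
          using \<alpha> finite_simple by (simp add: if_distrib[of "\<lambda>k. k * _"] cong: if_cong)
        ultimately show ?thesis
          using fun_cong[OF less(3), of x] by (simp add: sum_subtractf left_diff_distrib) (simp add: algebra_simps)
      qed
      note indep = simple_indep[OF this]
      have eq: "of_nat (n \<gamma>) - of_nat (m \<gamma>) = (if \<gamma> = \<alpha> then k else 0)" if "\<gamma> \<in> \<Delta>" for \<gamma>
        using indep[OF that] by simp
      have "Re (of_nat (n \<alpha>) - of_nat (m \<alpha>)) > 0" using eq[OF \<alpha>(1)] \<alpha>(2) by (simp add: k_def)
      then have "m \<alpha> < n \<alpha>" by simp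
      moreover have "m \<gamma> \<le> n \<gamma>" if "\<gamma> \<in> \<Delta>" for \<gamma>
      proof (cases "\<gamma> = \<alpha>")
        case False
        then have "complex_of_nat (n \<gamma>) = of_nat (m \<gamma>)" using eq[OF that] by simp
        then show ?thesis by simp
      qed (use calculation in simp)
      ultimately have "sum m \<Delta> < sum n \<Delta>" using \<alpha>(1) finite_simple by (intro sum_strict_mono_ex1) auto
      from less(1)[OF this pos m] obtain js where js: "set js \<subseteq> \<Delta>" "word D js = \<sigma> ?\<beta>" "odd (length js)"
        by blast
      have "\<sigma> \<beta> = \<sigma> (?\<beta> \<circ> \<sigma> \<alpha>)" using \<alpha> by (simp add: comp_refl_refl simple_root)
      also have "\<dots> = \<sigma> \<alpha> \<circ> \<sigma> ?\<beta> \<circ> \<sigma> \<alpha>"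
        using \<alpha>(1) pos by (intro refl_comp_refl) (auto simp: simple_root pos_root)
      finally have "word D (\<alpha> # js @ [\<alpha>]) = \<sigma> \<beta>" by (simp add: word_append js(2) o_assoc)
      then show ?thesis using js(1,3) \<alpha>(1) by (intro exI[of _ "\<alpha> # js @ [\<alpha>]"]) auto
    qed
  qed
  show ?thesis
  proof (cases "\<beta> \<in> \<Phi>\<^sub>p")
    case True
    then show ?thesis using pos by (auto simp: pos_roots_def)
  next
    case False
    then have "neg \<beta> \<in> \<Phi>\<^sub>p" using pos_or_neg assms by blast
    moreover from this obtain n where "neg \<beta> = (\<lambda>x. \<Sum>\<alpha>\<in>\<Delta>. of_nat (n \<alpha> :: nat) * \<alpha> x)"
      by (auto simp: pos_roots_def)
    ultimately have "\<exists>js. set js \<subseteq> \<Delta> \<and> word D js = \<sigma> (neg \<beta>) \<and> odd (length js)" by (rule pos)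
    then show ?thesis by (simp add: refl_neg assms)
  qed
qed

text \<open>Every reflection is a product of simple ones and is its own inverse, so words in the
  simple reflections exhaust the generated group. On bijections the product of
  \<open>BijGroup\<close> is plain composition.\<close>

lemma weyl_eq: "weyl D = word D ` {js. set js \<subseteq> \<Delta>}"
proof
  have refl_bij: "\<sigma> \<beta> \<in> Bij UNIV" if "\<beta> \<in> \<Phi>" for \<beta>
    using o_bij[OF refl_o_refl refl_o_refl] that by (simp add: Bij_def)
  have mult: "f \<otimes>\<^bsub>BijGroup UNIV\<^esub> g = f \<circ> g" if "bij f" "bij g" for f g :: "'h \<Rightarrow> 'h"
    using that by (simp add: BijGroup_def Bij_def compose_def o_def restrict_def fun_eq_iff)
  have one: "\<one>\<^bsub>BijGroup UNIV\<^esub> = (id :: 'h \<Rightarrow> 'h)"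
    by (auto simp: BijGroup_def)
  have m_inv: "inv\<^bsub>BijGroup UNIV\<^esub> (\<sigma> \<beta>) = \<sigma> \<beta>" if "\<beta> \<in> \<Phi>" for \<beta>
  proof -
    have "inv_into UNIV (\<sigma> \<beta>) = \<sigma> \<beta>"
      using refl_o_refl[OF that] by (metis inv_unique_comp)
    then show ?thesis using inv_BijGroup[OF refl_bij[OF that]] by (simp add: restrict_def)
  qed
  show "weyl D \<subseteq> word D ` {js. set js \<subseteq> \<Delta>}"
  proof
    fix w assume "w \<in> weyl D"
    then have "\<exists>js. set js \<subseteq> \<Delta> \<and> w = word D js"
      unfolding weyl_def
    proof (induction rule: generate.induct)
      case one
      then show ?case using \<open>\<one>\<^bsub>BijGroup UNIV\<^esub> = id\<close> by (intro exI[of _ "[]"]) simp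
    next
      case (incl h)
      then show ?case using refl_is_word by fastforce
    next
      case (inv h)
      then show ?case using refl_is_word m_inv by fastforce
    next
      case (eng h1 h2)
      then obtain js ks where "set js \<subseteq> \<Delta>" "h1 = word D js" "set ks \<subseteq> \<Delta>" "h2 = word D ks" by blast
      then show ?case using mult bij_word by (intro exI[of _ "js @ ks"]) (simp add: word_append)
    qed
    then show "w \<in> word D ` {js. set js \<subseteq> \<Delta>}" by blast
  qed
  show "word D ` {js. set js \<subseteq> \<Delta>} \<subseteq> weyl D"
  proof safe
    fix js assume "set js \<subseteq> \<Delta>"
    then show "word D js \<in> weyl D"
    proof (induction js)
      case Nil
      then show ?case using generate.one[of "BijGroup UNIV" "\<sigma> ` \<Phi>"] by (simp add: weyl_def flip: one)
    next
      case (Cons \<alpha> js)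
      then have "\<sigma> \<alpha> \<in> weyl D" "word D js \<in> weyl D"
        by (auto simp: weyl_def simple_root intro: generate.incl)
      then have "\<sigma> \<alpha> \<otimes>\<^bsub>BijGroup UNIV\<^esub> word D js \<in> weyl D" by (simp add: weyl_def generate.eng)
      moreover have "bij (\<sigma> \<alpha>)" "bij (word D js)"
        using Cons.prems refl_bij simple_root bij_word by (auto simp: Bij_def)
      ultimately show ?case unfolding word_Cons using mult by metis
    qed
  qed
qed

lemma weyl_cases:
  assumes "w \<in> weyl D" obtains js where "set js \<subseteq> \<Delta>" "w = word D js"
  using assms weyl_eq by auto

lemma word_weyl: "set js \<subseteq> \<Delta> \<Longrightarrow> word D js \<in> weyl D"
  using weyl_eq by auto

lemma id_weyl: "id \<in> weyl D"
  using word_weyl[of "[]"] by simp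

lemma weyl_comp: "v \<in> weyl D \<Longrightarrow> w \<in> weyl D \<Longrightarrow> v \<circ> w \<in> weyl D"
  by (elim weyl_cases) (metis le_sup_iff set_append word_append word_weyl)

lemma weyl_inv: "w \<in> weyl D \<Longrightarrow> inv_into UNIV w \<in> weyl D"
  by (elim weyl_cases) (simp add: inv_word word_weyl)

lemma weyl_bij: "w \<in> weyl D \<Longrightarrow> bij w"
  by (elim weyl_cases) (simp add: bij_word)

lemma weyl_inv_comp: "w \<in> weyl D \<Longrightarrow> inv_into UNIV w \<circ> w = id" "w \<in> weyl D \<Longrightarrow> w \<circ> inv_into UNIV w = id"
  by (meson bij_def inv_o_cancel surj_iff weyl_bij)+

lemma weyl_linear: "w \<in> weyl D \<Longrightarrow> linear_map w"
  by (elim weyl_cases) (simp add: linear_word)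

lemma weyl_root: "w \<in> weyl D \<Longrightarrow> \<beta> \<in> \<Phi> \<Longrightarrow> \<beta> \<circ> w \<in> \<Phi>"
  by (elim weyl_cases) (simp add: root_comp_word)

lemma refl_weyl: "\<alpha> \<in> \<Delta> \<Longrightarrow> \<sigma> \<alpha> \<in> weyl D"
  using word_weyl[of "[\<alpha>]"] by simp

text \<open>An element is determined by its permutation of the finite set of roots, because the
  roots span the dual space and functionals separate points.\<close>

lemma finite_weyl: "finite (weyl D)"
proof (rule finite_imageD)
  let ?F = "\<lambda>w. \<lambda>\<beta>\<in>\<Phi>. \<beta> \<circ> w"
  have "?F ` weyl D \<subseteq> \<Phi> \<rightarrow>\<^sub>E \<Phi>" using weyl_root by auto
  then show "finite (?F ` weyl D)"
    using finite_roots by (meson finite_PiE finite_subset)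
  show "inj_on ?F (weyl D)"
  proof (rule inj_onI)
    fix v w assume "v \<in> weyl D" "w \<in> weyl D" and eq: "?F v = ?F w"
    have root: "\<beta> (v x) = \<beta> (w x)" if "\<beta> \<in> \<Phi>" for \<beta> x
      using fun_cong[OF eq, of \<beta>] that by (auto simp: fun_eq_iff)
    show "v = w"
    proof
      fix x
      show "v x = w x"
      proof (rule dual_separates)
        fix f assume "f \<in> dual D"
        then obtain k where "f = (\<lambda>x. \<Sum>\<gamma>\<in>\<Phi>. k \<gamma> * \<gamma> x)" using dual_root_span by blast
        then show "f (v x) = f (w x)" using root by (auto intro!: sum.cong)
      qed
    qed
  qed
qed


subsection \<open>Inversions and length\<close>

text \<open>Deleting the \<open>i\<close>-th letter of a word multiplies the product from the right by the reflection
  in \<open>s\<^sub>k \<dots> s\<^sub>i\<^sub>+\<^sub>1 \<alpha>\<^sub>i\<close>, which is recorded along with the shortened word.\<close>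

primrec deletions :: "('h \<Rightarrow> complex) list \<Rightarrow> (('h \<Rightarrow> complex) \<times> ('h \<Rightarrow> complex) list) list" where
  "deletions [] = []"
| "deletions (\<alpha> # js) = (\<alpha> \<circ> word D js, js) # map (\<lambda>(\<gamma>, ks). (\<gamma>, \<alpha> # ks)) (deletions js)"

lemma word_Cons_deletion:
  assumes "set js \<subseteq> \<Delta>" "\<alpha> \<in> \<Delta>"
  shows "word D (\<alpha> # js) \<circ> \<sigma> (\<alpha> \<circ> word D js) = word D js"
proof -
  have "word D (\<alpha> # js) \<circ> \<sigma> (\<alpha> \<circ> word D js)
      = \<sigma> \<alpha> \<circ> (word D js \<circ> word D (rev js)) \<circ> \<sigma> \<alpha> \<circ> word D js"
    using refl_comp_word[OF assms(1) simple_root[OF assms(2)]] by (simp add: comp_assoc)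
  also have "\<dots> = word D js"
    unfolding word_rev'[OF assms(1)] by (simp add: refl_o_refl simple_root assms(2))
  finally show ?thesis .
qed

lemma deletionsD:
  assumes "(\<gamma>, ks) \<in> set (deletions js)" "set js \<subseteq> \<Delta>"
  shows "\<gamma> \<in> \<Phi>" "set ks \<subseteq> \<Delta>" "Suc (length ks) = length js" "word D ks = word D js \<circ> \<sigma> \<gamma>"
proof -
  have "\<gamma> \<in> \<Phi> \<and> set ks \<subseteq> \<Delta> \<and> Suc (length ks) = length js \<and> word D ks = word D js \<circ> \<sigma> \<gamma>"
    using assms
  proof (induction js arbitrary: ks)
    case (Cons \<alpha> js)
    from Cons.prems(1) consider (head) "\<gamma> = \<alpha> \<circ> word D js" "ks = js"
      | (tail) ks' where "(\<gamma>, ks') \<in> set (deletions js)" "ks = \<alpha> # ks'" by auto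
    then show ?case
    proof cases
      case head
      have "\<gamma> \<in> \<Phi>" using root_comp_word[of js \<alpha>] simple_root Cons.prems(2) head by simp
      moreover have "word D ks = word D (\<alpha> # js) \<circ> \<sigma> \<gamma>"
        unfolding head using Cons.prems(2) by (intro word_Cons_deletion[symmetric]) auto
      moreover have "set ks \<subseteq> \<Delta>" "Suc (length ks) = length (\<alpha> # js)"
        using Cons.prems(2) head by auto
      ultimately show ?thesis by blast
    next
      case tail
      have IH: "\<gamma> \<in> \<Phi> \<and> set ks' \<subseteq> \<Delta> \<and> Suc (length ks') = length js
          \<and> word D ks' = word D js \<circ> \<sigma> \<gamma>"
      proof (rule Cons.IH[OF tail(1)])
        show "set js \<subseteq> \<Delta>" using Cons.prems(2) by simp
      qed
      then have "word D ks = word D (\<alpha> # js) \<circ> \<sigma> \<gamma>" by (simp add: tail(2) comp_assoc)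
      moreover have "set ks \<subseteq> \<Delta>" "Suc (length ks) = length (\<alpha> # js)"
        using IH Cons.prems(2) tail(2) by auto
      ultimately show ?thesis using IH by blast
    qed
  qed simp
  then show "\<gamma> \<in> \<Phi>" "set ks \<subseteq> \<Delta>" "Suc (length ks) = length js" "word D ks = word D js \<circ> \<sigma> \<gamma>"
    by auto
qed

text \<open>Composition with the inverse is the contragredient action, so these are the positive
  roots that \<open>w\<close> sends to negative ones.\<close>

definition inversions :: "('h \<Rightarrow> 'h) \<Rightarrow> ('h \<Rightarrow> complex) set" where
  "inversions w = {\<gamma> \<in> \<Phi>\<^sub>p. \<gamma> \<circ> inv_into UNIV w \<notin> \<Phi>\<^sub>p}"

lemma refl_word_fold: "(\<lambda>x. \<sigma> \<alpha> (word D js x)) = \<sigma> \<alpha> \<circ> word D js"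
  by auto

lemma inversions_id: "inversions (\<lambda>x. x) = {}"
  using inversions_def[of id] by (simp add: id_def[symmetric])

lemma inversions_subset: "inversions w \<subseteq> \<Phi>\<^sub>p"
  by (auto simp: inversions_def)

lemma finite_inversions: "finite (inversions w)"
  using finite_pos inversions_subset by (rule finite_subset[rotated])

lemma inv_weyl_comp:
  assumes "v \<in> weyl D" "w \<in> weyl D"
  shows "inv_into UNIV (v \<circ> w) = inv_into UNIV w \<circ> inv_into UNIV v"
  using assms by (simp add: o_inv_distrib weyl_bij)

lemma inv_refl: "\<alpha> \<in> \<Phi> \<Longrightarrow> inv_into UNIV (\<sigma> \<alpha>) = \<sigma> \<alpha>"
  using refl_o_refl by (metis inv_unique_comp)

lemma weyl_inv_inv: "w \<in> weyl D \<Longrightarrow> inv_into UNIV (inv_into UNIV w) = w"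
  by (simp add: inv_inv_eq weyl_bij)

lemma neg_comp: "neg \<beta> \<circ> w = neg (\<beta> \<circ> w)"
  by auto

text \<open>A simple reflection changes the sign of \<alpha> and of its negative only. Hence the
  inversion sets of \<open>w\<close> and \<open>\<sigma> \<alpha> \<circ> w\<close> can differ only
  at the positive one of the two roots that \<open>w\<close> carries to \<alpha> and its
  negative.\<close>

lemma inversions_refl_comp:
  assumes \<alpha>: "\<alpha> \<in> \<Delta>" and w: "w \<in> weyl D"
  shows "\<alpha> \<circ> w \<in> \<Phi>\<^sub>p \<Longrightarrow> \<alpha> \<circ> w \<notin> inversions w"
    and "\<alpha> \<circ> w \<in> \<Phi>\<^sub>p \<Longrightarrow> inversions (\<sigma> \<alpha> \<circ> w) = insert (\<alpha> \<circ> w) (inversions w)"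
    and "\<alpha> \<circ> w \<notin> \<Phi>\<^sub>p \<Longrightarrow> neg (\<alpha> \<circ> w) \<in> inversions w"
    and "\<alpha> \<circ> w \<notin> \<Phi>\<^sub>p \<Longrightarrow> inversions (\<sigma> \<alpha> \<circ> w) = inversions w - {neg (\<alpha> \<circ> w)}"
proof -
  let ?i = "inv_into UNIV w"
  have i: "?i \<in> weyl D" using w by (rule weyl_inv)
  have cancel: "f \<circ> w \<circ> ?i = f" "f \<circ> ?i \<circ> w = f" for f :: "'h \<Rightarrow> complex"
    using weyl_inv_comp[OF w] by (simp_all add: comp_assoc)
  have "\<gamma> = f \<circ> w \<longleftrightarrow> \<gamma> \<circ> ?i = f" for \<gamma> f :: "'h \<Rightarrow> complex"
    using cancel(1)[of f] cancel(2)[of \<gamma>] by auto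
  note this[of _ \<alpha>] this[of _ "neg \<alpha>", unfolded neg_comp]
  note \<gamma> = this
  have neg_simple: "neg \<alpha> \<notin> \<Phi>\<^sub>p" using not_pos_neg[OF simple_pos[OF \<alpha>]] .
  have root: "\<gamma> \<circ> ?i \<in> \<Phi>" if "\<gamma> \<in> \<Phi>\<^sub>p" for \<gamma> using that weyl_root[OF i] pos_root by blast
  have flip: "\<gamma> \<circ> ?i \<circ> \<sigma> \<alpha> \<in> \<Phi>\<^sub>p \<longleftrightarrow> \<gamma> \<circ> ?i \<in> \<Phi>\<^sub>p"
    if "\<gamma> \<in> \<Phi>\<^sub>p" "\<gamma> \<noteq> \<alpha> \<circ> w" "\<gamma> \<noteq> neg (\<alpha> \<circ> w)" for \<gamma>
  proof (cases "\<gamma> \<circ> ?i \<in> \<Phi>\<^sub>p")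
    case True
    then show ?thesis using pos_comp_simple_refl[OF \<alpha> True] that(2) \<gamma>(1) by blast
  next
    case False
    then have "neg (\<gamma> \<circ> ?i) \<in> \<Phi>\<^sub>p" using pos_or_neg root that(1) by blast
    moreover have "neg (\<gamma> \<circ> ?i) \<noteq> \<alpha>" using that(3) \<gamma>(2) by force
    ultimately have "neg (\<gamma> \<circ> ?i) \<circ> \<sigma> \<alpha> \<in> \<Phi>\<^sub>p"
      by (rule pos_comp_simple_refl[OF \<alpha>])
    then show ?thesis unfolding neg_comp using False not_pos_neg by blast
  qed
  have mem: "\<gamma> \<in> inversions (\<sigma> \<alpha> \<circ> w) \<longleftrightarrow> \<gamma> \<in> \<Phi>\<^sub>p \<and> \<gamma> \<circ> ?i \<circ> \<sigma> \<alpha> \<notin> \<Phi>\<^sub>p" for \<gamma>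
    using \<alpha> w by (simp add: inversions_def inv_weyl_comp refl_weyl inv_refl simple_root o_assoc)
  have self: "\<alpha> \<circ> w \<circ> ?i \<circ> \<sigma> \<alpha> \<notin> \<Phi>\<^sub>p" "neg (\<alpha> \<circ> w) \<circ> ?i \<circ> \<sigma> \<alpha> \<in> \<Phi>\<^sub>p"
  proof -
    have eq: "\<alpha> \<circ> w \<circ> ?i \<circ> \<sigma> \<alpha> = neg \<alpha>"
      by (simp only: cancel root_comp_refl_self[OF simple_root[OF \<alpha>]])
    show "\<alpha> \<circ> w \<circ> ?i \<circ> \<sigma> \<alpha> \<notin> \<Phi>\<^sub>p" unfolding eq by (rule neg_simple)
    show "neg (\<alpha> \<circ> w) \<circ> ?i \<circ> \<sigma> \<alpha> \<in> \<Phi>\<^sub>p"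
      unfolding neg_comp eq using simple_pos[OF \<alpha>] by simp
  qed
  have inv_mem: "\<alpha> \<circ> w \<notin> inversions w" "neg (\<alpha> \<circ> w) \<in> \<Phi>\<^sub>p \<Longrightarrow> neg (\<alpha> \<circ> w) \<in> inversions w"
    unfolding inversions_def mem_Collect_eq neg_comp cancel using neg_simple simple_pos[OF \<alpha>] by blast+
  note neg_pos = neg_pos_iff[OF weyl_root[OF w simple_root[OF \<alpha>]]]
  have iff: "\<gamma> \<in> inversions w \<longleftrightarrow> \<gamma> \<in> \<Phi>\<^sub>p \<and> \<gamma> \<circ> ?i \<notin> \<Phi>\<^sub>p" for \<gamma> by (simp add: inversions_def)
  show "\<alpha> \<circ> w \<in> \<Phi>\<^sub>p \<Longrightarrow> \<alpha> \<circ> w \<notin> inversions w" using inv_mem by blast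
  show "\<alpha> \<circ> w \<notin> \<Phi>\<^sub>p \<Longrightarrow> neg (\<alpha> \<circ> w) \<in> inversions w" using inv_mem neg_pos by blast
  show "inversions (\<sigma> \<alpha> \<circ> w) = insert (\<alpha> \<circ> w) (inversions w)" if pos: "\<alpha> \<circ> w \<in> \<Phi>\<^sub>p"
  proof (rule Set.set_eqI)
    fix \<gamma>
    have "neg (\<alpha> \<circ> w) \<notin> \<Phi>\<^sub>p" using pos neg_pos by blast
    then show "\<gamma> \<in> inversions (\<sigma> \<alpha> \<circ> w) \<longleftrightarrow> \<gamma> \<in> insert (\<alpha> \<circ> w) (inversions w)"
      unfolding insert_iff mem iff using flip[of \<gamma>] self(1) pos by blast
  qed
  show "inversions (\<sigma> \<alpha> \<circ> w) = inversions w - {neg (\<alpha> \<circ> w)}" if pos: "\<alpha> \<circ> w \<notin> \<Phi>\<^sub>p"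
  proof (rule Set.set_eqI)
    fix \<gamma>
    show "\<gamma> \<in> inversions (\<sigma> \<alpha> \<circ> w) \<longleftrightarrow> \<gamma> \<in> inversions w - {neg (\<alpha> \<circ> w)}"
      unfolding Diff_iff singleton_iff mem iff using flip[of \<gamma>] self(2) pos by blast
  qed
qed

text \<open>A new first letter adds the root \<open>\<alpha> \<circ> word D js\<close>. If it is
  positive, it is a new inversion; if it is negative, its negative was an inversion, and oddness of
  \<open>F\<close> makes the two terms cancel just as that inversion disappears. The word may
  therefore be nonreduced.\<close>

lemma sum_deletions:
  fixes F :: "('h \<Rightarrow> complex) \<Rightarrow> 'b::ab_group_add"
  assumes js: "set js \<subseteq> \<Delta>" and F: "\<And>\<gamma>. \<gamma> \<in> \<Phi> \<Longrightarrow> F (neg \<gamma>) = - F \<gamma>"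
  shows "(\<Sum>(\<gamma>, ks)\<leftarrow>deletions js. F \<gamma>) = (\<Sum>\<gamma>\<in>inversions (word D js). F \<gamma>)"
  using js
proof (induction js)
  case Nil
  then show ?case by (simp add: inversions_id)
next
  case (Cons \<alpha> js)
  let ?w = "word D js"
  have \<alpha>: "\<alpha> \<in> \<Delta>" and w: "?w \<in> weyl D" using Cons.prems by (auto simp: word_weyl)
  note inv = inversions_refl_comp[OF \<alpha> w]
  have "(\<Sum>(\<gamma>, ks)\<leftarrow>deletions (\<alpha> # js). F \<gamma>) = F (\<alpha> \<circ> ?w) + (\<Sum>\<gamma>\<in>inversions ?w. F \<gamma>)"
    using Cons by (simp add: case_prod_beta' comp_def)
  also have "\<dots> = (\<Sum>\<gamma>\<in>inversions (\<sigma> \<alpha> \<circ> ?w). F \<gamma>)"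
  proof (cases "\<alpha> \<circ> ?w \<in> \<Phi>\<^sub>p")
    case True
    then show ?thesis using inv finite_inversions by simp
  next
    case False
    have "F (neg (\<alpha> \<circ> ?w)) = - F (\<alpha> \<circ> ?w)"
      using F[OF weyl_root[OF w simple_root[OF \<alpha>]]] .
    moreover have "sum F (inversions ?w)
        = F (neg (\<alpha> \<circ> ?w)) + sum F (inversions ?w - {neg (\<alpha> \<circ> ?w)})"
      using inv(3)[OF False] finite_inversions by (rule sum.remove[rotated])
    ultimately show ?thesis using inv(4)[OF False] by simp
  qed
  finally show ?case by (simp add: refl_word_fold)
qed

lemma card_inversions_refl_comp:
  assumes "\<alpha> \<in> \<Delta>" "w \<in> weyl D"
  shows "\<alpha> \<circ> w \<in> \<Phi>\<^sub>p \<Longrightarrow> card (inversions (\<sigma> \<alpha> \<circ> w)) = Suc (card (inversions w))"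
    and "\<alpha> \<circ> w \<notin> \<Phi>\<^sub>p \<Longrightarrow> Suc (card (inversions (\<sigma> \<alpha> \<circ> w))) = card (inversions w)"
  using inversions_refl_comp[OF assms] finite_inversions card_Suc_Diff1[of "inversions w"] by simp_all

lemma card_inversions_word:
  assumes "set js \<subseteq> \<Delta>"
  shows "card (inversions (word D js)) \<le> length js \<and>
    (even (card (inversions (word D js))) \<longleftrightarrow> even (length js))"
  using assms
proof (induction js)
  case Nil
  then show ?case by (simp add: inversions_id)
next
  case (Cons \<alpha> js)
  then have "card (inversions (word D (\<alpha> # js))) = Suc (card (inversions (word D js)))
      \<or> Suc (card (inversions (word D (\<alpha> # js)))) = card (inversions (word D js))"
    using card_inversions_refl_comp[of \<alpha> "word D js"] by (auto simp: word_weyl)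
  moreover have "card (inversions (word D js)) \<le> length js"
    "even (card (inversions (word D js))) \<longleftrightarrow> even (length js)" using Cons by auto
  ultimately have "card (inversions (word D (\<alpha> # js))) \<le> Suc (length js) \<and>
      (even (card (inversions (word D (\<alpha> # js)))) \<longleftrightarrow> even (Suc (length js)))" by presburger
  then show ?case by (simp add: refl_word_fold)
qed

text \<open>The case of a negative root \<open>\<alpha> \<circ> ?w\<close> is the exchange property:
  its negative is an inversion, some deletion of the shortest word \<open>ks\<close> carries it, and
  the shortened word has product \<open>?w \<circ> \<sigma> (\<alpha> \<circ> ?w)\<close>, which
  equals \<open>\<sigma> \<alpha> \<circ> ?w\<close>.\<close>

lemma word_of_length_card_inversions:
  assumes "set js \<subseteq> \<Delta>"
  shows "\<exists>ks. set ks \<subseteq> \<Delta> \<and> word D ks = word D js \<and> length ks = card (inversions (word D js))"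
  using assms
proof (induction js)
  case Nil
  then show ?case by (intro exI[of _ "[]"]) (simp add: inversions_id id_def)
next
  case (Cons \<alpha> js)
  let ?w = "word D js"
  have \<alpha>: "\<alpha> \<in> \<Delta>" and w: "?w \<in> weyl D" using Cons.prems by (auto simp: word_weyl)
  obtain ks where ks: "set ks \<subseteq> \<Delta>" "word D ks = ?w" "length ks = card (inversions ?w)"
    using Cons by auto
  show ?case
  proof (cases "\<alpha> \<circ> ?w \<in> \<Phi>\<^sub>p")
    case True
    then show ?thesis using ks \<alpha> card_inversions_refl_comp[OF \<alpha> w]
      by (intro exI[of _ "\<alpha> # ks"]) (simp add: refl_word_fold)
  next
    case False
    let ?\<gamma> = "neg (\<alpha> \<circ> ?w)"
    have root: "\<alpha> \<circ> ?w \<in> \<Phi>" using weyl_root[OF w simple_root[OF \<alpha>]] .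
    have \<gamma>: "?\<gamma> \<in> inversions ?w" using inversions_refl_comp(3)[OF \<alpha> w False] .
    \<comment> \<open>The odd version of the indicator of \<open>?\<gamma>\<close>. Its sum over the
      inversions is 1, whereas deletions avoiding \<open>?\<gamma>\<close> could contribute only -1
      or 0.\<close>
    define F :: "('h \<Rightarrow> complex) \<Rightarrow> int" where
      "F \<gamma> = (if \<gamma> = ?\<gamma> then 1 else if neg \<gamma> = ?\<gamma> then -1 else 0)" for \<gamma>
    have ne: "neg ?\<gamma> \<noteq> ?\<gamma>" using not_pos_neg \<gamma> inversions_subset by (metis subsetD)
    have "(\<Sum>(\<gamma>, l)\<leftarrow>deletions ks. F \<gamma>) = (\<Sum>\<gamma>\<in>inversions ?w. F \<gamma>)"
      unfolding ks(2)[symmetric] using ne by (intro sum_deletions ks(1)) (auto simp: F_def)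
    also have "\<dots> = (\<Sum>\<gamma>\<in>inversions ?w. if \<gamma> = ?\<gamma> then 1 else 0)"
    proof (intro sum.cong refl)
      fix \<gamma> assume "\<gamma> \<in> inversions ?w"
      then have "neg \<gamma> \<noteq> ?\<gamma>" using \<gamma> inversions_subset not_pos_neg by (metis subsetD)
      then show "F \<gamma> = (if \<gamma> = ?\<gamma> then 1 else 0)" by (simp add: F_def)
    qed
    also have "\<dots> = 1" using \<gamma> finite_inversions by simp
    finally have sum: "(\<Sum>(\<gamma>, l)\<leftarrow>deletions ks. F \<gamma>) = 1" .
    have "\<exists>l. (?\<gamma>, l) \<in> set (deletions ks)"
    proof (rule ccontr)
      assume "\<nexists>l. (?\<gamma>, l) \<in> set (deletions ks)"
      then have "(\<Sum>(\<gamma>, l)\<leftarrow>deletions ks. F \<gamma>) \<le> 0"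
        by (intro sum_list_nonpos) (auto simp: F_def)
      with sum show False by simp
    qed
    then obtain l where l: "(?\<gamma>, l) \<in> set (deletions ks)" by blast
    note del = deletionsD[OF l ks(1)]
    have "word D l = ?w \<circ> \<sigma> (\<alpha> \<circ> ?w)" using del(4) ks(2) refl_neg[OF root] by simp
    also have "\<dots> = \<sigma> \<alpha> \<circ> (\<sigma> \<alpha> \<circ> ?w \<circ> \<sigma> (\<alpha> \<circ> ?w))"
      using refl_o_refl[OF simple_root[OF \<alpha>]] by (simp flip: comp_assoc)
    also have "\<dots> = \<sigma> \<alpha> \<circ> ?w" using word_Cons_deletion[of js \<alpha>] Cons.prems by simp
    finally have "word D l = word D (\<alpha> # js)" by simp
    moreover have "length l = card (inversions (word D (\<alpha> # js)))"
      using del(3) ks(3) card_inversions_refl_comp(2)[OF \<alpha> w False] by simp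
    ultimately show ?thesis using del(2) by blast
  qed
qed

lemma len_eq: assumes "w \<in> weyl D" shows "len D w = card (inversions w)"
  unfolding len_def
proof (rule Least_equality)
  obtain js where "set js \<subseteq> \<Delta>" "w = word D js" using assms by (rule weyl_cases)
  then show "\<exists>js. set js \<subseteq> \<Delta> \<and> length js = card (inversions w) \<and> word D js = w"
    using word_of_length_card_inversions by metis
  fix n assume "\<exists>js. set js \<subseteq> \<Delta> \<and> length js = n \<and> word D js = w"
  then show "card (inversions w) \<le> n" using card_inversions_word by blast
qed

lemma reduced_expression_exists: "w \<in> weyl D \<Longrightarrow> \<exists>js. reduced_expression D w js"
  unfolding reduced_expression_def
  by (elim weyl_cases) (metis len_eq word_of_length_card_inversions word_weyl)

lemma len_word: "set js \<subseteq> \<Delta> \<Longrightarrow> len D (word D js) \<le> length js"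
  and len_word_parity: "set js \<subseteq> \<Delta> \<Longrightarrow> even (len D (word D js)) \<longleftrightarrow> even (length js)"
  using card_inversions_word len_eq word_weyl by metis+

lemma len_refl_comp_parity:
  assumes "\<alpha> \<in> \<Delta>" "w \<in> weyl D" shows "even (len D (\<sigma> \<alpha> \<circ> w)) \<longleftrightarrow> odd (len D w)"
  using card_inversions_refl_comp[OF assms] len_eq[OF assms(2)]
    len_eq[OF weyl_comp[OF refl_weyl[OF assms(1)] assms(2)]]
  by (cases "\<alpha> \<circ> w \<in> \<Phi>\<^sub>p") (simp, metis even_Suc)

lemma len_eq_0_iff: "w \<in> weyl D \<Longrightarrow> len D w = 0 \<longleftrightarrow> w = id"
  using reduced_expression_exists[of w] len_word[of "[]"]
  by (auto simp: reduced_expression_def)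

lemma len_id: "len D id = 0"
  using len_eq_0_iff id_weyl by blast

lemma len_inv: assumes "w \<in> weyl D" shows "len D (inv_into UNIV w) = len D w"
proof -
  have le: "len D (inv_into UNIV w) \<le> len D w" if w: "w \<in> weyl D" for w
  proof -
    obtain js where "set js \<subseteq> \<Delta>" "word D js = w" "length js = len D w"
      using reduced_expression_exists[OF w] by (auto simp: reduced_expression_def)
    then show ?thesis using len_word[of "rev js"] by (auto simp: inv_word)
  qed
  show ?thesis using le[OF assms] le[OF weyl_inv[OF assms]] weyl_inv_inv[OF assms] by simp
qed

lemma len_le_card_pos: "w \<in> weyl D \<Longrightarrow> len D w \<le> card \<Phi>\<^sub>p"
  by (simp add: len_eq card_mono finite_pos inversions_subset)

text \<open>The negatives of the images of the simple roots have natural coefficients, and so have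
  their natural combinations.\<close>

lemma pos_comp_neg_if_simple:
  assumes w: "w \<in> weyl D" and neg: "\<And>\<alpha>. \<alpha> \<in> \<Delta> \<Longrightarrow> \<alpha> \<circ> w \<notin> \<Phi>\<^sub>p" and \<gamma>: "\<gamma> \<in> \<Phi>\<^sub>p"
  shows "\<gamma> \<circ> w \<notin> \<Phi>\<^sub>p"
proof -
  obtain n where n: "\<gamma> = (\<lambda>x. \<Sum>\<alpha>\<in>\<Delta>. of_nat (n \<alpha> :: nat) * \<alpha> x)"
    using \<gamma> by (auto simp: pos_roots_def)
  have "\<forall>\<alpha>\<in>\<Delta>. \<exists>m. neg (\<alpha> \<circ> w) = (\<lambda>x. \<Sum>\<beta>\<in>\<Delta>. of_nat (m \<beta> :: nat) * \<beta> x)"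
  proof
    fix \<alpha> assume \<alpha>: "\<alpha> \<in> \<Delta>"
    have "neg (\<alpha> \<circ> w) \<in> \<Phi>\<^sub>p"
      using neg[OF \<alpha>] pos_or_neg weyl_root[OF w simple_root[OF \<alpha>]] by blast
    then show "\<exists>m. neg (\<alpha> \<circ> w) = (\<lambda>x. \<Sum>\<beta>\<in>\<Delta>. of_nat (m \<beta> :: nat) * \<beta> x)"
      by (auto simp: pos_roots_def)
  qed
  from bchoice[OF this] obtain m where m: "\<And>\<alpha>. \<alpha> \<in> \<Delta> \<Longrightarrow> neg (\<alpha> \<circ> w) = (\<lambda>x. \<Sum>\<beta>\<in>\<Delta>. of_nat (m \<alpha> \<beta> :: nat) * \<beta> x)"
    by blast
  have "neg (\<gamma> \<circ> w) x = (\<Sum>\<beta>\<in>\<Delta>. of_nat (\<Sum>\<alpha>\<in>\<Delta>. n \<alpha> * m \<alpha> \<beta>) * \<beta> x)" for x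
  proof -
    have "neg (\<gamma> \<circ> w) x = (\<Sum>\<alpha>\<in>\<Delta>. of_nat (n \<alpha>) * neg (\<alpha> \<circ> w) x)"
      by (simp add: n sum_negf)
    also have "\<dots> = (\<Sum>\<alpha>\<in>\<Delta>. \<Sum>\<beta>\<in>\<Delta>. of_nat (n \<alpha> * m \<alpha> \<beta>) * \<beta> x)"
      by (intro sum.cong refl) (simp only: m fun_cong[OF m] sum_distrib_left of_nat_mult mult.assoc)
    also have "\<dots> = (\<Sum>\<beta>\<in>\<Delta>. of_nat (\<Sum>\<alpha>\<in>\<Delta>. n \<alpha> * m \<alpha> \<beta>) * \<beta> x)"
      by (subst sum.swap) (simp add: sum_distrib_right)
    finally show ?thesis .
  qed
  then have "\<exists>k. neg (\<gamma> \<circ> w) = (\<lambda>x. \<Sum>\<beta>\<in>\<Delta>. of_nat (k \<beta> :: nat) * \<beta> x)"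
    by (intro exI[of _ "\<lambda>\<beta>. \<Sum>\<alpha>\<in>\<Delta>. n \<alpha> * m \<alpha> \<beta>"]) blast
  then have "neg (\<gamma> \<circ> w) \<in> \<Phi>\<^sub>p"
    using root_neg[OF weyl_root[OF w pos_root[OF \<gamma>]]] by (simp add: pos_roots_def)
  then show ?thesis using not_pos_neg by blast
qed

text \<open>An element of length \<open>card \<Phi>\<^sub>p\<close> inverts every positive root, so
  acting by it and negating permutes the positive roots. This permutation matches the inversions of
  \<open>v \<circ> w\<close> with the positive roots that \<open>v\<close> does not invert.\<close>

lemma len_comp_maximal:
  assumes w: "w \<in> weyl D" "len D w = card \<Phi>\<^sub>p" and v: "v \<in> weyl D"
  shows "len D (v \<circ> w) = card \<Phi>\<^sub>p - len D v"
proof -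
  let ?w = "inv_into UNIV w"
  have "inversions w = \<Phi>\<^sub>p"
    using w by (intro card_subset_eq finite_pos inversions_subset) (simp add: len_eq)
  then have neg1: "neg (\<gamma> \<circ> ?w) \<in> \<Phi>\<^sub>p" if "\<gamma> \<in> \<Phi>\<^sub>p" for \<gamma>
    using that pos_or_neg[OF weyl_root[OF weyl_inv[OF w(1)] pos_root]] by (auto simp: inversions_def)
  have "inversions ?w = \<Phi>\<^sub>p"
    using w by (intro card_subset_eq finite_pos inversions_subset)
      (simp add: weyl_inv len_inv flip: len_eq)
  then have neg2: "neg (\<gamma> \<circ> w) \<in> \<Phi>\<^sub>p" if "\<gamma> \<in> \<Phi>\<^sub>p" for \<gamma>
    using that pos_or_neg[OF weyl_root[OF w(1) pos_root]]
    by (auto simp: inversions_def weyl_inv_inv[OF w(1)])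
  have cancel: "f \<circ> w \<circ> ?w = f" "f \<circ> ?w \<circ> w = f" for f :: "'h \<Rightarrow> complex"
    using weyl_inv_comp[OF w(1)] by (simp_all add: comp_assoc)
  have mem: "\<gamma> \<in> inversions (v \<circ> w) \<longleftrightarrow> neg (\<gamma> \<circ> ?w) \<in> \<Phi>\<^sub>p - inversions v" if "\<gamma> \<in> \<Phi>\<^sub>p" for \<gamma>
  proof -
    have "\<gamma> \<circ> ?w \<circ> inv_into UNIV v \<in> \<Phi>"
      using that v w by (intro weyl_root weyl_inv pos_root)
    then have "neg (\<gamma> \<circ> ?w \<circ> inv_into UNIV v) \<in> \<Phi>\<^sub>p \<longleftrightarrow> \<gamma> \<circ> ?w \<circ> inv_into UNIV v \<notin> \<Phi>\<^sub>p"
      by (rule neg_pos_iff)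
    moreover have "\<gamma> \<in> inversions (v \<circ> w) \<longleftrightarrow> \<gamma> \<circ> ?w \<circ> inv_into UNIV v \<notin> \<Phi>\<^sub>p"
      using that by (simp add: inversions_def inv_weyl_comp v w o_assoc)
    moreover have "neg (\<gamma> \<circ> ?w) \<in> inversions v \<longleftrightarrow> neg (\<gamma> \<circ> ?w \<circ> inv_into UNIV v) \<notin> \<Phi>\<^sub>p"
      unfolding inversions_def mem_Collect_eq neg_comp using neg1[OF that] by blast
    ultimately show ?thesis using neg1[OF that] by blast
  qed
  have "bij_betw (\<lambda>\<gamma>. neg (\<gamma> \<circ> ?w)) (inversions (v \<circ> w)) (\<Phi>\<^sub>p - inversions v)"
  proof (rule bij_betw_byWitness[of _ "\<lambda>\<gamma>. neg (\<gamma> \<circ> w)"])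
    have dn: "neg (neg \<gamma> \<circ> u) = \<gamma> \<circ> u" for \<gamma> u by auto
    show "\<forall>\<gamma>\<in>inversions (v \<circ> w). neg (neg (\<gamma> \<circ> ?w) \<circ> w) = \<gamma>"
      "\<forall>\<gamma>\<in>\<Phi>\<^sub>p - inversions v. neg (neg (\<gamma> \<circ> w) \<circ> ?w) = \<gamma>"
      unfolding dn cancel by auto
    show "(\<lambda>\<gamma>. neg (\<gamma> \<circ> ?w)) ` inversions (v \<circ> w) \<subseteq> \<Phi>\<^sub>p - inversions v"
      using mem inversions_subset by blast
    have "neg (\<gamma> \<circ> w) \<in> inversions (v \<circ> w)" if "\<gamma> \<in> \<Phi>\<^sub>p - inversions v" for \<gamma>
      using mem[OF neg2[of \<gamma>]] that unfolding dn cancel by blast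
    then show "(\<lambda>\<gamma>. neg (\<gamma> \<circ> w)) ` (\<Phi>\<^sub>p - inversions v) \<subseteq> inversions (v \<circ> w)" by blast
  qed
  then have "card (inversions (v \<circ> w)) = card (\<Phi>\<^sub>p - inversions v)" by (rule bij_betw_same_card)
  also have "\<dots> = card \<Phi>\<^sub>p - card (inversions v)"
    using inversions_subset finite_inversions by (rule card_Diff_subset[rotated])
  finally show ?thesis using v w by (simp add: len_eq weyl_comp)
qed

text \<open>For \<open>w\<close> of maximal length every \<open>\<alpha> \<circ> w\<close> with
  \<alpha> simple is negative, as otherwise \<open>\<sigma> \<alpha> \<circ> w\<close> would be
  longer; then the inverse of \<open>w\<close> inverts all positive roots. Two such elements differ
  by an element of length 0.\<close>

lemma ex1_maximal: "\<exists>!w. w \<in> weyl D \<and> len D w = card \<Phi>\<^sub>p"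
proof (rule ex_ex1I)
  have "Max (len D ` weyl D) \<in> len D ` weyl D" using finite_weyl id_weyl by (intro Max_in) auto
  then obtain w where w: "w \<in> weyl D" and "len D w = Max (len D ` weyl D)" by auto
  then have max: "len D v \<le> len D w" if "v \<in> weyl D" for v using that finite_weyl by simp
  have "\<alpha> \<circ> w \<notin> \<Phi>\<^sub>p" if "\<alpha> \<in> \<Delta>" for \<alpha>
    using card_inversions_refl_comp(1)[OF that w] max[OF weyl_comp[OF refl_weyl[OF that] w]]
    by (auto simp: len_eq w weyl_comp refl_weyl that)
  then have "\<gamma> \<circ> w \<notin> \<Phi>\<^sub>p" if "\<gamma> \<in> \<Phi>\<^sub>p" for \<gamma> using pos_comp_neg_if_simple w that by blast
  then have "inversions (inv_into UNIV w) = \<Phi>\<^sub>p" by (auto simp: inversions_def weyl_inv_inv w)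
  then show "\<exists>w. w \<in> weyl D \<and> len D w = card \<Phi>\<^sub>p"
    using w by (intro exI[of _ "inv_into UNIV w"]) (simp add: len_eq weyl_inv)
next
  fix v w assume v: "v \<in> weyl D \<and> len D v = card \<Phi>\<^sub>p" and w: "w \<in> weyl D \<and> len D w = card \<Phi>\<^sub>p"
  let ?u = "v \<circ> inv_into UNIV w"
  have u: "?u \<in> weyl D" using v w by (simp add: weyl_comp weyl_inv)
  have vw: "?u \<circ> w = v" using w weyl_inv_comp by (simp add: comp_assoc)
  then have "len D ?u = 0" using len_comp_maximal[of w ?u] v w u len_le_card_pos[OF u] by simp
  then have "?u = id" using u len_eq_0_iff by blast
  then show "v = w" using vw by simp
qed

lemma longest: "longest D \<in> weyl D" and len_longest: "len D (longest D) = card \<Phi>\<^sub>p"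
proof -
  obtain w where w: "w \<in> weyl D" "len D w = card \<Phi>\<^sub>p" using ex1_maximal by blast
  have "longest D = w"
    unfolding longest_def
  proof (rule the_equality)
    show "w \<in> weyl D \<and> (\<forall>v\<in>weyl D. len D v \<le> len D w)" using w len_le_card_pos by simp
    fix v assume v: "v \<in> weyl D \<and> (\<forall>u\<in>weyl D. len D u \<le> len D v)"
    then have "len D v = card \<Phi>\<^sub>p" using w len_le_card_pos by (metis le_antisym)
    then show "v = w" using v w ex1_maximal by blast
  qed
  then show "longest D \<in> weyl D" "len D (longest D) = card \<Phi>\<^sub>p" using w by auto
qed

lemma longest_unique: "w \<in> weyl D \<Longrightarrow> len D w = card \<Phi>\<^sub>p \<Longrightarrow> w = longest D"
  using ex1_maximal longest len_longest by blast


subsection \<open>Demazure operators\<close>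

abbreviation "dem \<equiv> demazure_simple D"

lemma refl_apply: "\<alpha> \<in> \<Phi> \<Longrightarrow> weyl_act (\<sigma> \<alpha>) f x = f (\<sigma> \<alpha> x)"
  by (simp add: weyl_act_def inv_refl)

lemma root_ne_0: "\<alpha> \<in> \<Phi> \<Longrightarrow> \<exists>x. \<alpha> x \<noteq> 0"
  by (metis coroot_2 zero_neq_numeral)

lemma dem_ex1:
  assumes "f \<in> polys" "\<alpha> \<in> \<Phi>"
  shows "\<exists>!g. g \<in> polys \<and> (\<forall>x. \<alpha> x * g x = f x - weyl_act (\<sigma> \<alpha>) f x)"
proof (rule ex_ex1I)
  show "\<exists>g. g \<in> polys \<and> (\<forall>x. \<alpha> x * g x = f x - weyl_act (\<sigma> \<alpha>) f x)"
    using polys_transvection_quotient[OF assms(1) root_dual[OF assms(2)], of "coroot D \<alpha>"] assms(2)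
    by (auto simp: refl_apply reflection_def)
next
  fix g h
  assume "g \<in> polys \<and> (\<forall>x. \<alpha> x * g x = f x - weyl_act (\<sigma> \<alpha>) f x)"
    "h \<in> polys \<and> (\<forall>x. \<alpha> x * h x = f x - weyl_act (\<sigma> \<alpha>) f x)"
  then show "g = h"
    using polys_cancel[OF dual_polys[OF root_dual[OF assms(2)]]] root_ne_0[OF assms(2)] by metis
qed

lemma dem_polys: "f \<in> polys \<Longrightarrow> \<alpha> \<in> \<Phi> \<Longrightarrow> dem \<alpha> f \<in> polys"
  and dem_eq: "f \<in> polys \<Longrightarrow> \<alpha> \<in> \<Phi> \<Longrightarrow> \<alpha> x * dem \<alpha> f x = f x - f (\<sigma> \<alpha> x)"
  using theI'[OF dem_ex1] by (auto simp: demazure_simple_def refl_apply)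

text \<open>The working tool for this section: identities between Demazure operators are verified
  after multiplication by \<alpha>.\<close>

lemma dem_unique:
  assumes "f \<in> polys" "\<alpha> \<in> \<Phi>" "g \<in> polys" "\<And>x. \<alpha> x * g x = f x - f (\<sigma> \<alpha> x)"
  shows "dem \<alpha> f = g"
  unfolding demazure_simple_def
  using assms dem_ex1[OF assms(1,2)] by (intro the1_equality) (auto simp: refl_apply)

lemma dem_hom_polys:
  assumes "f \<in> hom_polys n" "\<alpha> \<in> \<Phi>"
  shows "dem \<alpha> f \<in> hom_polys (n - 1)" and "n = 0 \<Longrightarrow> dem \<alpha> f = (\<lambda>x. 0)"
proof -
  obtain g where g: "n = 0 \<longrightarrow> g = (\<lambda>x. 0)" "0 < n \<longrightarrow> g \<in> hom_polys (n - 1)"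
    "\<forall>x. \<alpha> x * g x = f x - f (x - scale D (\<alpha> x) (coroot D \<alpha>))"
    using hom_polys_transvection_quotient[OF assms(1) root_dual[OF assms(2)]] by blast
  then have hom: "g \<in> hom_polys (n - 1)" by (cases "n = 0") (auto simp: hom_polys_zero)
  have "dem \<alpha> f = g"
    using g(3) assms hom hom_polys_polys by (intro dem_unique) (auto simp: reflection_def)
  then show "dem \<alpha> f \<in> hom_polys (n - 1)" "n = 0 \<Longrightarrow> dem \<alpha> f = (\<lambda>x. 0)" using hom g(1) by auto
qed

lemma refl_polys: "f \<in> polys \<Longrightarrow> \<alpha> \<in> \<Phi> \<Longrightarrow> (\<lambda>x. f (\<sigma> \<alpha> x)) \<in> polys"
  using polys_comp[OF _ linear_refl] by (simp add: o_def)

lemma dem_add: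
  assumes "f \<in> polys" "g \<in> polys" "\<alpha> \<in> \<Phi>"
  shows "dem \<alpha> (\<lambda>x. f x + g x) = (\<lambda>x. dem \<alpha> f x + dem \<alpha> g x)"
  using assms
  by (intro dem_unique polys_add dem_polys) (simp_all add: dem_eq distrib_left)

lemma dem_mult:
  assumes "f \<in> polys" "g \<in> polys" "\<alpha> \<in> \<Phi>"
  shows "dem \<alpha> (\<lambda>x. f x * g x) = (\<lambda>x. dem \<alpha> f x * g x + f (\<sigma> \<alpha> x) * dem \<alpha> g x)"
proof (intro dem_unique polys_add polys_mult dem_polys refl_polys assms)
  fix x
  have "\<alpha> x * (dem \<alpha> f x * g x + f (\<sigma> \<alpha> x) * dem \<alpha> g x)
      = (\<alpha> x * dem \<alpha> f x) * g x + f (\<sigma> \<alpha> x) * (\<alpha> x * dem \<alpha> g x)" by (simp add: algebra_simps)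
  also have "\<dots> = f x * g x - f (\<sigma> \<alpha> x) * g (\<sigma> \<alpha> x)"
    using assms by (simp add: dem_eq algebra_simps)
  finally show "\<alpha> x * (dem \<alpha> f x * g x + f (\<sigma> \<alpha> x) * dem \<alpha> g x)
      = f x * g x - f (\<sigma> \<alpha> x) * g (\<sigma> \<alpha> x)" .
qed

lemma dem_invariant:
  assumes "f \<in> polys" "\<alpha> \<in> \<Phi>" "\<And>x. f (\<sigma> \<alpha> x) = f x" shows "dem \<alpha> f = (\<lambda>x. 0)"
  using assms by (intro dem_unique) (auto simp: polys_const)

lemma dem_smult: "f \<in> polys \<Longrightarrow> \<alpha> \<in> \<Phi> \<Longrightarrow> dem \<alpha> (\<lambda>x. k * f x) = (\<lambda>x. k * dem \<alpha> f x)"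
  using dem_mult[OF polys_const, of f \<alpha> k] dem_invariant[OF polys_const, of \<alpha> k] by simp

lemma dem_dual_mult:
  assumes "l \<in> dual D" "f \<in> polys" "\<alpha> \<in> \<Phi>"
  shows "dem \<alpha> (\<lambda>x. l x * f x) = (\<lambda>x. l (\<sigma> \<alpha> x) * dem \<alpha> f x + l (coroot D \<alpha>) * f x)"
proof -
  have "dem \<alpha> l = (\<lambda>x. l (coroot D \<alpha>))"
    using assms
    by (intro dem_unique dual_polys polys_const) (auto simp: reflection_def dual_diff dual_scale)
  then show ?thesis using dem_mult[OF dual_polys[OF assms(1)] assms(2,3)] by (simp add: add.commute)
qed

text \<open>The reflection changes the sign of the numerator and of the denominator.\<close>

lemma dem_refl:
  assumes "f \<in> polys" "\<alpha> \<in> \<Phi>" shows "dem \<alpha> f (\<sigma> \<alpha> x) = dem \<alpha> f x"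
proof -
  have "(\<lambda>x. dem \<alpha> f (\<sigma> \<alpha> x)) = dem \<alpha> f"
  proof -
    obtain y where y: "\<alpha> y \<noteq> 0" using root_ne_0[OF assms(2)] by blast
    have "\<alpha> x * dem \<alpha> f (\<sigma> \<alpha> x) = \<alpha> x * dem \<alpha> f x" for x
    proof -
      have "\<alpha> (\<sigma> \<alpha> x) = - \<alpha> x"
        using fun_cong[OF root_comp_refl_self[OF assms(2)]] by simp
      then have "- (\<alpha> x * dem \<alpha> f (\<sigma> \<alpha> x)) = f (\<sigma> \<alpha> x) - f x"
        using dem_eq[OF assms, of "\<sigma> \<alpha> x"] assms(2) by (simp add: refl_refl)
      then have "\<alpha> x * dem \<alpha> f (\<sigma> \<alpha> x) = f x - f (\<sigma> \<alpha> x)"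
        by (metis minus_diff_eq minus_minus)
      then show ?thesis by (simp add: dem_eq[OF assms])
    qed
    then show ?thesis
      by (rule polys_cancel[OF dual_polys[OF root_dual[OF assms(2)]]
            refl_polys[OF dem_polys[OF assms] assms(2)] dem_polys[OF assms] _ y])
  qed
  then show ?thesis by (rule fun_cong)
qed

lemma dem_dem: "f \<in> polys \<Longrightarrow> \<alpha> \<in> \<Phi> \<Longrightarrow> dem \<alpha> (dem \<alpha> f) = (\<lambda>x. 0)"
  by (simp add: dem_invariant dem_polys dem_refl)

text \<open>The composite along any word, reduced or not. Inductions over words and deletions leave
  the reduced words, on which alone \<open>demazure\<close> is defined.\<close>

definition dems :: "('h \<Rightarrow> complex) list \<Rightarrow> ('h \<Rightarrow> complex) \<Rightarrow> 'h \<Rightarrow> complex" where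
  "dems js = foldr (\<lambda>\<alpha> F. dem \<alpha> \<circ> F) js id"

lemma dems_Nil [simp]: "dems [] f = f"
  and dems_Cons [simp]: "dems (\<alpha> # js) f = dem \<alpha> (dems js f)"
  by (simp_all add: dems_def)

lemma dems_append: "dems (js @ ks) f = dems js (dems ks f)"
  by (induction js) auto

lemma dems_polys: "set js \<subseteq> \<Delta> \<Longrightarrow> f \<in> polys \<Longrightarrow> dems js f \<in> polys"
  by (induction js) (auto intro: dem_polys simple_root)

lemma dems_add:
  "set js \<subseteq> \<Delta> \<Longrightarrow> f \<in> polys \<Longrightarrow> g \<in> polys \<Longrightarrow>
    dems js (\<lambda>x. f x + g x) = (\<lambda>x. dems js f x + dems js g x)"
  by (induction js) (auto simp: dem_add dems_polys simple_root)

lemma dems_smult: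
  "set js \<subseteq> \<Delta> \<Longrightarrow> f \<in> polys \<Longrightarrow> dems js (\<lambda>x. k * f x) = (\<lambda>x. k * dems js f x)"
  by (induction js) (auto simp: dem_smult dems_polys simple_root)

lemma dem_zero: "\<alpha> \<in> \<Phi> \<Longrightarrow> dem \<alpha> (\<lambda>x. 0) = (\<lambda>x. 0)"
  by (simp add: dem_invariant polys_const)

lemma dems_zero: "set js \<subseteq> \<Delta> \<Longrightarrow> dems js (\<lambda>x. 0) = (\<lambda>x. 0)"
  using dems_smult[OF _ polys_const, of js 0] by simp

text \<open>The subtraction is truncated: for a word longer than the degree, the result is the zero
  polynomial, which lies in degree 0 as well.\<close>

lemma dems_hom_polys:
  "set js \<subseteq> \<Delta> \<Longrightarrow> f \<in> hom_polys n \<Longrightarrow> dems js f \<in> hom_polys (n - length js)"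
proof (induction js)
  case (Cons \<alpha> js)
  then show ?case using dem_hom_polys(1)[of "dems js f" "n - length js" \<alpha>] by (simp add: simple_root)
qed simp

lemma dems_hom_polys_vanish:
  "set js \<subseteq> \<Delta> \<Longrightarrow> f \<in> hom_polys n \<Longrightarrow> n < length js \<Longrightarrow> dems js f = (\<lambda>x. 0)"
proof (induction js)
  case (Cons \<alpha> js)
  then show ?case
    using dem_hom_polys(2)[OF dems_hom_polys[of js f n], of \<alpha>]
    by (cases "n = length js") (auto simp: simple_root dem_zero)
qed simp

lemma coroot_comp_word:
  "set js \<subseteq> \<Delta> \<Longrightarrow> \<beta> \<in> \<Phi> \<Longrightarrow> coroot D (\<beta> \<circ> word D js) = word D (rev js) (coroot D \<beta>)"
proof (induction js arbitrary: \<beta>)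
  case (Cons \<alpha> js)
  then have "coroot D ((\<beta> \<circ> \<sigma> \<alpha>) \<circ> word D js) = word D (rev js) (coroot D (\<beta> \<circ> \<sigma> \<alpha>))"
    by (intro Cons.IH root_comp_refl) (auto simp: simple_root)
  also have "coroot D (\<beta> \<circ> \<sigma> \<alpha>) = \<sigma> \<alpha> (coroot D \<beta>)"
    using Cons.prems by (intro coroot_comp_refl) (auto simp: simple_root)
  finally show ?case by (simp add: word_append comp_assoc refl_word_fold)
qed simp

lemma polys_sum_list:
  "(\<And>p. p \<in> set ps \<Longrightarrow> g p \<in> polys) \<Longrightarrow> (\<lambda>x. \<Sum>p\<leftarrow>ps. c p * g p x) \<in> polys"
  by (induction ps) (auto simp: polys_const polys_add polys_smult)

lemma dem_sum_list:
  assumes "\<alpha> \<in> \<Phi>" "\<And>p. p \<in> set ps \<Longrightarrow> g p \<in> polys"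
  shows "dem \<alpha> (\<lambda>x. \<Sum>p\<leftarrow>ps. c p * g p x) = (\<lambda>x. \<Sum>p\<leftarrow>ps. c p * dem \<alpha> (g p) x)"
  using assms(2)
proof (induction ps)
  case (Cons p ps)
  then show ?case
    using dem_add[OF polys_smult[of "g p" "c p"] polys_sum_list[of ps g c] assms(1)]
    by (simp add: dem_smult assms(1))
qed (simp add: dem_zero assms(1))

text \<open>A Demazure operator turns a linear functional into a constant. So at most one letter is
  spent on \<open>l\<close>, which removes that letter from the operator applied to
  \<open>f\<close>, while all other letters act on \<open>f\<close> and reflect \<open>l\<close>.
  This is the source of Chevalley's multiplication formula.\<close>

lemma dems_dual_mult:
  assumes "set js \<subseteq> \<Delta>" "l \<in> dual D" "f \<in> polys"
  shows "dems js (\<lambda>x. l x * f x) =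
    (\<lambda>x. l (word D (rev js) x) * dems js f x + (\<Sum>p\<leftarrow>deletions js. l (coroot D (fst p)) * dems (snd p) f x))"
  using assms(1)
proof (induction js)
  case (Cons \<alpha> js)
  then have \<alpha>: "\<alpha> \<in> \<Phi>" and js: "set js \<subseteq> \<Delta>" by (auto simp: simple_root)
  let ?l = "l \<circ> word D (rev js)"
  have l: "?l \<in> dual D" using js assms(2) by (intro dual_comp linear_word) auto
  have f: "dems js f \<in> polys" using js assms(3) by (rule dems_polys)
  have del: "dems (snd p) f \<in> polys" if "p \<in> set (deletions js)" for p
    using deletionsD(2)[of "fst p" "snd p" js] that js assms(3) by (intro dems_polys) auto
  have "dems (\<alpha> # js) (\<lambda>x. l x * f x)
      = dem \<alpha> (\<lambda>x. ?l x * dems js f x + (\<Sum>p\<leftarrow>deletions js. l (coroot D (fst p)) * dems (snd p) f x))"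
    using Cons.IH[OF js] by simp
  also have "\<dots> = (\<lambda>x. dem \<alpha> (\<lambda>x. ?l x * dems js f x) x
      + (\<Sum>p\<leftarrow>deletions js. l (coroot D (fst p)) * dem \<alpha> (dems (snd p) f) x))"
    using del dem_sum_list[OF \<alpha>, of "deletions js" "\<lambda>p. dems (snd p) f" "\<lambda>p. l (coroot D (fst p))"]
    by (subst dem_add[OF polys_mult[OF dual_polys[OF l] f] polys_sum_list \<alpha>]) auto
  also have "dem \<alpha> (\<lambda>x. ?l x * dems js f x)
      = (\<lambda>x. ?l (\<sigma> \<alpha> x) * dem \<alpha> (dems js f) x + ?l (coroot D \<alpha>) * dems js f x)"
    by (rule dem_dual_mult[OF l f \<alpha>])
  \<comment> \<open>The constant obtained from the new letter is thereby expressed by the root that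
    \<open>deletions\<close> records for it.\<close>
  also have "?l (coroot D \<alpha>) = l (coroot D (\<alpha> \<circ> word D js))"
    using coroot_comp_word[OF js \<alpha>] by simp
  also have "(\<lambda>x. ?l (\<sigma> \<alpha> x)) = (\<lambda>x. l (word D (rev (\<alpha> # js)) x))"
    by (simp add: word_append)
  finally show ?case
    by (simp add: case_prod_beta' comp_def word_append add.assoc)
qed simp

text \<open>The braid relations are bypassed: moving a linear factor through \<open>dems js\<close> produces the
  operators of shorter words, and by \<open>sum_deletions\<close> their sum depends only on the product and
  the length of \<open>js\<close>.\<close>

lemma dems_cong_hom:
  assumes "f \<in> hom_polys n"
  shows "\<forall>js ks. set js \<subseteq> \<Delta> \<longrightarrow> set ks \<subseteq> \<Delta> \<longrightarrow> length js = length ks \<longrightarrow>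
    word D js = word D ks \<longrightarrow> dems js f = dems ks f"
  using assms
proof (induction rule: hom_polys_induct)
  case (const k)
  have "dems js (\<lambda>x. k) = dems ks (\<lambda>x. k)"
    if "set js \<subseteq> \<Delta>" "set ks \<subseteq> \<Delta>" "length js = length ks" for js ks
  proof (cases "js = []")
    case False
    then have "0 < length js" "0 < length ks" using that(3) by auto
    then show ?thesis using dems_hom_polys_vanish[OF _ hom_polys_const] that by metis
  qed (use that in simp)
  then show ?case by blast
next
  case (mult l n f)
  have f: "f \<in> polys" using mult(2) by (rule hom_polys_polys)
  \<comment> \<open>The summand has to be a function of the root alone, so \<open>SOME\<close> picks
    a word with one letter less and product \<open>w \<circ> \<rho>\<close>. By the induction
    hypothesis every deletion carrying that root gives the same operator on
    \<open>f\<close>.\<close>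
  define T where "T m w \<rho> x = dems (SOME ks. set ks \<subseteq> \<Delta> \<and> Suc (length ks) = m \<and> word D ks = w \<circ> \<rho>) f x"
    for m and w \<rho> :: "'h \<Rightarrow> 'h" and x
  define F where "F m w x \<gamma> = l (coroot D \<gamma>) * T m w (\<sigma> \<gamma>) x" for m w x \<gamma>
  have sum: "(\<Sum>p\<leftarrow>deletions js. l (coroot D (fst p)) * dems (snd p) f x)
      = (\<Sum>\<gamma>\<in>inversions (word D js). F (length js) (word D js) x \<gamma>)" if js: "set js \<subseteq> \<Delta>" for js x
  proof -
    have "(\<Sum>p\<leftarrow>deletions js. l (coroot D (fst p)) * dems (snd p) f x)
        = (\<Sum>(\<gamma>, ks)\<leftarrow>deletions js. F (length js) (word D js) x \<gamma>)"
    proof (intro arg_cong[where f = sum_list] map_cong refl)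
      fix p assume p: "p \<in> set (deletions js)"
      obtain \<gamma> ks where p_eq: "p = (\<gamma>, ks)" by (cases p)
      let ?P = "\<lambda>ks. set ks \<subseteq> \<Delta> \<and> Suc (length ks) = length js \<and> word D ks = word D js \<circ> \<sigma> \<gamma>"
      have ks: "?P ks" using deletionsD[of \<gamma> ks js] p js p_eq by blast
      define ks' where "ks' = Eps ?P"
      have ks': "?P ks'" unfolding ks'_def by (rule someI) (rule ks)
      have "length ks = length ks'" "word D ks = word D ks'" using ks ks' by simp_all
      then have "dems ks f = dems ks' f" using mult(3) ks ks' by blast
      then show "l (coroot D (fst p)) * dems (snd p) f x
          = (case p of (\<gamma>, ks) \<Rightarrow> F (length js) (word D js) x \<gamma>)"
        by (simp add: p_eq F_def T_def ks'_def)
    qed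
    \<comment> \<open>\<open>F\<close> is odd in the root: negation changes the sign of the coroot
      and keeps the reflection.\<close>
    also have "\<dots> = (\<Sum>\<gamma>\<in>inversions (word D js). F (length js) (word D js) x \<gamma>)"
      using js mult(1) by (intro sum_deletions) (auto simp: F_def refl_neg coroot_neg dual_uminus)
    finally show ?thesis .
  qed
  have "dems js (\<lambda>x. l x * f x) = dems ks (\<lambda>x. l x * f x)"
    if js: "set js \<subseteq> \<Delta>" and ks: "set ks \<subseteq> \<Delta>" and len: "length js = length ks"
      and eq: "word D js = word D ks" for js ks
  proof -
    have "word D (rev js) = word D (rev ks)" using inv_word js ks eq by metis
    moreover have "dems js f = dems ks f" using mult(3) js ks len eq by blast
    ultimately show ?thesis
      by (simp only: dems_dual_mult[OF js mult(1) f] dems_dual_mult[OF ks mult(1) f]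
          sum[OF js] sum[OF ks] eq len)
  qed
  then show ?case by blast
next
  case (add n f g)
  have fg: "f \<in> polys" "g \<in> polys" using add(1,2) hom_polys_polys by auto
  show ?case
  proof (intro allI impI)
    fix js ks
    assume js: "set js \<subseteq> \<Delta>" and ks: "set ks \<subseteq> \<Delta>"
      and eq: "length js = length ks" "word D js = word D ks"
    have "dems js f = dems ks f" "dems js g = dems ks g" using add(3,4) js ks eq by blast+
    then show "dems js (\<lambda>x. f x + g x) = dems ks (\<lambda>x. f x + g x)"
      by (simp only: dems_add[OF js fg] dems_add[OF ks fg])
  qed
qed

lemma dems_cong:
  assumes "set js \<subseteq> \<Delta>" "set ks \<subseteq> \<Delta>" "length js = length ks" "word D js = word D ks" "f \<in> polys"
  shows "dems js f = dems ks f"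
  using assms(5)
proof (induction rule: polys_induct)
  case (hom n f)
  then show ?case using dems_cong_hom assms(1-4) by blast
next
  case (add f g)
  then show ?case by (simp add: dems_add assms(1,2))
qed

lemma reduced_expression_some: "w \<in> weyl D \<Longrightarrow> reduced_expression D w (SOME js. reduced_expression D w js)"
  using reduced_expression_exists by (rule someI_ex)

lemma demazure_eq_dems:
  "w \<in> weyl D \<Longrightarrow> \<exists>js. set js \<subseteq> \<Delta> \<and> word D js = w \<and> length js = len D w \<and> demazure D w = dems js"
  using reduced_expression_some[of w] by (auto simp: reduced_expression_def demazure_def dems_def)

lemma dems_replicate_Suc_Suc:
  assumes "\<alpha> \<in> \<Phi>" "f \<in> polys" shows "dems (replicate (Suc (Suc m)) \<alpha>) f = (\<lambda>x. 0)"
proof (induction m)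
  case 0
  show ?case using assms by (simp add: dem_dem)
next
  case (Suc m)
  then show ?case using dem_zero[OF assms(1)] by simp
qed

lemma word_replicate_double: "\<alpha> \<in> \<Phi> \<Longrightarrow> word D (replicate (2 * m) \<alpha>) = id"
proof (induction m)
  case (Suc m)
  have "word D (replicate (2 * Suc m) \<alpha>) = \<sigma> \<alpha> \<circ> \<sigma> \<alpha> \<circ> word D (replicate (2 * m) \<alpha>)"
    by (simp add: comp_assoc)
  then show ?case using Suc by (simp add: refl_o_refl)
qed simp

text \<open>The excess of a nonreduced word over the length of its product is even and positive.
  Padding a reduced word with that many copies of one simple root keeps the product, so
  \<open>dems_cong\<close> applies, and two equal adjacent operators compose to zero.\<close>

lemma dems_eq_demazure:
  assumes js: "set js \<subseteq> \<Delta>" and f: "f \<in> polys"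
  shows "dems js f = (if length js = len D (word D js) then demazure D (word D js) f else (\<lambda>x. 0))"
proof -
  let ?w = "word D js"
  obtain ks where ks: "set ks \<subseteq> \<Delta>" "word D ks = ?w" "length ks = len D ?w" "demazure D ?w = dems ks"
    using demazure_eq_dems[OF word_weyl[OF js]] by blast
  show ?thesis
  proof (cases "length js = len D ?w")
    case True
    have "dems js f = dems ks f"
      using True ks(2,3) by (intro dems_cong[OF js ks(1) _ _ f]) simp_all
    then show ?thesis using True ks(4) by simp
  next
    case False
    then have less: "len D ?w < length js" using len_word[OF js] by simp
    then have "even (length js - len D ?w)" using len_word_parity[OF js] by simp
    then obtain m where "length js - len D ?w = 2 * m" by (rule evenE)
    then have m: "length js = len D ?w + 2 * m" "0 < m" using less by auto
    obtain \<alpha> where \<alpha>: "\<alpha> \<in> \<Delta>" using less js by (cases js) auto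
    have "dems js f = dems (ks @ replicate (2 * m) \<alpha>) f"
    proof (rule dems_cong[OF js _ _ _ f])
      show "word D js = word D (ks @ replicate (2 * m) \<alpha>)"
        using ks by (simp add: word_append word_replicate_double simple_root[OF \<alpha>])
    qed (use ks \<alpha> m in auto)
    also have "\<dots> = (\<lambda>x. 0)"
    proof -
      obtain m' where m': "2 * m = Suc (Suc m')" using m(2) by (cases m) auto
      have "dems (replicate (2 * m) \<alpha>) f = (\<lambda>x. 0)"
        unfolding m' by (rule dems_replicate_Suc_Suc[OF simple_root[OF \<alpha>] f])
      then show ?thesis unfolding dems_append by (simp only: dems_zero[OF ks(1)])
    qed
    finally show ?thesis using False by simp
  qed
qed

lemma demazure_polys: "w \<in> weyl D \<Longrightarrow> f \<in> polys \<Longrightarrow> demazure D w f \<in> polys"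
  using demazure_eq_dems[of w] dems_polys by auto

lemma demazure_demazure:
  assumes "v \<in> weyl D" "w \<in> weyl D" "f \<in> polys"
  shows "demazure D v (demazure D w f) =
    (if len D (v \<circ> w) = len D v + len D w then demazure D (v \<circ> w) f else (\<lambda>x. 0))"
proof -
  obtain js where js: "set js \<subseteq> \<Delta>" "word D js = v" "length js = len D v" "demazure D v = dems js"
    using demazure_eq_dems[OF assms(1)] by blast
  obtain ks where ks: "set ks \<subseteq> \<Delta>" "word D ks = w" "length ks = len D w" "demazure D w = dems ks"
    using demazure_eq_dems[OF assms(2)] by blast
  show ?thesis
    using dems_eq_demazure[of "js @ ks" f] js ks assms(3) by (auto simp: word_append dems_append)
qed

lemma len_refl: assumes "\<alpha> \<in> \<Delta>" shows "len D (\<sigma> \<alpha>) = 1"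
proof -
  have "odd (len D (\<sigma> \<alpha>))" using len_word_parity[of "[\<alpha>]"] assms by simp
  moreover have "len D (\<sigma> \<alpha>) \<le> 1" using len_word[of "[\<alpha>]"] assms by simp
  ultimately show ?thesis by (metis dvd_0_right le_neq_implies_less less_one)
qed

lemma demazure_refl: "\<alpha> \<in> \<Delta> \<Longrightarrow> f \<in> polys \<Longrightarrow> demazure D (\<sigma> \<alpha>) f = dem \<alpha> f"
  using dems_eq_demazure[of "[\<alpha>]" f] by (simp add: len_refl)


subsection \<open>The ideal generated by the invariants of positive degree\<close>

abbreviation "R \<equiv> sym_algebra D"
abbreviation "I\<^sub>W \<equiv> invariant_ideal D"
abbreviation "w\<^sub>0 \<equiv> longest D"
abbreviation "N \<equiv> card \<Phi>\<^sub>p"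

lemma sym_algebra_simps [simp]:
  "f \<otimes>\<^bsub>R\<^esub> g = (\<lambda>x. f x * g x)" "f \<oplus>\<^bsub>R\<^esub> g = (\<lambda>x. f x + g x)"
  "\<one>\<^bsub>R\<^esub> = (\<lambda>x. 1)" "\<zero>\<^bsub>R\<^esub> = (\<lambda>x. 0)"
  by (simp_all add: sym_algebra_def)

lemma cring_sym_algebra: "cring R"
proof (rule cringI)
  show "abelian_group R"
  proof (rule abelian_groupI)
    fix f assume "f \<in> polys"
    then show "\<exists>g\<in>polys. g \<oplus>\<^bsub>R\<^esub> f = \<zero>\<^bsub>R\<^esub>"
      using polys_smult[of f "-1"] by (intro bexI[of _ "\<lambda>x. -1 * f x"]) auto
  qed (auto simp: polys_add polys_const algebra_simps)
  show "comm_monoid R"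
    by (rule comm_monoidI) (auto simp: polys_mult polys_const algebra_simps)
qed (auto simp: algebra_simps)

lemma ring_sym_algebra: "ring R"
  using cring_sym_algebra by (rule cring.axioms)

definition invariants :: "('h \<Rightarrow> complex) set" where
  "invariants = {f. (\<exists>k>0. f \<in> hom_polys k) \<and> (\<forall>w\<in>weyl D. weyl_act w f = f)}"

lemma invariants_polys: "invariants \<subseteq> polys"
  by (auto simp: invariants_def hom_polys_polys)

lemma invariant_ideal_eq: "I\<^sub>W = Idl\<^bsub>R\<^esub> invariants"
  by (simp add: invariant_ideal_def invariants_def)

lemma ideal_invariant_ideal: "ideal I\<^sub>W R"
  unfolding invariant_ideal_eq using ring_sym_algebra invariants_polys by (rule ring.genideal_ideal)

lemma ideal_polys: "f \<in> I\<^sub>W \<Longrightarrow> f \<in> polys"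
  using ideal.Icarr[OF ideal_invariant_ideal] .

lemma ideal_mult: "p \<in> polys \<Longrightarrow> f \<in> I\<^sub>W \<Longrightarrow> (\<lambda>x. p x * f x) \<in> I\<^sub>W"
  using ideal.I_l_closed[OF ideal_invariant_ideal] by fastforce

lemma ideal_add: "f \<in> I\<^sub>W \<Longrightarrow> g \<in> I\<^sub>W \<Longrightarrow> (\<lambda>x. f x + g x) \<in> I\<^sub>W"
  using additive_subgroup.a_closed[OF ideal.axioms(1)[OF ideal_invariant_ideal]] by fastforce

lemma ideal_zero: "(\<lambda>x. 0) \<in> I\<^sub>W"
  using additive_subgroup.zero_closed[OF ideal.axioms(1)[OF ideal_invariant_ideal]] by simp

lemma invariants_ideal: "f \<in> invariants \<Longrightarrow> f \<in> I\<^sub>W"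
  unfolding invariant_ideal_eq
  using ring.genideal_self[OF ring_sym_algebra invariants_polys] by blast

lemma ideal_smult: "f \<in> I\<^sub>W \<Longrightarrow> (\<lambda>x. k * f x) \<in> I\<^sub>W"
  using ideal_mult[OF polys_const] .

lemma ideal_diff: "f \<in> I\<^sub>W \<Longrightarrow> g \<in> I\<^sub>W \<Longrightarrow> (\<lambda>x. f x - g x) \<in> I\<^sub>W"
  using ideal_add[OF _ ideal_smult[of g "-1"]] by simp

lemma ideal_sum: "(\<And>i. i \<in> A \<Longrightarrow> f i \<in> I\<^sub>W) \<Longrightarrow> (\<lambda>x. \<Sum>i\<in>A. f i x) \<in> I\<^sub>W"
  by (induction A rule: infinite_finite_induct) (auto simp: ideal_zero ideal_add)

text \<open>The elements of the ideal with property \<open>Q\<close> form an ideal containing the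
  generators.\<close>

lemma invariant_ideal_induct [consumes 1, case_names zero gen add mult]:
  assumes f: "f \<in> I\<^sub>W"
    and zero: "Q (\<lambda>x. 0)"
    and gen: "\<And>g. g \<in> invariants \<Longrightarrow> Q g"
    and add: "\<And>g h. g \<in> I\<^sub>W \<Longrightarrow> h \<in> I\<^sub>W \<Longrightarrow> Q g \<Longrightarrow> Q h \<Longrightarrow> Q (\<lambda>x. g x + h x)"
    and mult: "\<And>p g. p \<in> polys \<Longrightarrow> g \<in> I\<^sub>W \<Longrightarrow> Q g \<Longrightarrow> Q (\<lambda>x. p x * g x)"
  shows "Q f"
proof -
  interpret ring R by (rule ring_sym_algebra)
  let ?J = "{f \<in> I\<^sub>W. Q f}"
  have inv: "\<ominus>\<^bsub>R\<^esub> g = (\<lambda>x. -1 * g x)" if "g \<in> polys" for g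
    using that polys_smult[of g "-1"] by (intro minus_equality) auto
  have "ideal ?J R"
  proof (rule idealI)
    show "subgroup ?J (add_monoid R)"
    proof (rule add.subgroupI)
      show "?J \<subseteq> polys" using ideal_polys by auto
      show "?J \<noteq> {}" using ideal_zero zero by auto
      show "\<ominus>\<^bsub>R\<^esub> g \<in> ?J" if "g \<in> ?J" for g
        using that mult[OF polys_const[of "-1"]] ideal_smult[of g "-1"] inv[OF ideal_polys] by auto
      show "g \<oplus>\<^bsub>R\<^esub> h \<in> ?J" if "g \<in> ?J" "h \<in> ?J" for g h
        using that add ideal_add by auto
    qed
    show "p \<otimes>\<^bsub>R\<^esub> g \<in> ?J" if "g \<in> ?J" "p \<in> polys" for g p
      using that mult ideal_mult by auto
    then show "g \<otimes>\<^bsub>R\<^esub> p \<in> ?J" if "g \<in> ?J" "p \<in> polys" for g p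
      using that by (simp add: mult.commute[of "g _"])
  qed (rule ring_sym_algebra)
  moreover have "invariants \<subseteq> ?J" using gen invariants_ideal by auto
  ultimately have "I\<^sub>W \<subseteq> ?J" unfolding invariant_ideal_eq by (rule genideal_minimal)
  then show ?thesis using f by auto
qed

lemma invariants_at_0: "f \<in> invariants \<Longrightarrow> f 0 = 0"
  by (auto simp: invariants_def hom_polys_at_0)

lemma ideal_at_0: "f \<in> I\<^sub>W \<Longrightarrow> f 0 = 0"
  by (induction rule: invariant_ideal_induct) (auto simp: invariants_at_0)

lemma invariants_weyl: "f \<in> invariants \<Longrightarrow> w \<in> weyl D \<Longrightarrow> f (w x) = f x"
proof -
  assume f: "f \<in> invariants" and w: "w \<in> weyl D"
  then have "weyl_act (inv_into UNIV w) f = f" by (simp add: invariants_def weyl_inv)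
  then have "f \<circ> w = f" by (simp add: weyl_act_def weyl_inv_inv w)
  then show "f (w x) = f x" by (metis comp_apply)
qed

lemma dem_ideal: assumes "f \<in> I\<^sub>W" and \<alpha>: "\<alpha> \<in> \<Delta>" shows "dem \<alpha> f \<in> I\<^sub>W"
  using assms(1)
proof (induction rule: invariant_ideal_induct)
  case zero
  then show ?case using \<alpha> by (simp add: dem_zero simple_root ideal_zero)
next
  case (gen g)
  then have "dem \<alpha> g = (\<lambda>x. 0)"
    using \<alpha> invariants_polys by (intro dem_invariant) (auto simp: simple_root invariants_weyl refl_weyl)
  then show ?case by (simp add: ideal_zero)
next
  case (add g h)
  then show ?case using \<alpha> by (simp add: dem_add ideal_polys simple_root ideal_add)
next
  case (mult p g)
  have "(\<lambda>x. p (\<sigma> \<alpha> x) * dem \<alpha> g x) \<in> I\<^sub>W"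
    using mult \<alpha> by (intro ideal_mult refl_polys) (auto simp: simple_root)
  moreover have "(\<lambda>x. dem \<alpha> p x * g x) \<in> I\<^sub>W"
    using mult \<alpha> by (intro ideal_mult dem_polys) (auto simp: simple_root)
  ultimately show ?case
    using mult \<alpha> by (simp add: dem_mult ideal_polys simple_root ideal_add)
qed

lemma dems_ideal: "f \<in> I\<^sub>W \<Longrightarrow> set js \<subseteq> \<Delta> \<Longrightarrow> dems js f \<in> I\<^sub>W"
  by (induction js) (auto simp: dem_ideal)

lemma demazure_ideal: "f \<in> I\<^sub>W \<Longrightarrow> w \<in> weyl D \<Longrightarrow> demazure D w f \<in> I\<^sub>W"
  using demazure_eq_dems[of w] dems_ideal by auto

lemma refl_ideal: assumes "f \<in> I\<^sub>W" "\<alpha> \<in> \<Delta>" shows "(\<lambda>x. f (\<sigma> \<alpha> x)) \<in> I\<^sub>W"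
proof -
  have "(\<lambda>x. f x - \<alpha> x * dem \<alpha> f x) \<in> I\<^sub>W"
    using assms by (intro ideal_diff ideal_mult dual_polys simple_dual dem_ideal)
  then show ?thesis using assms by (simp add: dem_eq ideal_polys simple_root)
qed


subsection \<open>Constant terms of Demazure operators\<close>

definition coef :: "('h \<Rightarrow> 'h) \<Rightarrow> ('h \<Rightarrow> complex) \<Rightarrow> complex" where
  "coef w f = demazure D w f 0"

lemma demazure_add:
  "w \<in> weyl D \<Longrightarrow> f \<in> polys \<Longrightarrow> g \<in> polys \<Longrightarrow>
    demazure D w (\<lambda>x. f x + g x) = (\<lambda>x. demazure D w f x + demazure D w g x)"
  using demazure_eq_dems[of w] dems_add by auto

lemma demazure_smult:
  "w \<in> weyl D \<Longrightarrow> f \<in> polys \<Longrightarrow> demazure D w (\<lambda>x. k * f x) = (\<lambda>x. k * demazure D w f x)"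
  using demazure_eq_dems[of w] dems_smult by auto

lemma demazure_hom_polys:
  "w \<in> weyl D \<Longrightarrow> f \<in> hom_polys n \<Longrightarrow> demazure D w f \<in> hom_polys (n - len D w)"
  using demazure_eq_dems[of w] dems_hom_polys by metis

lemma demazure_hom_polys_vanish:
  "w \<in> weyl D \<Longrightarrow> f \<in> hom_polys n \<Longrightarrow> n < len D w \<Longrightarrow> demazure D w f = (\<lambda>x. 0)"
  using demazure_eq_dems[of w] dems_hom_polys_vanish by metis

lemma coef_add:
  "w \<in> weyl D \<Longrightarrow> f \<in> polys \<Longrightarrow> g \<in> polys \<Longrightarrow> coef w (\<lambda>x. f x + g x) = coef w f + coef w g"
  by (simp add: coef_def demazure_add)

lemma coef_smult: "w \<in> weyl D \<Longrightarrow> f \<in> polys \<Longrightarrow> coef w (\<lambda>x. k * f x) = k * coef w f"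
  by (simp add: coef_def demazure_smult)

lemma coef_zero: "w \<in> weyl D \<Longrightarrow> coef w (\<lambda>x. 0) = 0"
  using coef_smult[OF _ polys_const, of w 0] by simp

lemma coef_sum:
  "w \<in> weyl D \<Longrightarrow> (\<And>i. i \<in> A \<Longrightarrow> f i \<in> polys) \<Longrightarrow>
    coef w (\<lambda>x. \<Sum>i\<in>A. f i x) = (\<Sum>i\<in>A. coef w (f i))"
  by (induction A rule: infinite_finite_induct) (auto simp: coef_zero coef_add polys_sum)

lemma coef_hom_polys:
  assumes "w \<in> weyl D" "f \<in> hom_polys n" "n \<noteq> len D w" shows "coef w f = 0"
proof (cases "n < len D w")
  case True
  then show ?thesis using demazure_hom_polys_vanish assms by (simp add: coef_def)
next
  case False
  then show ?thesis
    using hom_polys_at_0[OF demazure_hom_polys[OF assms(1,2)]] assms(3) by (simp add: coef_def)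
qed

lemma coef_ideal: "f \<in> I\<^sub>W \<Longrightarrow> w \<in> weyl D \<Longrightarrow> coef w f = 0"
  by (simp add: coef_def demazure_ideal ideal_at_0)

text \<open>Each difference \<open>f x - f (\<sigma> \<alpha> x)\<close> is \<alpha> times a
  Demazure operator applied to \<open>f\<close>. These differences telescope along a word, since the
  ideal is stable under simple reflections.\<close>

lemma dem_ideal_weyl:
  assumes f: "f \<in> polys" and dem: "\<And>\<alpha>. \<alpha> \<in> \<Delta> \<Longrightarrow> dem \<alpha> f \<in> I\<^sub>W" and js: "set js \<subseteq> \<Delta>"
  shows "(\<lambda>x. f x - f (word D js x)) \<in> I\<^sub>W"
  using js
proof (induction js rule: rev_induct)
  case Nil
  then show ?case by (simp add: ideal_zero)
next
  case (snoc \<alpha> js)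
  then have \<alpha>: "\<alpha> \<in> \<Delta>" by simp
  have "(\<lambda>x. f x - f (word D js x)) \<in> I\<^sub>W" using snoc by simp
  from refl_ideal[OF this \<alpha>]
  have "(\<lambda>x. f (\<sigma> \<alpha> x) - f (word D js (\<sigma> \<alpha> x))) \<in> I\<^sub>W" .
  moreover have "(\<lambda>x. \<alpha> x * dem \<alpha> f x) \<in> I\<^sub>W"
    using \<alpha> by (intro ideal_mult dual_polys simple_dual dem)
  then have "(\<lambda>x. f x - f (\<sigma> \<alpha> x)) \<in> I\<^sub>W" using f \<alpha> by (simp add: dem_eq simple_root)
  ultimately have "(\<lambda>x. f x - f (\<sigma> \<alpha> x) + (f (\<sigma> \<alpha> x) - f (word D js (\<sigma> \<alpha> x)))) \<in> I\<^sub>W"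
    by (rule ideal_add[rotated])
  then show ?case by (simp add: word_append)
qed

lemma weyl_sum_reindex:
  assumes "v \<in> weyl D" shows "(\<Sum>w\<in>weyl D. F (w \<circ> v)) = (\<Sum>w\<in>weyl D. F w)"
  by (rule sum.reindex_bij_witness[of _ "\<lambda>w. w \<circ> inv_into UNIV v" "\<lambda>w. w \<circ> v"])
    (use assms weyl_inv_comp[OF assms] in \<open>auto simp: weyl_comp weyl_inv comp_assoc\<close>)

lemma card_weyl: "card (weyl D) \<noteq> 0"
  using finite_weyl id_weyl by auto

lemma hom_polys_ideal_if_coef:
  "f \<in> hom_polys n \<Longrightarrow> (\<And>w. w \<in> weyl D \<Longrightarrow> coef w f = 0) \<Longrightarrow> f \<in> I\<^sub>W"
proof (induction n arbitrary: f)
  case 0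
  have f: "f = (\<lambda>x. f 0)" using hom_polys_const_iff[OF 0(1)] .
  have "demazure D id f = f"
    using dems_eq_demazure[of "[]" f] hom_polys_polys[OF 0(1)] by (simp add: len_id)
  then have "f 0 = 0" using 0(2)[OF id_weyl] by (simp only: coef_def)
  then show ?case using f ideal_zero by simp
next
  case (Suc n)
  have f: "f \<in> polys" using hom_polys_polys[OF Suc.prems(1)] .
  \<comment> \<open>A coordinate of \<open>dem \<alpha> f\<close> is either a coordinate of
    \<open>f\<close> itself, at \<open>w \<circ> \<sigma> \<alpha>\<close>, or zero because the
    lengths do not add up.\<close>
  have dem: "dem \<alpha> f \<in> I\<^sub>W" if \<alpha>: "\<alpha> \<in> \<Delta>" for \<alpha>
  proof (rule Suc.IH)
    show "dem \<alpha> f \<in> hom_polys n" using dem_hom_polys(1)[OF Suc.prems(1) simple_root[OF \<alpha>]] by simp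
    fix w assume w: "w \<in> weyl D"
    have "coef (w \<circ> \<sigma> \<alpha>) f = 0"
      by (rule Suc.prems(2)[OF weyl_comp[OF w refl_weyl[OF \<alpha>]]])
    then have "demazure D w (demazure D (\<sigma> \<alpha>) f) 0 = 0"
      using demazure_demazure[OF w refl_weyl[OF \<alpha>] f] by (simp add: coef_def)
    then show "coef w (dem \<alpha> f) = 0" by (simp add: demazure_refl \<alpha> f coef_def)
  qed
  \<comment> \<open>The average up to the factor \<open>card (weyl D)\<close>. It is invariant of
    positive degree, hence a generator, and adding the differences \<open>f x - f (w x)\<close> for
    all \<open>w\<close> gives \<open>card (weyl D)\<close> times \<open>f\<close>.\<close>
  define g where "g x = (\<Sum>w\<in>weyl D. (f \<circ> w) x)" for x
  have hom: "g \<in> hom_polys (Suc n)"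
    unfolding g_def using Suc.prems(1) weyl_linear by (intro hom_polys_sum hom_polys_comp)
  have "weyl_act v g = g" if "v \<in> weyl D" for v
  proof
    fix x
    have "weyl_act v g x = (\<Sum>w\<in>weyl D. (f \<circ> (w \<circ> inv_into UNIV v)) x)"
      by (simp add: weyl_act_def g_def)
    also have "\<dots> = g x"
      unfolding g_def using weyl_sum_reindex[OF weyl_inv[OF that], of "\<lambda>w. (f \<circ> w) x"] .
    finally show "weyl_act v g x = g x" .
  qed
  then have g: "g \<in> I\<^sub>W" using hom by (intro invariants_ideal) (auto simp: invariants_def)
  have "(\<lambda>x. \<Sum>w\<in>weyl D. f x - f (w x)) \<in> I\<^sub>W"
  proof (rule ideal_sum)
    fix w assume "w \<in> weyl D"
    then show "(\<lambda>x. f x - f (w x)) \<in> I\<^sub>W" using dem_ideal_weyl[OF f dem] by (auto elim!: weyl_cases)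
  qed
  from ideal_smult[OF ideal_add[OF this g], of "1 / of_nat (card (weyl D))"]
  show ?case using card_weyl by (simp add: g_def sum_subtractf)
qed

text \<open>The functional \<open>coef w\<close> sees only the component of degree
  \<open>len D w\<close>, so its vanishing on \<open>f\<close> passes to every homogeneous
  component.\<close>

lemma ideal_if_coef:
  assumes f: "f \<in> polys" and coef: "\<And>w. w \<in> weyl D \<Longrightarrow> coef w f = 0" shows "f \<in> I\<^sub>W"
proof -
  obtain n g where g: "\<And>k. g k \<in> hom_polys k" "f = (\<lambda>x. \<Sum>k\<le>n. g k x)"
    using f unfolding polys_iff by blast
  have "g k \<in> I\<^sub>W" if "k \<le> n" for k
  proof (rule hom_polys_ideal_if_coef[OF g(1)])
    fix w assume w: "w \<in> weyl D"
    show "coef w (g k) = 0"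
    proof (cases "len D w = k")
      case True
      have "coef w f = (\<Sum>j\<le>n. coef w (g j))"
        unfolding g(2) by (rule coef_sum[OF w hom_polys_polys[OF g(1)]])
      also have "\<dots> = (\<Sum>j\<le>n. if j = k then coef w (g k) else 0)"
        using coef_hom_polys[OF w g(1)] True by (intro sum.cong refl) auto
      finally show ?thesis using coef[OF w] that by simp
    qed (use coef_hom_polys[OF w g(1)] in auto)
  qed
  then show ?thesis unfolding g(2) by (intro ideal_sum) auto
qed

text \<open>The components of \<open>p\<close> of positive degree push \<open>f\<close> beyond
  degree \<open>len D w\<close>, where \<open>coef w\<close> vanishes. This gives both the
  triangularity behind the cell structure and the pairing with the top class.\<close>

lemma coef_mult_hom_polys:
  assumes w: "w \<in> weyl D" and p: "p \<in> polys" and f: "f \<in> hom_polys n" and n: "len D w \<le> n"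
  shows "coef w (\<lambda>x. p x * f x) = p 0 * coef w f"
proof -
  obtain m g where g: "\<And>k. g k \<in> hom_polys (Suc k)" "p = (\<lambda>x. p 0 + (\<Sum>k<m. g k x))"
    using polys_split[OF p] by blast
  have fp: "f \<in> polys" using f by (rule hom_polys_polys)
  have gf: "(\<lambda>x. g k x * f x) \<in> hom_polys (Suc k + n)" for k
    by (rule hom_polys_mult[OF g(1) f])
  have "p x * f x = p 0 * f x + (\<Sum>k<m. g k x * f x)" for x
    using fun_cong[OF g(2), of x] by (simp add: distrib_right sum_distrib_right)
  then have "coef w (\<lambda>x. p x * f x) = coef w (\<lambda>x. p 0 * f x + (\<Sum>k<m. g k x * f x))"
    by presburger
  also have "\<dots> = coef w (\<lambda>x. p 0 * f x) + coef w (\<lambda>x. \<Sum>k<m. g k x * f x)"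
    using fp gf hom_polys_polys by (intro coef_add w polys_smult polys_sum) auto
  also have "coef w (\<lambda>x. \<Sum>k<m. g k x * f x) = (\<Sum>k<m. coef w (\<lambda>x. g k x * f x))"
    using gf hom_polys_polys by (intro coef_sum w) auto
  also have "\<dots> = 0" using n by (intro sum.neutral ballI coef_hom_polys[OF w gf]) auto
  finally show ?thesis by (simp add: coef_smult w fp)
qed


subsection \<open>The product of the positive roots\<close>

definition pos_prod :: "'h \<Rightarrow> complex" where
  "pos_prod x = (\<Prod>\<gamma>\<in>\<Phi>\<^sub>p. \<gamma> x)"

lemma pos_prod_hom_polys: "pos_prod \<in> hom_polys N"
  unfolding pos_prod_def[abs_def] using finite_pos root_dual pos_root by (intro hom_polys_prod) auto

text \<open>A simple reflection negates its own root and permutes the remaining positive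
  roots.\<close>

lemma pos_prod_refl: assumes \<alpha>: "\<alpha> \<in> \<Delta>" shows "pos_prod (\<sigma> \<alpha> x) = - pos_prod x"
proof -
  have split: "pos_prod y = \<alpha> y * (\<Prod>\<gamma>\<in>\<Phi>\<^sub>p - {\<alpha>}. \<gamma> y)" for y
    unfolding pos_prod_def using finite_pos simple_pos[OF \<alpha>] by (rule prod.remove)
  have "(\<Prod>\<gamma>\<in>\<Phi>\<^sub>p - {\<alpha>}. \<gamma> (\<sigma> \<alpha> x)) = (\<Prod>\<gamma>\<in>\<Phi>\<^sub>p - {\<alpha>}. \<gamma> x)"
  proof (rule prod.reindex_bij_witness[of _ "\<lambda>\<gamma>. \<gamma> \<circ> \<sigma> \<alpha>" "\<lambda>\<gamma>. \<gamma> \<circ> \<sigma> \<alpha>"])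
    fix \<gamma> assume \<gamma>: "\<gamma> \<in> \<Phi>\<^sub>p - {\<alpha>}"
    show "\<gamma> \<circ> \<sigma> \<alpha> \<circ> \<sigma> \<alpha> = \<gamma>" using \<alpha> by (simp add: comp_refl_refl simple_root)
    have "\<gamma> \<circ> \<sigma> \<alpha> \<noteq> \<alpha>"
    proof
      assume "\<gamma> \<circ> \<sigma> \<alpha> = \<alpha>"
      then have "\<gamma> = \<alpha> \<circ> \<sigma> \<alpha>" using comp_refl_refl[OF simple_root[OF \<alpha>], of \<gamma>] by simp
      then show False
        using \<gamma> root_comp_refl_self[OF simple_root[OF \<alpha>]] not_pos_neg[OF simple_pos[OF \<alpha>]] by auto
    qed
    then show "\<gamma> \<circ> \<sigma> \<alpha> \<in> \<Phi>\<^sub>p - {\<alpha>}" using pos_comp_simple_refl[OF \<alpha>] \<gamma> by auto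
    then show "\<gamma> \<circ> \<sigma> \<alpha> \<in> \<Phi>\<^sub>p - {\<alpha>}" .
  qed (use \<alpha> in \<open>auto simp: comp_refl_refl simple_root\<close>)
  moreover have "\<alpha> (\<sigma> \<alpha> x) = - \<alpha> x"
    using fun_cong[OF root_comp_refl_self[OF simple_root[OF \<alpha>]], of x] by simp
  ultimately show ?thesis by (simp add: split)
qed

lemma antisymmetric_word:
  assumes "\<And>\<alpha> x. \<alpha> \<in> \<Delta> \<Longrightarrow> f (\<sigma> \<alpha> x) = - f x" "set js \<subseteq> \<Delta>"
  shows "f (word D js x) = (-1) ^ length js * (f x :: complex)"
  using assms(2) by (induction js arbitrary: x) (auto simp: assms(1))

lemma minus_one_power_len_word:
  "set js \<subseteq> \<Delta> \<Longrightarrow> (-1 :: complex) ^ len D (word D js) = (-1) ^ length js"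
  using len_word_parity[of js] by (metis neg_one_even_power neg_one_odd_power)

text \<open>The usual alternating sum, left without normalization. Since an element and its inverse
  have the same length, acting by the inverses would merely reindex it.\<close>

definition antisymmetrize :: "('h \<Rightarrow> complex) \<Rightarrow> 'h \<Rightarrow> complex" where
  "antisymmetrize f x = (\<Sum>w\<in>weyl D. (-1) ^ len D w * f (w x))"

lemma antisymmetrize_polys: assumes "f \<in> polys" shows "antisymmetrize f \<in> polys"
proof -
  have "(\<lambda>x. \<Sum>w\<in>weyl D. (-1) ^ len D w * (f \<circ> w) x) \<in> polys"
    by (intro polys_sum polys_smult polys_comp assms weyl_linear)
  then show ?thesis by (simp add: antisymmetrize_def[abs_def])
qed

lemma antisymmetrize_refl:
  assumes \<alpha>: "\<alpha> \<in> \<Delta>" shows "antisymmetrize f (\<sigma> \<alpha> x) = - antisymmetrize f x"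
proof -
  \<comment> \<open>The parity rule concerns multiplication from the left; passing to inverses,
    which preserves length, transfers it to the right.\<close>
  have sign: "(-1 :: complex) ^ len D w = - ((-1) ^ len D (w \<circ> \<sigma> \<alpha>))" if w: "w \<in> weyl D" for w
  proof -
    have "len D (w \<circ> \<sigma> \<alpha>) = len D (\<sigma> \<alpha> \<circ> inv_into UNIV w)"
      using len_inv[OF weyl_comp[OF w refl_weyl[OF \<alpha>]]] w \<alpha>
      by (simp add: inv_weyl_comp refl_weyl inv_refl simple_root)
    then have "even (len D (w \<circ> \<sigma> \<alpha>)) \<longleftrightarrow> odd (len D w)"
      using len_refl_comp_parity[OF \<alpha> weyl_inv[OF w]] len_inv[OF w] by simp
    then show ?thesis by (cases "even (len D w)") auto
  qed
  have "antisymmetrize f (\<sigma> \<alpha> x) = - (\<Sum>w\<in>weyl D. (-1) ^ len D (w \<circ> \<sigma> \<alpha>) * f ((w \<circ> \<sigma> \<alpha>) x))"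
    unfolding antisymmetrize_def by (simp add: sign flip: sum_negf)
  also have "\<dots> = - antisymmetrize f x"
    unfolding antisymmetrize_def
    by (subst weyl_sum_reindex[OF refl_weyl[OF \<alpha>], of "\<lambda>w. (-1) ^ len D w * f (w x)"]) simp
  finally show ?thesis .
qed

text \<open>Polynomial functions restricted to a subspace have no zero divisors, so finitely many
  functionals that are nonzero on it have a common point of nonvanishing.\<close>

lemma prod_nonzero_on_subspace:
  assumes U: "V.subspace U" and "finite S"
    and "\<And>\<alpha>. \<alpha> \<in> S \<Longrightarrow> \<alpha> \<in> dual D" "\<And>\<alpha>. \<alpha> \<in> S \<Longrightarrow> \<exists>x\<in>U. \<alpha> x \<noteq> 0"
  shows "\<exists>x\<in>U. (\<Prod>\<alpha>\<in>S. \<alpha> x) \<noteq> 0"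
  using assms(2-)
proof (induction S rule: finite_induct)
  case empty
  then show ?case using V.subspace_0[OF U] by auto
next
  case (insert \<beta> S)
  obtain x where x: "x \<in> U" "\<beta> x \<noteq> 0" using insert(5) by blast
  obtain y where y: "y \<in> U" "(\<Prod>\<alpha>\<in>S. \<alpha> y) \<noteq> 0" using insert.IH insert(4,5) by blast
  have "(\<lambda>x. \<Prod>\<alpha>\<in>S. \<alpha> x) \<in> polys" using insert by (intro hom_polys_polys[OF hom_polys_prod]) auto
  moreover have "\<beta> \<in> polys" using insert by (intro dual_polys) auto
  ultimately have "(\<Prod>\<alpha>\<in>S. \<alpha> y) = 0" if "\<And>z. z \<in> U \<Longrightarrow> \<beta> z * (\<Prod>\<alpha>\<in>S. \<alpha> z) = 0"
    using polys_mult_eq_0_on_subspace[of \<beta> "\<lambda>x. \<Prod>\<alpha>\<in>S. \<alpha> x" U x y] U x y(1) that by blast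
  then show ?case using y(2) insert.hyps by auto
qed

text \<open>A functional vanishing on the kernel of \<beta> is a multiple of \<beta>, as projecting
  along the coroot shows. A reduced system contains only \<beta> and its negative as such multiples,
  and only one of them is positive.\<close>

lemma pos_root_nonzero_on_kernel:
  assumes "\<alpha> \<in> \<Phi>\<^sub>p" "\<beta> \<in> \<Phi>\<^sub>p" "\<alpha> \<noteq> \<beta>" shows "\<exists>x\<in>{x. \<beta> x = 0}. \<alpha> x \<noteq> 0"
proof (rule ccontr)
  assume zero: "\<not> ?thesis"
  define c where "c = \<alpha> (coroot D \<beta>) / 2"
  have dual: "\<alpha> \<in> dual D" "\<beta> \<in> dual D" using assms by (simp_all add: root_dual pos_root)
  have "\<alpha> x = c * \<beta> x" for x
  proof -
    let ?y = "x - scale D (\<beta> x / 2) (coroot D \<beta>)"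
    have "\<beta> ?y = 0" using assms(2) dual by (simp add: dual_diff dual_scale coroot_2 pos_root)
    then have "\<alpha> ?y = 0" using zero by simp
    then show ?thesis using dual by (simp add: dual_diff dual_scale c_def)
  qed
  then have eq: "\<alpha> = (\<lambda>x. c * \<beta> x)" by blast
  then have "c = 1 \<or> c = -1" using reduced_roots[of \<beta> c] assms pos_root by auto
  then show False using eq assms not_pos_neg by auto
qed

lemma subspace_kernel: "\<beta> \<in> dual D \<Longrightarrow> V.subspace {x. \<beta> x = 0}"
  by (auto simp: V.subspace_def dual_0 dual_add dual_scale)

text \<open>Each reflection is a word of odd length, so \<open>f\<close> changes sign under it and
  vanishes on its hyperplane. The positive roots can then be divided out one at a time.\<close>

lemma antisymmetric_divisible:
  assumes f: "f \<in> polys" and anti: "\<And>\<alpha> x. \<alpha> \<in> \<Delta> \<Longrightarrow> f (\<sigma> \<alpha> x) = - f x"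
  shows "\<exists>h\<in>polys. \<forall>x. f x = pos_prod x * h x"
proof -
  have zero: "f x = 0" if \<beta>: "\<beta> \<in> \<Phi>\<^sub>p" "\<beta> x = 0" for \<beta> x
  proof -
    obtain js where "set js \<subseteq> \<Delta>" "word D js = \<sigma> \<beta>" "odd (length js)"
      using refl_is_word[OF pos_root[OF \<beta>(1)]] by blast
    then have "f (\<sigma> \<beta> x) = - f x" using antisymmetric_word[of f js x] anti by simp
    then show ?thesis using \<beta>(2) by (simp add: reflection_def)
  qed
  have "\<exists>h\<in>polys. \<forall>x. f x = (\<Prod>\<gamma>\<in>S. \<gamma> x) * h x" if "finite S" "S \<subseteq> \<Phi>\<^sub>p" for S
    using that
  proof (induction S rule: finite_induct)
    case empty
    then show ?case using f by auto
  next
    case (insert \<beta> S)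
    then obtain h where h: "h \<in> polys" "\<And>x. f x = (\<Prod>\<gamma>\<in>S. \<gamma> x) * h x" by auto
    let ?U = "{x. \<beta> x = 0}"
    have \<beta>: "\<beta> \<in> \<Phi>\<^sub>p" "\<beta> \<in> dual D" using insert root_dual pos_root by auto
    have S: "\<alpha> \<in> dual D" "\<exists>x\<in>?U. \<alpha> x \<noteq> 0" if "\<alpha> \<in> S" for \<alpha>
      using that insert \<beta>(1) root_dual pos_root pos_root_nonzero_on_kernel[of \<alpha> \<beta>] by auto
    have U: "V.subspace ?U" using \<beta>(2) by (rule subspace_kernel)
    obtain y where y: "y \<in> ?U" "(\<Prod>\<gamma>\<in>S. \<gamma> y) \<noteq> 0"
      using prod_nonzero_on_subspace[OF U insert(1) S] by blast
    have S_polys: "(\<lambda>x. \<Prod>\<gamma>\<in>S. \<gamma> x) \<in> polys"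
      using insert(1) S(1) by (intro hom_polys_polys[OF hom_polys_prod])
    \<comment> \<open>On this hyperplane \<open>f\<close> is zero but the product of the roots
      already divided out is not identically zero, so the quotient must vanish there.\<close>
    have hU: "h x = 0" if "x \<in> ?U" for x
      using polys_mult_eq_0_on_subspace[OF S_polys h(1) U _ y that] zero[OF \<beta>(1)] h(2) by auto
    \<comment> \<open>Half the coroot, so that subtracting \<open>\<beta> x\<close> times it
      projects onto the kernel of \<beta>, where \<open>h\<close> is zero.\<close>
    let ?v = "scale D (1 / 2) (coroot D \<beta>)"
    obtain q where q: "q \<in> polys" "\<And>x. \<beta> x * q x = h x - h (x - scale D (\<beta> x) ?v)"
      using polys_transvection_quotient[OF h(1) \<beta>(2)] by blast
    have "h (x - scale D (\<beta> x) ?v) = 0" for x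
      using \<beta> coroot_2[OF pos_root[OF \<beta>(1)]] by (intro hU) (simp add: dual_diff dual_scale)
    then have "h x = \<beta> x * q x" for x using q(2) by simp
    then have "f x = (\<Prod>\<gamma>\<in>insert \<beta> S. \<gamma> x) * q x" for x
      using h(2)[of x] insert(1,2) by simp
    then show ?case using q(1) by blast
  qed
  then show ?thesis using finite_pos by (simp add: pos_prod_def)
qed

lemma pos_prod_not_ideal: "pos_prod \<notin> I\<^sub>W"
proof
  assume pos_prod: "pos_prod \<in> I\<^sub>W"
  \<comment> \<open>Antisymmetrization commutes with invariant factors but in general not with
    arbitrary ones. Letting the multiplier \<open>p\<close> range over all polynomials makes the
    claim stable under multiplication in the ideal.\<close>
  have "\<forall>p\<in>polys. \<exists>h\<in>polys. h 0 = 0 \<and> (\<forall>x. antisymmetrize (\<lambda>x. p x * f x) x = pos_prod x * h x)"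
    if "f \<in> I\<^sub>W" for f
    using that
  proof (induction rule: invariant_ideal_induct)
    case zero
    show ?case by (intro ballI bexI[of _ "\<lambda>x. 0"]) (auto simp: antisymmetrize_def polys_const)
  next
    case (gen g)
    show ?case
    proof
      fix p assume "p \<in> polys"
      then obtain h where h: "h \<in> polys" "\<And>x. antisymmetrize p x = pos_prod x * h x"
        using antisymmetric_divisible[OF antisymmetrize_polys antisymmetrize_refl] by blast
      have "antisymmetrize (\<lambda>x. p x * g x) x = pos_prod x * (g x * h x)" for x
      proof -
        have "antisymmetrize (\<lambda>x. p x * g x) x = g x * antisymmetrize p x"
          unfolding antisymmetrize_def sum_distrib_left
          by (intro sum.cong refl) (simp add: invariants_weyl[OF gen])
        then show ?thesis by (simp add: h(2))
      qed
      moreover have "(\<lambda>x. g x * h x) \<in> polys" using gen h(1) invariants_polys polys_mult by blast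
      moreover have "g 0 * h 0 = 0" using invariants_at_0[OF gen] by simp
      ultimately show "\<exists>h\<in>polys. h 0 = 0 \<and>
          (\<forall>x. antisymmetrize (\<lambda>x. p x * g x) x = pos_prod x * h x)"
        by (intro bexI[of _ "\<lambda>x. g x * h x"]) auto
    qed
  next
    case (add f g)
    show ?case
    proof
      fix p assume p: "p \<in> polys"
      obtain h where h: "h \<in> polys" "h 0 = 0"
        "\<And>x. antisymmetrize (\<lambda>x. p x * f x) x = pos_prod x * h x" using add(3) p by blast
      obtain k where k: "k \<in> polys" "k 0 = 0"
        "\<And>x. antisymmetrize (\<lambda>x. p x * g x) x = pos_prod x * k x" using add(4) p by blast
      have "antisymmetrize (\<lambda>x. p x * (f x + g x)) x = pos_prod x * (h x + k x)" for x
        using h(3)[of x] k(3)[of x]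
        by (simp add: antisymmetrize_def distrib_left sum.distrib)
      then show "\<exists>h\<in>polys. h 0 = 0 \<and>
          (\<forall>x. antisymmetrize (\<lambda>x. p x * (f x + g x)) x = pos_prod x * h x)"
        using h k by (intro bexI[of _ "\<lambda>x. h x + k x"]) (auto simp: polys_add)
    qed
  next
    case (mult q g)
    show ?case
    proof
      fix p assume "p \<in> polys"
      then have "(\<lambda>x. p x * q x) \<in> polys" using mult(1) polys_mult by blast
      then show "\<exists>h\<in>polys. h 0 = 0 \<and>
          (\<forall>x. antisymmetrize (\<lambda>x. p x * (q x * g x)) x = pos_prod x * h x)"
        using mult(3) by (simp add: mult.assoc[symmetric])
    qed
  qed
  from this[OF pos_prod] polys_const[of 1] obtain h where h: "h \<in> polys" "h 0 = 0"
    "\<And>x. antisymmetrize pos_prod x = pos_prod x * h x" by force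
  have "antisymmetrize pos_prod x = of_nat (card (weyl D)) * pos_prod x" for x
  proof -
    have "(-1) ^ len D w * pos_prod (w x) = pos_prod x" if w: "w \<in> weyl D" for w
    proof -
      obtain js where "set js \<subseteq> \<Delta>" "w = word D js" using weyl_cases[OF w] .
      then show ?thesis
        using antisymmetric_word[of pos_prod js x] pos_prod_refl minus_one_power_len_word[of js]
        by (simp flip: power_mult_distrib mult.assoc)
    qed
    then show ?thesis by (simp add: antisymmetrize_def)
  qed
  then have eq: "pos_prod x * h x = pos_prod x * of_nat (card (weyl D))" for x
    using h(3) by (simp add: mult.commute)
  obtain x where "pos_prod x \<noteq> 0"
  proof -
    have "\<exists>x\<in>UNIV. (\<Prod>\<alpha>\<in>\<Phi>\<^sub>p. \<alpha> x) \<noteq> 0"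
      using finite_pos root_dual pos_root root_ne_0
      by (intro prod_nonzero_on_subspace V.subspace_UNIV) auto
    then show ?thesis using that by (auto simp: pos_prod_def)
  qed
  \<comment> \<open>Cancelling the product of the positive roots leaves a nonzero constant, against
    \<open>h 0 = 0\<close>.\<close>
  then have "h = (\<lambda>x. of_nat (card (weyl D)))"
    using eq by (intro polys_cancel[OF hom_polys_polys[OF pos_prod_hom_polys] h(1) polys_const])
  then show False using h(2) card_weyl by simp
qed


subsection \<open>Schubert polynomials and duality\<close>

lemma top_poly_eq: "top_poly D = (\<lambda>x. (1 / of_nat (card (weyl D))) * pos_prod x)"
  by (auto simp: top_poly_def pos_prod_def)

lemma top_poly_hom_polys: "top_poly D \<in> hom_polys N"
  unfolding top_poly_eq using pos_prod_hom_polys by (rule hom_polys_smult)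

lemma top_poly_polys: "top_poly D \<in> polys"
  using top_poly_hom_polys by (rule hom_polys_polys)

text \<open>In fact the value is 1, but only non-vanishing is needed.\<close>

definition top_coef :: complex where
  "top_coef = coef w\<^sub>0 (top_poly D)"

text \<open>Only the longest element has length \<open>N\<close>, so every other functional vanishes
  on the top polynomial for degree reasons. If this one vanished as well, the polynomial would lie
  in the ideal.\<close>

lemma top_coef_nonzero: "top_coef \<noteq> 0"
proof
  assume top: "top_coef = 0"
  have "coef w (top_poly D) = 0" if "w \<in> weyl D" for w
    using that top coef_hom_polys[OF that top_poly_hom_polys] longest_unique[OF that]
    by (cases "len D w = N") (auto simp: top_coef_def)
  then have "top_poly D \<in> I\<^sub>W" by (rule ideal_if_coef[OF top_poly_polys])
  from ideal_smult[OF this, of "of_nat (card (weyl D))"] have "pos_prod \<in> I\<^sub>W"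
    using card_weyl by (simp add: top_poly_eq)
  then show False using pos_prod_not_ideal by blast
qed

definition schubert_poly :: "('h \<Rightarrow> 'h) \<Rightarrow> 'h \<Rightarrow> complex" where
  "schubert_poly w = demazure D (inv_into UNIV w \<circ> w\<^sub>0) (top_poly D)"

lemma len_inv_comp_longest: "w \<in> weyl D \<Longrightarrow> len D (inv_into UNIV w \<circ> w\<^sub>0) = N - len D w"
  using len_comp_maximal[OF longest len_longest weyl_inv] by (simp add: len_inv)

lemma inv_comp_longest_weyl: "w \<in> weyl D \<Longrightarrow> inv_into UNIV w \<circ> w\<^sub>0 \<in> weyl D"
  by (simp add: weyl_comp weyl_inv longest)

lemma schubert_poly_hom_polys: assumes "w \<in> weyl D" shows "schubert_poly w \<in> hom_polys (len D w)"
  using demazure_hom_polys[OF inv_comp_longest_weyl[OF assms] top_poly_hom_polys]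
    len_inv_comp_longest[OF assms] len_le_card_pos[OF assms]
  by (simp add: schubert_poly_def)

lemma schubert_poly_polys: "w \<in> weyl D \<Longrightarrow> schubert_poly w \<in> polys"
  using schubert_poly_hom_polys hom_polys_polys by blast

text \<open>The composite of the two operators acts on a polynomial of degree \<open>N\<close>, so a
  constant term survives only if the product of the two group elements is the longest element, that
  is for \<open>v = w\<close>; in that case the lengths do add up.\<close>

lemma coef_schubert_poly:
  assumes v: "v \<in> weyl D" and w: "w \<in> weyl D"
  shows "coef v (schubert_poly w) = (if v = w then top_coef else 0)"
proof -
  let ?u = "inv_into UNIV w \<circ> w\<^sub>0"
  have u: "?u \<in> weyl D" using w by (rule inv_comp_longest_weyl)
  have comp: "demazure D v (schubert_poly w) =
      (if len D (v \<circ> ?u) = len D v + len D ?u then demazure D (v \<circ> ?u) (top_poly D) else (\<lambda>x. 0))"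
    unfolding schubert_poly_def by (rule demazure_demazure[OF v u top_poly_polys])
  show ?thesis
  proof (cases "v = w")
    case True
    have "v \<circ> ?u = w\<^sub>0" using weyl_inv_comp(2)[OF w] by (simp add: True flip: comp_assoc)
    moreover have "N = len D v + len D ?u"
      using len_inv_comp_longest[OF w] len_le_card_pos[OF w] by (simp add: True)
    ultimately show ?thesis using comp True by (simp add: coef_def top_coef_def len_longest)
  next
    case False
    have "v \<circ> ?u \<noteq> w\<^sub>0"
    proof
      assume "v \<circ> ?u = w\<^sub>0"
      then have "v \<circ> inv_into UNIV w \<circ> w\<^sub>0 \<circ> inv_into UNIV w\<^sub>0 = w\<^sub>0 \<circ> inv_into UNIV w\<^sub>0"
        by (simp add: comp_assoc)
      then have "v \<circ> inv_into UNIV w = id"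
        using weyl_inv_comp(2)[OF longest] by (simp add: comp_assoc)
      then have "v \<circ> inv_into UNIV w \<circ> w = w" by simp
      then show False using False weyl_inv_comp(1)[OF w] by (simp add: comp_assoc)
    qed
    then have "N \<noteq> len D (v \<circ> ?u)" using longest_unique weyl_comp[OF v u] by metis
    then have "coef (v \<circ> ?u) (top_poly D) = 0"
      by (rule coef_hom_polys[OF weyl_comp[OF v u] top_poly_hom_polys])
    then show ?thesis using comp False by (simp add: coef_def)
  qed
qed

section \<open>Adjointness with respect to the top coordinate\<close>

lemma inv_longest: "inv_into UNIV w\<^sub>0 = w\<^sub>0"
  using longest_unique[OF weyl_inv[OF longest]] len_inv[OF longest] len_longest by simp

text \<open>Any simple reflection can be split off from the longest element on the right with
  lengths adding up.\<close>

lemma coef_longest_dem: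
  assumes \<alpha>: "\<alpha> \<in> \<Delta>" and f: "f \<in> polys"
  shows "coef w\<^sub>0 f = coef (w\<^sub>0 \<circ> \<sigma> \<alpha>) (dem \<alpha> f)"
proof -
  have w: "w\<^sub>0 \<circ> \<sigma> \<alpha> \<in> weyl D" using \<alpha> by (intro weyl_comp longest refl_weyl)
  have "len D (w\<^sub>0 \<circ> \<sigma> \<alpha>) = len D (\<sigma> \<alpha> \<circ> w\<^sub>0)"
    using len_inv[OF w] \<alpha> by (simp add: inv_weyl_comp longest refl_weyl inv_refl simple_root inv_longest)
  also have "\<dots> = N - 1"
    using len_comp_maximal[OF longest len_longest refl_weyl[OF \<alpha>]] by (simp add: len_refl \<alpha>)
  finally have len: "len D (w\<^sub>0 \<circ> \<sigma> \<alpha>) = N - 1" .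
  have "w\<^sub>0 \<circ> \<sigma> \<alpha> \<circ> \<sigma> \<alpha> = w\<^sub>0" using \<alpha> by (simp add: comp_assoc refl_o_refl simple_root)
  moreover have "0 < N" using finite_pos simple_pos[OF \<alpha>] card_gt_0_iff by blast
  ultimately have "demazure D (w\<^sub>0 \<circ> \<sigma> \<alpha>) (demazure D (\<sigma> \<alpha>) f) = demazure D w\<^sub>0 f"
    using demazure_demazure[OF w refl_weyl[OF \<alpha>] f] len by (simp add: len_longest len_refl \<alpha>)
  then show ?thesis by (simp add: coef_def demazure_refl \<alpha> f)
qed

text \<open>Both sides depend only on the product of \<open>dem \<alpha> f\<close> and
  \<open>dem \<alpha> g\<close>: such a result is invariant under the reflection and killed by a
  second application of \<open>dem \<alpha>\<close>, which leaves one term in the Leibniz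
  rule.\<close>

lemma coef_longest_dem_swap:
  assumes \<alpha>: "\<alpha> \<in> \<Delta>" and f: "f \<in> polys" and g: "g \<in> polys"
  shows "coef w\<^sub>0 (\<lambda>x. dem \<alpha> f x * g x) = coef w\<^sub>0 (\<lambda>x. f x * dem \<alpha> g x)"
proof -
  have root: "\<alpha> \<in> \<Phi>" using \<alpha> by (rule simple_root)
  have dem: "dem \<alpha> (\<lambda>x. dem \<alpha> f x * g x) = (\<lambda>x. dem \<alpha> f x * dem \<alpha> g x)"
    if "f \<in> polys" "g \<in> polys" for f g
    using dem_mult[OF dem_polys[OF that(1) root] that(2) root] that root by (simp add: dem_dem dem_refl)
  have "coef w\<^sub>0 (\<lambda>x. dem \<alpha> f x * g x) = coef (w\<^sub>0 \<circ> \<sigma> \<alpha>) (\<lambda>x. dem \<alpha> f x * dem \<alpha> g x)"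
    using coef_longest_dem[OF \<alpha> polys_mult[OF dem_polys[OF f root] g]] dem[OF f g] by simp
  also have "\<dots> = coef w\<^sub>0 (\<lambda>x. dem \<alpha> g x * f x)"
    using coef_longest_dem[OF \<alpha> polys_mult[OF dem_polys[OF g root] f]] dem[OF g f]
    by (simp add: mult.commute)
  finally show ?thesis by (simp add: mult.commute)
qed

lemma coef_longest_dems_swap:
  "set js \<subseteq> \<Delta> \<Longrightarrow> f \<in> polys \<Longrightarrow> g \<in> polys \<Longrightarrow>
    coef w\<^sub>0 (\<lambda>x. dems js f x * g x) = coef w\<^sub>0 (\<lambda>x. f x * dems (rev js) g x)"
proof (induction js arbitrary: g)
  case (Cons \<alpha> js)
  then have "coef w\<^sub>0 (\<lambda>x. dems (\<alpha> # js) f x * g x) = coef w\<^sub>0 (\<lambda>x. dems js f x * dem \<alpha> g x)"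
    using coef_longest_dem_swap[of \<alpha> "dems js f" g] by (simp add: dems_polys)
  also have "\<dots> = coef w\<^sub>0 (\<lambda>x. f x * dems (rev js) (dem \<alpha> g) x)"
    using Cons by (intro Cons.IH) (auto simp: dem_polys simple_root)
  finally show ?case by (simp add: dems_append)
qed simp

lemma coef_longest_demazure_swap:
  assumes w: "w \<in> weyl D" and f: "f \<in> polys" and g: "g \<in> polys"
  shows "coef w\<^sub>0 (\<lambda>x. demazure D w f x * g x) = coef w\<^sub>0 (\<lambda>x. f x * demazure D (inv_into UNIV w) g x)"
proof -
  obtain js where js: "set js \<subseteq> \<Delta>" "word D js = w" "length js = len D w" "demazure D w = dems js"
    using demazure_eq_dems[OF w] by blast
  have "dems (rev js) g = demazure D (inv_into UNIV w) g"
    using dems_eq_demazure[of "rev js" g] js g inv_word[OF js(1)] len_inv[OF w] by simp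
  then show ?thesis using coef_longest_dems_swap[OF js(1) f g] js(4) by simp
qed

lemma ideal_if_coef_longest:
  assumes f: "f \<in> polys" and zero: "\<And>g. g \<in> polys \<Longrightarrow> coef w\<^sub>0 (\<lambda>x. f x * g x) = 0"
  shows "f \<in> I\<^sub>W"
proof (rule ideal_if_coef[OF f])
  fix w assume w: "w \<in> weyl D"
  \<comment> \<open>The test polynomial is the Schubert polynomial of
    \<open>w\<^sub>0 \<circ> w\<close>. After the operator is moved to \<open>f\<close>, only the
    constant term of \<open>demazure D w f\<close> survives against the factor of degree
    \<open>N\<close>.\<close>
  have "0 = coef w\<^sub>0 (\<lambda>x. f x * demazure D (inv_into UNIV w) (top_poly D) x)"
    using w by (intro zero[symmetric] demazure_polys weyl_inv top_poly_polys)
  also have "\<dots> = coef w\<^sub>0 (\<lambda>x. demazure D w f x * top_poly D x)"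
    using coef_longest_demazure_swap[OF w f top_poly_polys] by simp
  also have "\<dots> = coef w f * top_coef"
    using coef_mult_hom_polys[OF longest demazure_polys[OF w f] top_poly_hom_polys]
    by (simp add: len_longest coef_def[of w] top_coef_def)
  finally show "coef w f = 0" using top_coef_nonzero by simp
qed


subsection \<open>The coinvariant algebra in coordinates\<close>

abbreviation "C \<equiv> coinvariant_algebra D"
abbreviation "cls \<equiv> coinv_class D"

lemma mem_cls_iff: "f \<in> cls g \<longleftrightarrow> (\<exists>h\<in>I\<^sub>W. f = (\<lambda>x. h x + g x))"
  by (auto simp: coinv_class_def a_r_coset_def')

lemma cls_eq_iff:
  assumes "f \<in> polys" "g \<in> polys" shows "cls f = cls g \<longleftrightarrow> (\<lambda>x. f x - g x) \<in> I\<^sub>W"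
proof
  assume "cls f = cls g"
  moreover have "f \<in> cls f"
    unfolding mem_cls_iff using ideal_zero by (intro bexI[of _ "\<lambda>x. 0"]) auto
  ultimately have "f \<in> cls g" by simp
  then obtain h where "h \<in> I\<^sub>W" "f = (\<lambda>x. h x + g x)" by (auto simp: mem_cls_iff)
  then show "(\<lambda>x. f x - g x) \<in> I\<^sub>W" by simp
next
  assume fg: "(\<lambda>x. f x - g x) \<in> I\<^sub>W"
  show "cls f = cls g"
  proof (intro equalityI subsetI)
    fix u assume "u \<in> cls f"
    then obtain h where "h \<in> I\<^sub>W" "u = (\<lambda>x. h x + f x)" by (auto simp: mem_cls_iff)
    then show "u \<in> cls g" using ideal_add[OF _ fg, of h]
      by (auto simp: mem_cls_iff intro!: bexI[of _ "\<lambda>x. h x + (f x - g x)"])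
  next
    fix u assume "u \<in> cls g"
    then obtain h where "h \<in> I\<^sub>W" "u = (\<lambda>x. h x + g x)" by (auto simp: mem_cls_iff)
    then show "u \<in> cls f" using ideal_diff[OF _ fg, of h]
      by (auto simp: mem_cls_iff intro!: bexI[of _ "\<lambda>x. h x - (f x - g x)"])
  qed
qed

lemma cls_hom: "coinv_class D \<in> ring_hom R (R Quot I\<^sub>W)"
  using ideal.rcos_ring_hom[OF ideal_invariant_ideal] by (simp add: coinv_class_def[abs_def])

lemma coinvariant_algebra_sel:
  "carrier C = carrier (R Quot I\<^sub>W)" "x \<otimes>\<^bsub>C\<^esub> y = x \<otimes>\<^bsub>R Quot I\<^sub>W\<^esub> y" "x \<oplus>\<^bsub>C\<^esub> y = x \<oplus>\<^bsub>R Quot I\<^sub>W\<^esub> y"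
  "\<one>\<^bsub>C\<^esub> = \<one>\<^bsub>R Quot I\<^sub>W\<^esub>" "\<zero>\<^bsub>C\<^esub> = \<zero>\<^bsub>R Quot I\<^sub>W\<^esub>" "k \<odot>\<^bsub>C\<^esub> x = cls (\<lambda>x. k) \<otimes>\<^bsub>R Quot I\<^sub>W\<^esub> x"
  by (simp_all add: coinvariant_algebra_def ring.defs)

lemma carrier_coinv: "carrier C = cls ` polys"
  by (auto simp: coinvariant_algebra_sel FactRing_def A_RCOSETS_def' coinv_class_def)

lemma coinv_cases:
  assumes "x \<in> carrier C" obtains f where "f \<in> polys" "x = cls f"
  using assms carrier_coinv by blast

lemma cls_closed [simp]: "f \<in> polys \<Longrightarrow> cls f \<in> carrier C"
  by (simp add: carrier_coinv)

lemma cls_add: "f \<in> polys \<Longrightarrow> g \<in> polys \<Longrightarrow> cls f \<oplus>\<^bsub>C\<^esub> cls g = cls (\<lambda>x. f x + g x)"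
  using ring_hom_add[OF cls_hom, of f g] by (simp add: coinvariant_algebra_sel)

lemma cls_mult: "f \<in> polys \<Longrightarrow> g \<in> polys \<Longrightarrow> cls f \<otimes>\<^bsub>C\<^esub> cls g = cls (\<lambda>x. f x * g x)"
  using ring_hom_mult[OF cls_hom, of f g] by (simp add: coinvariant_algebra_sel)

lemma cls_one: "\<one>\<^bsub>C\<^esub> = cls (\<lambda>x. 1)"
  using ring_hom_one[OF cls_hom] by (simp add: coinvariant_algebra_sel)

lemma cls_zero: "\<zero>\<^bsub>C\<^esub> = cls (\<lambda>x. 0)"
  using ring_hom_zero[OF cls_hom ring_sym_algebra ideal.quotient_is_ring[OF ideal_invariant_ideal]]
  by (simp add: coinvariant_algebra_sel)

lemma cls_smult: "f \<in> polys \<Longrightarrow> k \<odot>\<^bsub>C\<^esub> cls f = cls (\<lambda>x. k * f x)"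
  using cls_mult[OF polys_const, of f k] by (simp add: coinvariant_algebra_sel)

lemma cring_coinv: "cring C"
proof (rule cringI)
  show "abelian_group C"
  proof (rule abelian_groupI)
    fix x assume "x \<in> carrier C"
    then obtain f where f: "f \<in> polys" "x = cls f" by (rule coinv_cases)
    then have "cls (\<lambda>x. -1 * f x) \<oplus>\<^bsub>C\<^esub> x = \<zero>\<^bsub>C\<^esub>"
      by (simp add: cls_add cls_zero polys_smult[of f "-1", simplified])
    then show "\<exists>y\<in>carrier C. y \<oplus>\<^bsub>C\<^esub> x = \<zero>\<^bsub>C\<^esub>" using f polys_smult by (meson cls_closed)
  qed (auto elim!: coinv_cases simp: cls_add cls_zero polys_add polys_const algebra_simps)
  show "comm_monoid C"
    by (rule comm_monoidI)
      (auto elim!: coinv_cases simp: cls_mult cls_one polys_mult polys_const algebra_simps)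
qed (auto elim!: coinv_cases simp: cls_mult cls_add polys_mult polys_add algebra_simps)

lemma smult_closed: "x \<in> carrier C \<Longrightarrow> k \<odot>\<^bsub>C\<^esub> x \<in> carrier C"
  by (auto elim!: coinv_cases simp: cls_smult polys_smult)

lemma cring_complex_ring: "cring complex_ring"
proof (rule cringI)
  show "abelian_group complex_ring"
    by (rule abelian_groupI) (auto simp: complex_ring_def intro!: exI[of _ "- _"])
  show "comm_monoid complex_ring"
    by (rule comm_monoidI) (auto simp: complex_ring_def)
qed (auto simp: complex_ring_def algebra_simps)

lemma module_coinv: "module complex_ring C"
proof (rule moduleI[OF cring_complex_ring])
  show "abelian_group C" using cring_coinv by (simp add: cring_def ring_def)
qed (auto elim!: coinv_cases simp: complex_ring_def cls_smult cls_add polys_smult polys_add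
    algebra_simps)

lemma complex_algebra_coinv: "complex_algebra C"
  unfolding complex_algebra_def
proof (intro conjI allI ballI)
  fix k x y assume "x \<in> carrier C" "y \<in> carrier C"
  then obtain f g where "f \<in> polys" "x = cls f" "g \<in> polys" "y = cls g" by (elim coinv_cases)
  then show "(k \<odot>\<^bsub>C\<^esub> x) \<otimes>\<^bsub>C\<^esub> y = k \<odot>\<^bsub>C\<^esub> (x \<otimes>\<^bsub>C\<^esub> y)" "x \<otimes>\<^bsub>C\<^esub> (k \<odot>\<^bsub>C\<^esub> y) = k \<odot>\<^bsub>C\<^esub> (x \<otimes>\<^bsub>C\<^esub> y)"
    by (simp_all add: cls_smult cls_mult polys_smult polys_mult mult.assoc mult.left_commute)
qed (use module_coinv cring.axioms(1)[OF cring_coinv] in auto)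

text \<open>The choice of a representative is harmless because \<open>coef w\<close> vanishes on the
  ideal.\<close>

definition coord :: "('h \<Rightarrow> 'h) \<Rightarrow> ('h \<Rightarrow> complex) set \<Rightarrow> complex" where
  "coord w x = coef w (SOME f. f \<in> polys \<and> cls f = x)"

lemma coord_cls: assumes "w \<in> weyl D" "f \<in> polys" shows "coord w (cls f) = coef w f"
proof -
  define g where "g = (SOME g. g \<in> polys \<and> cls g = cls f)"
  have "\<exists>g. g \<in> polys \<and> cls g = cls f" using assms(2) by blast
  from someI_ex[OF this] have g: "g \<in> polys \<and> cls g = cls f" unfolding g_def .
  then have "(\<lambda>x. g x - f x) \<in> I\<^sub>W" using cls_eq_iff assms(2) by blast
  then have "coef w (\<lambda>x. g x - f x) = 0" using assms(1) by (rule coef_ideal)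
  then have "coef w g = coef w f"
    using coef_add[OF assms(1) polys_diff[of g f] assms(2)] g assms(2) by simp
  then show ?thesis by (simp add: coord_def g_def)
qed

lemma coord_add:
  "w \<in> weyl D \<Longrightarrow> x \<in> carrier C \<Longrightarrow> y \<in> carrier C \<Longrightarrow> coord w (x \<oplus>\<^bsub>C\<^esub> y) = coord w x + coord w y"
  by (auto elim!: coinv_cases simp: cls_add coord_cls coef_add polys_add)

lemma coord_smult: "w \<in> weyl D \<Longrightarrow> x \<in> carrier C \<Longrightarrow> coord w (k \<odot>\<^bsub>C\<^esub> x) = k * coord w x"
  by (auto elim!: coinv_cases simp: cls_smult coord_cls coef_smult polys_smult)

lemma coord_zero: "w \<in> weyl D \<Longrightarrow> coord w \<zero>\<^bsub>C\<^esub> = 0"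
  by (simp add: cls_zero coord_cls polys_const coef_zero)

lemma coord_eqI:
  assumes "x \<in> carrier C" "y \<in> carrier C" "\<And>w. w \<in> weyl D \<Longrightarrow> coord w x = coord w y"
  shows "x = y"
proof -
  obtain f g where f: "f \<in> polys" "x = cls f" and g: "g \<in> polys" "y = cls g"
    using assms(1,2) by (elim coinv_cases)
  have "(\<lambda>x. f x - g x) \<in> I\<^sub>W"
  proof (rule ideal_if_coef[OF polys_diff[OF f(1) g(1)]])
    fix w assume w: "w \<in> weyl D"
    have "coef w f = coef w g" using assms(3)[OF w] f g w by (simp add: coord_cls)
    then show "coef w (\<lambda>x. f x - g x) = 0"
      using coef_add[OF w polys_diff[OF f(1) g(1)] g(1)] by simp
  qed
  then show ?thesis using cls_eq_iff f g by blast
qed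

sublocale coinv: cring C
  by (rule cring_coinv)

lemma coord_minus:
  assumes "w \<in> weyl D" "x \<in> carrier C" "y \<in> carrier C"
  shows "coord w (x \<ominus>\<^bsub>C\<^esub> y) = coord w x - coord w y"
proof -
  have "coord w (\<ominus>\<^bsub>C\<^esub> y) + coord w y = 0"
    using coord_add[of w "\<ominus>\<^bsub>C\<^esub> y" y] assms by (simp add: coinv.l_neg coord_zero)
  then have "coord w (\<ominus>\<^bsub>C\<^esub> y) = - coord w y" by (simp add: eq_neg_iff_add_eq_0)
  then show ?thesis using assms by (simp add: coinv.minus_eq coord_add)
qed

lemma coord_finsum:
  assumes "w \<in> weyl D" "finite A" "g \<in> A \<rightarrow> carrier C"
  shows "coord w (\<Oplus>\<^bsub>C\<^esub>i\<in>A. g i) = (\<Sum>i\<in>A. coord w (g i))"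
  using assms(2,3)
  by (induction A rule: finite_induct)
    (auto simp: coord_zero assms(1) coord_add coinv.finsum_closed Pi_iff)

text \<open>Operators preserve the ideal, so all members of the coset of the top polynomial yield
  one class and \<open>the_elem\<close> is applied to a singleton.\<close>

lemma schubert_eq: assumes w: "w \<in> weyl D" shows "schubert D w = cls (schubert_poly w)"
proof -
  let ?u = "inv_into UNIV w \<circ> w\<^sub>0"
  have u: "?u \<in> weyl D" using w by (rule inv_comp_longest_weyl)
  have "cls (demazure D ?u f) = cls (schubert_poly w)" if f: "f \<in> cls (top_poly D)" for f
  proof -
    obtain h where h: "h \<in> I\<^sub>W" "f = (\<lambda>x. h x + top_poly D x)" using f by (auto simp: mem_cls_iff)
    then have "demazure D ?u f = (\<lambda>x. demazure D ?u h x + schubert_poly w x)"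
      by (simp add: demazure_add[OF u] ideal_polys top_poly_polys schubert_poly_def)
    moreover from this have "demazure D ?u f \<in> polys"
      using demazure_polys[OF u ideal_polys[OF h(1)]] schubert_poly_polys[OF w] polys_add by simp
    ultimately show ?thesis
      using demazure_ideal[OF h(1) u] schubert_poly_polys[OF w] by (simp add: cls_eq_iff)
  qed
  moreover have "top_poly D \<in> cls (top_poly D)"
    unfolding mem_cls_iff using ideal_zero by (intro bexI[of _ "\<lambda>x. 0"]) auto
  ultimately have "(\<lambda>f. cls (demazure D ?u f)) ` cls (top_poly D) = {cls (schubert_poly w)}" by auto
  then show ?thesis by (simp add: schubert_def demazure_coinv_def)
qed

lemma schubert_closed [simp]: "w \<in> weyl D \<Longrightarrow> schubert D w \<in> carrier C"
  by (simp add: schubert_eq schubert_poly_polys)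

lemma coord_schubert:
  "v \<in> weyl D \<Longrightarrow> w \<in> weyl D \<Longrightarrow> coord v (schubert D w) = (if v = w then top_coef else 0)"
  by (simp add: schubert_eq coord_cls schubert_poly_polys coef_schubert_poly)

lemma schubert_inj: "inj_on (schubert D) (weyl D)"
  using coord_schubert top_coef_nonzero by (metis inj_onI)

text \<open>The division compensates for the coordinate \<open>top_coef\<close> of a Schubert class
  at its own index, so that the \<open>a w\<close> become the coordinates.\<close>

definition lin_comb :: "(('h \<Rightarrow> 'h) \<Rightarrow> complex) \<Rightarrow> ('h \<Rightarrow> complex) set" where
  "lin_comb a = (\<Oplus>\<^bsub>C\<^esub>w\<in>weyl D. (a w / top_coef) \<odot>\<^bsub>C\<^esub> schubert D w)"

lemma lin_comb_closed: "lin_comb a \<in> carrier C"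
  unfolding lin_comb_def by (intro coinv.finsum_closed) (auto simp: smult_closed)

lemma coord_lin_comb: assumes "v \<in> weyl D" shows "coord v (lin_comb a) = a v"
proof -
  have "coord v (lin_comb a) = (\<Sum>w\<in>weyl D. a w / top_coef * (if v = w then top_coef else 0))"
    unfolding lin_comb_def
    using assms finite_weyl
    by (subst coord_finsum) (auto simp: smult_closed coord_smult coord_schubert intro!: sum.cong)
  also have "\<dots> = (\<Sum>w\<in>weyl D. if v = w then a v else 0)"
    using top_coef_nonzero by (intro sum.cong) auto
  finally show ?thesis using assms finite_weyl by simp
qed

lemma coinv_expand: "x \<in> carrier C \<Longrightarrow> x = lin_comb (\<lambda>w. coord w x)"
  by (rule coord_eqI) (auto simp: lin_comb_closed coord_lin_comb)

section \<open>The grading in coordinates\<close>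

abbreviation "gr \<equiv> coinvariant_grading D"

text \<open>A vanishing condition on coordinates turns most of the grading axioms into linear
  algebra. Odd and negative degrees are included: no length matches them, so all coordinates must
  vanish.\<close>

lemma grading_eq: "gr d = {x \<in> carrier C. \<forall>w\<in>weyl D. 2 * int (len D w) \<noteq> d \<longrightarrow> coord w x = 0}"
proof (intro equalityI subsetI)
  fix x assume x: "x \<in> gr d"
  show "x \<in> {x \<in> carrier C. \<forall>w\<in>weyl D. 2 * int (len D w) \<noteq> d \<longrightarrow> coord w x = 0}"
  proof (cases "0 \<le> d \<and> even d")
    case True
    then obtain f where f: "f \<in> hom_polys (nat (d div 2))" "x = cls f"
      using x by (auto simp: coinvariant_grading_def)
    have "coord w x = 0" if "w \<in> weyl D" "2 * int (len D w) \<noteq> d" for w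
    proof -
      have "nat (d div 2) \<noteq> len D w" using that(2) True by auto
      then show ?thesis
        using coef_hom_polys[OF that(1) f(1)] f hom_polys_polys that(1) by (auto simp: coord_cls)
    qed
    then show ?thesis using f hom_polys_polys by auto
  next
    case False
    then show ?thesis using x by (auto simp: coinvariant_grading_def coord_zero)
  qed
next
  fix x assume "x \<in> {x \<in> carrier C. \<forall>w\<in>weyl D. 2 * int (len D w) \<noteq> d \<longrightarrow> coord w x = 0}"
  then have x: "x \<in> carrier C" and zero: "\<And>w. w \<in> weyl D \<Longrightarrow> 2 * int (len D w) \<noteq> d \<Longrightarrow> coord w x = 0"
    by auto
  show "x \<in> gr d"
  proof (cases "0 \<le> d \<and> even d")
    case True
    define a where "a w = coord w x / top_coef" for w
    let ?A = "{w \<in> weyl D. 2 * int (len D w) = d}"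
    \<comment> \<open>A homogeneous representative: the expansion in Schubert polynomials,
      restricted to the indices whose coordinates may be nonzero.\<close>
    define f where "f x = (\<Sum>w\<in>?A. a w * schubert_poly w x)" for x
    have f: "f \<in> hom_polys (nat (d div 2))"
      unfolding f_def using schubert_poly_hom_polys by (intro hom_polys_sum hom_polys_smult) fastforce
    have "x = cls f"
    proof (rule coord_eqI[OF x cls_closed[OF hom_polys_polys[OF f]]])
      fix v assume v: "v \<in> weyl D"
      have "coord v (cls f) = (\<Sum>w\<in>?A. a w * (if v = w then top_coef else 0))"
        using v unfolding coord_cls[OF v hom_polys_polys[OF f]] unfolding f_def
        by (subst coef_sum)
          (auto simp: coef_smult schubert_poly_polys polys_smult coef_schubert_poly intro!: sum.cong)
      also have "\<dots> = (\<Sum>w\<in>?A. if v = w then coord v x else 0)"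
        using top_coef_nonzero by (intro sum.cong) (auto simp: a_def)
      also have "\<dots> = coord v x" using finite_weyl v zero[OF v] by simp
      finally show "coord v x = coord v (cls f)" by simp
    qed
    then show ?thesis using f True by (simp add: coinvariant_grading_def)
  next
    case False
    have "2 * int (len D w) \<noteq> d" for w using False by auto
    then have "coord w x = 0" if "w \<in> weyl D" for w using zero[OF that] by blast
    then have "x = \<zero>\<^bsub>C\<^esub>" using x by (intro coord_eqI) (auto simp: coord_zero)
    then show ?thesis using False by (auto simp: coinvariant_grading_def)
  qed
qed

lemma submodule_grading: "submodule (gr d) complex_ring C"
proof (rule module.submoduleI[OF module_coinv])
  fix x assume "x \<in> gr d"
  moreover have "\<ominus>\<^bsub>C\<^esub> x = \<zero>\<^bsub>C\<^esub> \<ominus>\<^bsub>C\<^esub> x" if "x \<in> carrier C" using that by (simp add: coinv.minus_eq)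
  ultimately show "\<ominus>\<^bsub>C\<^esub> x \<in> gr d" by (auto simp: grading_eq coord_minus coord_zero)
qed (auto simp: grading_eq coord_zero coord_add coord_smult smult_closed)

lemma grading_mult: assumes x: "x \<in> gr i" and y: "y \<in> gr j" shows "x \<otimes>\<^bsub>C\<^esub> y \<in> gr (i + j)"
proof (cases "(0 \<le> i \<and> even i) \<and> (0 \<le> j \<and> even j)")
  case True
  then obtain f g where f: "f \<in> hom_polys (nat (i div 2))" "x = cls f"
    and g: "g \<in> hom_polys (nat (j div 2))" "y = cls g"
    using x y by (auto simp: coinvariant_grading_def)
  have "nat (i div 2) + nat (j div 2) = nat ((i + j) div 2)" using True by (auto elim!: evenE)
  then have "(\<lambda>x. f x * g x) \<in> hom_polys (nat ((i + j) div 2))"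
    using hom_polys_mult[OF f(1) g(1)] by simp
  then show ?thesis
    using True f g hom_polys_polys by (auto simp: coinvariant_grading_def cls_mult)
next
  case False
  then have "x = \<zero>\<^bsub>C\<^esub> \<or> y = \<zero>\<^bsub>C\<^esub>" using x y by (auto simp: coinvariant_grading_def split: if_splits)
  moreover have "x \<in> carrier C" "y \<in> carrier C" using x y by (auto simp: grading_eq)
  ultimately have "x \<otimes>\<^bsub>C\<^esub> y = \<zero>\<^bsub>C\<^esub>" by auto
  then show ?thesis by (simp add: grading_eq coord_zero)
qed

lemma coord_homogeneous_sum:
  assumes f: "\<And>d. f d \<in> gr d" and fin: "finite {d. f d \<noteq> \<zero>\<^bsub>C\<^esub>}" and w: "w \<in> weyl D"
  shows "coord w (\<Oplus>\<^bsub>C\<^esub>d\<in>{d. f d \<noteq> \<zero>\<^bsub>C\<^esub>}. f d) = coord w (f (2 * int (len D w)))"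
proof -
  let ?d = "2 * int (len D w)"
  have "coord w (\<Oplus>\<^bsub>C\<^esub>d\<in>{d. f d \<noteq> \<zero>\<^bsub>C\<^esub>}. f d) = (\<Sum>d\<in>{d. f d \<noteq> \<zero>\<^bsub>C\<^esub>}. coord w (f d))"
    using f by (intro coord_finsum w fin) (auto simp: grading_eq)
  also have "\<dots> = (\<Sum>d\<in>{d. f d \<noteq> \<zero>\<^bsub>C\<^esub>}. if d = ?d then coord w (f ?d) else 0)"
    using f w by (intro sum.cong refl) (auto simp: grading_eq)
  \<comment> \<open>If \<open>?d\<close> is not among the indices, then \<open>f ?d\<close> is zero
    and both sides vanish.\<close>
  also have "\<dots> = coord w (f ?d)" using fin coord_zero[OF w] by auto
  finally show ?thesis .
qed

lemma homogeneous_decomposition: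
  assumes x: "x \<in> carrier C"
  shows "\<exists>!f. (\<forall>d. f d \<in> gr d) \<and> finite {d. f d \<noteq> \<zero>\<^bsub>C\<^esub>} \<and> x = (\<Oplus>\<^bsub>C\<^esub>d\<in>{d. f d \<noteq> \<zero>\<^bsub>C\<^esub>}. f d)"
proof (rule ex_ex1I)
  define f where "f d = lin_comb (\<lambda>w. if 2 * int (len D w) = d then coord w x else 0)" for d :: int
  have coord_f: "coord w (f d) = (if 2 * int (len D w) = d then coord w x else 0)"
    if "w \<in> weyl D" for w d using that by (simp add: f_def coord_lin_comb)
  have f: "f d \<in> gr d" for d using coord_f by (auto simp: grading_eq f_def lin_comb_closed)
  have "f d = \<zero>\<^bsub>C\<^esub>" if "d \<notin> (\<lambda>w. 2 * int (len D w)) ` weyl D" for d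
    by (rule coord_eqI) (use that coord_f in \<open>auto simp: f_def lin_comb_closed coord_zero\<close>)
  then have "{d. f d \<noteq> \<zero>\<^bsub>C\<^esub>} \<subseteq> (\<lambda>w. 2 * int (len D w)) ` weyl D" by blast
  then have fin: "finite {d. f d \<noteq> \<zero>\<^bsub>C\<^esub>}"
    by (rule finite_subset) (use finite_weyl in simp)
  have "x = (\<Oplus>\<^bsub>C\<^esub>d\<in>{d. f d \<noteq> \<zero>\<^bsub>C\<^esub>}. f d)"
    using x f fin
    by (intro coord_eqI coinv.finsum_closed) (auto simp: coord_homogeneous_sum coord_f grading_eq)
  then show "\<exists>f. (\<forall>d. f d \<in> gr d) \<and> finite {d. f d \<noteq> \<zero>\<^bsub>C\<^esub>} \<and>
      x = (\<Oplus>\<^bsub>C\<^esub>d\<in>{d. f d \<noteq> \<zero>\<^bsub>C\<^esub>}. f d)" using f fin by blast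
next
  fix f g :: "int \<Rightarrow> ('h \<Rightarrow> complex) set"
  assume f: "(\<forall>d. f d \<in> gr d) \<and> finite {d. f d \<noteq> \<zero>\<^bsub>C\<^esub>} \<and> x = (\<Oplus>\<^bsub>C\<^esub>d\<in>{d. f d \<noteq> \<zero>\<^bsub>C\<^esub>}. f d)"
    and g: "(\<forall>d. g d \<in> gr d) \<and> finite {d. g d \<noteq> \<zero>\<^bsub>C\<^esub>} \<and> x = (\<Oplus>\<^bsub>C\<^esub>d\<in>{d. g d \<noteq> \<zero>\<^bsub>C\<^esub>}. g d)"
  show "f = g"
  proof
    fix d
    show "f d = g d"
    proof (rule coord_eqI)
      show "f d \<in> carrier C" "g d \<in> carrier C" using f g by (auto simp: grading_eq)
      fix w assume w: "w \<in> weyl D"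
      have "coord w (f (2 * int (len D w))) = coord w (g (2 * int (len D w)))"
        using coord_homogeneous_sum[of f w] coord_homogeneous_sum[of g w] f g w by auto
      then show "coord w (f d) = coord w (g d)"
        using f g w by (cases "2 * int (len D w) = d") (auto simp: grading_eq)
    qed
  qed
qed

lemma graded_algebra_coinv: "graded_algebra C gr"
  unfolding graded_algebra_def
  by (intro conjI allI ballI complex_algebra_coinv submodule_grading homogeneous_decomposition grading_mult)


subsection \<open>The cellular structure\<close>

lemma lin_basis_schubert:
  "lin_basis C {(p, s, t). p \<in> weyl D \<and> s \<in> {p} \<and> t \<in> {p}} (\<lambda>(p, s, t). schubert D p)"
proof -
  let ?J = "{(p, s, t). p \<in> weyl D \<and> s \<in> {p} \<and> t \<in> {p}}"
  let ?b = "\<lambda>(p, s, t). schubert D p"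
  have J: "?J = (\<lambda>w. (w, w, w)) ` weyl D" by auto
  have fin: "finite ?J" unfolding J using finite_weyl by simp
  have coord: "coord v (\<Oplus>\<^bsub>C\<^esub>i\<in>?J. k i \<odot>\<^bsub>C\<^esub> ?b i) = k (v, v, v) * top_coef" if v: "v \<in> weyl D" for v k
  proof -
    have "coord v (\<Oplus>\<^bsub>C\<^esub>i\<in>?J. k i \<odot>\<^bsub>C\<^esub> ?b i) = (\<Sum>i\<in>?J. coord v (k i \<odot>\<^bsub>C\<^esub> ?b i))"
      using fin by (intro coord_finsum v) (auto simp: smult_closed)
    also have "\<dots> = (\<Sum>w\<in>weyl D. coord v (k (w, w, w) \<odot>\<^bsub>C\<^esub> schubert D w))"
      unfolding J by (subst sum.reindex) (auto simp: inj_on_def)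
    also have "\<dots> = (\<Sum>w\<in>weyl D. if v = w then k (v, v, v) * top_coef else 0)"
      using v by (intro sum.cong) (auto simp: coord_smult coord_schubert)
    finally show ?thesis using v finite_weyl by simp
  qed
  show ?thesis
    unfolding lin_basis_def
  proof (intro conjI ballI fin)
    show "?b \<in> ?J \<rightarrow> carrier C" by auto
    fix x assume x: "x \<in> carrier C"
    have closed: "(\<Oplus>\<^bsub>C\<^esub>i\<in>?J. k i \<odot>\<^bsub>C\<^esub> ?b i) \<in> carrier C" for k
      by (intro coinv.finsum_closed) (auto simp: smult_closed)
    show "\<exists>!k. k \<in> extensional ?J \<and> x = (\<Oplus>\<^bsub>C\<^esub>i\<in>?J. k i \<odot>\<^bsub>C\<^esub> ?b i)"
    proof (rule ex_ex1I)
      let ?k = "\<lambda>i\<in>?J. coord (fst i) x / top_coef"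
      have "x = (\<Oplus>\<^bsub>C\<^esub>i\<in>?J. ?k i \<odot>\<^bsub>C\<^esub> ?b i)"
        by (rule coord_eqI[OF x closed]) (subst coord, use top_coef_nonzero in auto)
      then show "\<exists>k. k \<in> extensional ?J \<and> x = (\<Oplus>\<^bsub>C\<^esub>i\<in>?J. k i \<odot>\<^bsub>C\<^esub> ?b i)"
        using restrict_extensional by blast
    next
      fix k l
      assume k: "k \<in> extensional ?J \<and> x = (\<Oplus>\<^bsub>C\<^esub>i\<in>?J. k i \<odot>\<^bsub>C\<^esub> ?b i)"
        and l: "l \<in> extensional ?J \<and> x = (\<Oplus>\<^bsub>C\<^esub>i\<in>?J. l i \<odot>\<^bsub>C\<^esub> ?b i)"
      have "k (v, v, v) = l (v, v, v)" if "v \<in> weyl D" for v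
        using coord[OF that, of k] coord[OF that, of l] k l top_coef_nonzero by simp
      then show "k = l" using k l by (intro extensionalityI[of k ?J l]) auto
    qed
  qed
qed

text \<open>The coordinate at \<open>id\<close> is the constant term of a representative. Up to the
  length of \<open>w\<close>, multiplication acts on the Schubert class through this scalar; the
  rest has higher degree.\<close>

lemma coord_mult_schubert:
  assumes v: "v \<in> weyl D" and w: "w \<in> weyl D" and le: "len D v \<le> len D w" and x: "x \<in> carrier C"
  shows "coord v (x \<otimes>\<^bsub>C\<^esub> schubert D w) = coord id x * coord v (schubert D w)"
proof -
  obtain f where f: "f \<in> polys" "x = cls f" using x by (rule coinv_cases)
  have "demazure D id f = f" using dems_eq_demazure[of "[]" f] f(1) by (simp add: len_id)
  then have "coord id x = f 0" unfolding f(2) coord_cls[OF id_weyl f(1)] by (simp only: coef_def)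
  moreover have "coord v (x \<otimes>\<^bsub>C\<^esub> schubert D w) = coef v (\<lambda>x. f x * schubert_poly w x)"
    using f v w by (simp add: schubert_eq schubert_poly_polys cls_mult coord_cls polys_mult)
  moreover have "\<dots> = f 0 * coef v (schubert_poly w)"
    using v f(1) schubert_poly_hom_polys[OF w] le by (rule coef_mult_hom_polys)
  ultimately show ?thesis using v w by (simp add: schubert_eq coord_cls schubert_poly_polys)
qed

lemma mem_span_schubert:
  assumes x: "x \<in> carrier C" and A: "A \<subseteq> weyl D"
    and zero: "\<And>w. w \<in> weyl D \<Longrightarrow> w \<notin> A \<Longrightarrow> coord w x = 0"
  shows "x \<in> lin_span C (schubert D ` A)"
proof -
  have fin: "finite A" using A finite_weyl by (rule finite_subset)
  have inj: "inj_on (schubert D) A" using schubert_inj A by (rule inj_on_subset)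
  \<comment> \<open>\<open>lin_span\<close> takes coefficients indexed by vectors, so the
    coordinates are transported along the injective map \<open>schubert D\<close>.\<close>
  define k where "k z = coord (inv_into A (schubert D) z) x / top_coef" for z
  have closed: "(\<lambda>z. k z \<odot>\<^bsub>C\<^esub> z) \<in> schubert D ` A \<rightarrow> carrier C"
    using A by (auto simp: smult_closed)
  have "x = (\<Oplus>\<^bsub>C\<^esub>z\<in>schubert D ` A. k z \<odot>\<^bsub>C\<^esub> z)"
  proof (rule coord_eqI[OF x coinv.finsum_closed[OF closed]])
    fix v assume v: "v \<in> weyl D"
    have "coord v (\<Oplus>\<^bsub>C\<^esub>z\<in>schubert D ` A. k z \<odot>\<^bsub>C\<^esub> z)
        = (\<Sum>z\<in>schubert D ` A. coord v (k z \<odot>\<^bsub>C\<^esub> z))"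
      using fin closed by (intro coord_finsum v) auto
    also have "\<dots> = (\<Sum>w\<in>A. coord v (k (schubert D w) \<odot>\<^bsub>C\<^esub> schubert D w))"
      by (subst sum.reindex[OF inj]) simp
    also have "\<dots> = (\<Sum>w\<in>A. if v = w then coord v x else 0)"
      using v A inj top_coef_nonzero
      by (intro sum.cong) (auto simp: coord_smult coord_schubert k_def subset_iff)
    also have "\<dots> = coord v x" using fin zero[OF v] by simp
    finally show "coord v x = coord v (\<Oplus>\<^bsub>C\<^esub>z\<in>schubert D ` A. k z \<odot>\<^bsub>C\<^esub> z)" by simp
  qed
  then show ?thesis
    unfolding lin_span_def using fin by blast
qed

text \<open>Longer elements are the larger ones because multiplication raises degrees. Elements of
  equal length are incomparable, so the span of higher terms lies in strictly larger degree.\<close>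

definition len_gt :: "('h \<Rightarrow> 'h) \<Rightarrow> ('h \<Rightarrow> 'h) \<Rightarrow> bool" where
  "len_gt v w \<longleftrightarrow> len D w < len D v"

text \<open>Subtracting the constant term times the Schubert class removes all coordinates at
  elements not longer than \<open>w\<close>. The coefficient does not involve \<open>w\<close>:
  every cell module is the module on which elements act by their constant terms.\<close>

lemma is_cell_coeff_schubert:
  assumes x: "x \<in> carrier C" and w: "w \<in> weyl D"
  shows "is_cell_coeff C (weyl D) len_gt (\<lambda>w. {w}) (\<lambda>w s t. schubert D w) w x s (\<lambda>u\<in>{w}. coord id x)"
proof -
  let ?y = "(x \<otimes>\<^bsub>C\<^esub> schubert D w) \<ominus>\<^bsub>C\<^esub> (coord id x \<odot>\<^bsub>C\<^esub> schubert D w)"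
  have "?y \<in> lin_span C (schubert D ` {v \<in> weyl D. len_gt v w})"
  proof (rule mem_span_schubert)
    show "?y \<in> carrier C" using x w by (simp add: smult_closed)
    fix v assume v: "v \<in> weyl D" "v \<notin> {v \<in> weyl D. len_gt v w}"
    then have "len D v \<le> len D w" by (simp add: len_gt_def)
    then show "coord v ?y = 0"
      using v(1) x w by (simp add: coord_minus coord_smult smult_closed coord_mult_schubert)
  qed auto
  moreover have "schubert D ` {v \<in> weyl D. len_gt v w}
      = {schubert D q | q u v. q \<in> weyl D \<and> len_gt q w \<and> u \<in> {q} \<and> v \<in> {q}}" by auto
  moreover have "(\<Oplus>\<^bsub>C\<^esub>u\<in>{w}. (\<lambda>u\<in>{w}. coord id x) u \<odot>\<^bsub>C\<^esub> schubert D w) = coord id x \<odot>\<^bsub>C\<^esub> schubert D w"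
    using w smult_closed by (subst coinv.finsum_insert) (auto simp: coinv.r_zero)
  ultimately show ?thesis by (simp add: is_cell_coeff_def higher_span_def)
qed

text \<open>With a single index per cell, the degree \<open>2 * len D p\<close> is split evenly
  between the two equal indices, and swapping them is the identity, an anti-automorphism because the
  algebra is commutative.\<close>

lemma graded_cellular_coinv:
  "graded_cellular C gr (weyl D) len_gt (\<lambda>w. {w}) (\<lambda>w s t. schubert D w) (\<lambda>w s. int (len D w)) id"
  unfolding graded_cellular_def
proof (intro conjI ballI)
  show "irreflp_on (weyl D) len_gt" by (simp add: irreflp_on_def len_gt_def)
  show "transp_on (weyl D) len_gt" by (auto intro!: transp_onI simp: len_gt_def)
  show "schubert D p \<in> gr (int (len D p) + int (len D p))" if "p \<in> weyl D" for p
    using that top_coef_nonzero by (auto simp: grading_eq coord_schubert)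
  show "\<exists>r. is_cell_coeff C (weyl D) len_gt (\<lambda>w. {w}) (\<lambda>w s t. schubert D w) p a s r"
    if "a \<in> carrier C" "p \<in> weyl D" for a p s using is_cell_coeff_schubert[OF that] by blast
  show "lin_basis C {(p, s, t). p \<in> weyl D \<and> s \<in> {p} \<and> t \<in> {p}} (\<lambda>(p, s, t). schubert D p)"
    by (rule lin_basis_schubert)
  show "anti_automorphism C id" by (auto simp: anti_automorphism_def coinv.m_comm)
qed (auto simp: graded_algebra_coinv finite_weyl)

lemma has_dim_cell_module:
  "has_dim (cell_module C (weyl D) len_gt (\<lambda>w. {w}) (\<lambda>w s t. schubert D w) w) 1"
proof -
  let ?V = "cell_module C (weyl D) len_gt (\<lambda>w. {w}) (\<lambda>w s t. schubert D w) w"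
  have sel: "carrier ?V = {f. \<forall>u. u \<noteq> w \<longrightarrow> f u = 0}" "\<zero>\<^bsub>?V\<^esub> = (\<lambda>u. 0)"
    "f \<oplus>\<^bsub>?V\<^esub> g = (\<lambda>u. f u + g u)" "k \<odot>\<^bsub>?V\<^esub> f = (\<lambda>u. k * f u)" for f g k
    by (simp_all add: cell_module_def)
  interpret V: abelian_monoid ?V by (rule abelian_monoidI) (auto simp: sel)
  define b where "b i = (\<lambda>u. if u = w then 1 else 0 :: complex)" for i :: nat
  have b: "b i \<in> carrier ?V" for i by (simp add: b_def sel)
  have sum: "(\<Oplus>\<^bsub>?V\<^esub>i\<in>{..<1}. k i \<odot>\<^bsub>?V\<^esub> b i) = (\<lambda>u. if u = w then k 0 else 0)" for k
  proof -
    have "(\<Oplus>\<^bsub>?V\<^esub>i\<in>{..<1}. k i \<odot>\<^bsub>?V\<^esub> b i) = (\<Oplus>\<^bsub>?V\<^esub>i\<in>insert 0 {}. k i \<odot>\<^bsub>?V\<^esub> b i)"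
      by (simp add: lessThan_Suc)
    also have "\<dots> = k 0 \<odot>\<^bsub>?V\<^esub> b 0 \<oplus>\<^bsub>?V\<^esub> \<zero>\<^bsub>?V\<^esub>"
      by (subst V.finsum_insert) (auto simp: sel b_def)
    finally show ?thesis by (auto simp: sel b_def)
  qed
  have "lin_basis ?V {..<1} b"
    unfolding lin_basis_def sum
  proof (intro conjI ballI)
    show "b \<in> {..<1} \<rightarrow> carrier ?V" using b by auto
    fix x assume "x \<in> carrier ?V"
    then have x: "x = (\<lambda>u. if u = w then x w else 0)" by (auto simp: sel)
    show "\<exists>!k. k \<in> extensional {..<1} \<and> x = (\<lambda>u. if u = w then k (0::nat) else 0)"
    proof (rule ex_ex1I)
      show "\<exists>k. k \<in> extensional {..<1} \<and> x = (\<lambda>u. if u = w then k (0::nat) else 0)"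
      proof (intro exI conjI)
        have at_0: "(\<lambda>i\<in>{..<1}. x w) (0::nat) = x w" by simp
        show "x = (\<lambda>u. if u = w then (\<lambda>i\<in>{..<1}. x w) (0::nat) else 0)"
          unfolding at_0 by (rule x)
      qed (rule restrict_extensional)
      fix k l :: "nat \<Rightarrow> complex"
      assume k: "k \<in> extensional {..<1} \<and> x = (\<lambda>u. if u = w then k 0 else 0)"
        and l: "l \<in> extensional {..<1} \<and> x = (\<lambda>u. if u = w then l 0 else 0)"
      have "x w = k 0" "x w = l 0"
        using fun_cong[OF conjunct2[OF k], of w] fun_cong[OF conjunct2[OF l], of w] by simp_all
      then have "k 0 = l 0" by simp
      then show "k = l" using k l by (intro extensionalityI[of k "{..<1}" l]) auto
    qed
  qed simp
  then show ?thesis unfolding has_dim_def by blast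
qed


subsection \<open>The symmetrizing form\<close>

lemma linear_form_lin_comb:
  assumes tr: "linear_form C tr"
  shows "tr (lin_comb a) = (\<Sum>w\<in>weyl D. a w / top_coef * tr (schubert D w))"
proof -
  have zero: "tr \<zero>\<^bsub>C\<^esub> = 0"
    using tr coinv.l_zero[of "\<zero>\<^bsub>C\<^esub>"] unfolding linear_form_def
    by (metis add_cancel_right_left coinv.zero_closed)
  have "tr (\<Oplus>\<^bsub>C\<^esub>w\<in>A. (a w / top_coef) \<odot>\<^bsub>C\<^esub> schubert D w)
      = (\<Sum>w\<in>A. a w / top_coef * tr (schubert D w))" if "finite A" "A \<subseteq> weyl D" for A
    using that
  proof (induction A rule: finite_induct)
    case empty
    then show ?case by (simp add: zero)
  next
    case (insert v A)
    have "(\<lambda>w. (a w / top_coef) \<odot>\<^bsub>C\<^esub> schubert D w) \<in> A \<rightarrow> carrier C"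
      using insert by (auto simp: smult_closed)
    then show ?case
      using insert tr by (simp add: linear_form_def smult_closed coinv.finsum_closed)
  qed
  then show ?thesis unfolding lin_comb_def using finite_weyl by blast
qed

text \<open>Division by \<open>top_coef\<close> gives the class of the longest element the value 1.
  Restriction to the carrier selects one function among those that agree on the algebra, as
  uniqueness requires.\<close>

definition trace :: "('h \<Rightarrow> complex) set \<Rightarrow> complex" where
  "trace = (\<lambda>x\<in>carrier C. coord w\<^sub>0 x / top_coef)"

lemma trace_schubert: "w \<in> weyl D \<Longrightarrow> trace (schubert D w) = (if w = w\<^sub>0 then 1 else 0)"
  using top_coef_nonzero by (auto simp: trace_def coord_schubert longest)

lemma linear_form_trace: "linear_form C trace"
  by (simp add: linear_form_def trace_def coord_add coord_smult longest smult_closed add_divide_distrib)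

lemma symmetrizing_form_trace: "symmetrizing_form C trace"
  unfolding symmetrizing_form_def
proof (intro conjI ballI impI linear_form_trace)
  show "trace (a \<otimes>\<^bsub>C\<^esub> b) = trace (b \<otimes>\<^bsub>C\<^esub> a)" if "a \<in> carrier C" "b \<in> carrier C" for a b
    using that by (simp add: coinv.m_comm)
  fix a assume a: "a \<in> carrier C" and zero: "\<forall>b\<in>carrier C. trace (a \<otimes>\<^bsub>C\<^esub> b) = 0"
  obtain f where f: "f \<in> polys" "a = cls f" using a by (rule coinv_cases)
  have "f \<in> I\<^sub>W"
  proof (rule ideal_if_coef_longest[OF f(1)])
    fix g assume g: "g \<in> polys"
    have "trace (cls f \<otimes>\<^bsub>C\<^esub> cls g) = 0" using zero g f by simp
    then show "coef w\<^sub>0 (\<lambda>x. f x * g x) = 0"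
      using f(1) g top_coef_nonzero by (simp add: trace_def cls_mult polys_mult coord_cls longest)
  qed
  then show "a = \<zero>\<^bsub>C\<^esub>" using f by (simp add: cls_zero cls_eq_iff polys_const)
qed

lemma homogeneous_form_trace: "homogeneous_form gr (- 2 * int (len D w\<^sub>0)) trace"
  using longest by (auto simp: homogeneous_form_def trace_def grading_eq)

lemma ex1_symmetrizing_form:
  "\<exists>!tr. tr \<in> extensional (carrier C) \<and>
     (\<forall>w\<in>weyl D. tr (schubert D w) = (if w = w\<^sub>0 then 1 else 0)) \<and>
     symmetrizing_form C tr \<and> homogeneous_form gr (- 2 * int (len D w\<^sub>0)) tr"
proof (rule ex1I[of _ trace])
  show "trace \<in> extensional (carrier C) \<and>
     (\<forall>w\<in>weyl D. trace (schubert D w) = (if w = w\<^sub>0 then 1 else 0)) \<and>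
     symmetrizing_form C trace \<and> homogeneous_form gr (- 2 * int (len D w\<^sub>0)) trace"
    using symmetrizing_form_trace homogeneous_form_trace trace_schubert by (auto simp: trace_def)
  fix tr
  assume tr: "tr \<in> extensional (carrier C) \<and>
     (\<forall>w\<in>weyl D. tr (schubert D w) = (if w = w\<^sub>0 then 1 else 0)) \<and>
     symmetrizing_form C tr \<and> homogeneous_form gr (- 2 * int (len D w\<^sub>0)) tr"
  then have "linear_form C tr" by (simp add: symmetrizing_form_def)
  then have "tr (lin_comb a) = trace (lin_comb a)" for a
    unfolding linear_form_lin_comb[OF \<open>linear_form C tr\<close>] linear_form_lin_comb[OF linear_form_trace]
    using tr by (intro sum.cong refl) (simp add: trace_schubert)
  then have "tr x = trace x" if "x \<in> carrier C" for x using coinv_expand[OF that] by metis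
  then show "tr = trace" using tr by (intro extensionalityI[of tr "carrier C"]) (auto simp: trace_def)
qed

end

theorem corollary3p4:
  fixes D :: "'h::ab_group_add root_datum"
  assumes "semisimple_root_datum D"
  shows
    "(\<exists>gt. graded_cellular (coinvariant_algebra D) (coinvariant_grading D)
              (weyl D) gt (\<lambda>w. {w}) (\<lambda>w s t. schubert D w) (\<lambda>w s. int (len D w)) id \<and>
           (\<forall>w\<in>weyl D. has_dim
              (cell_module (coinvariant_algebra D) (weyl D) gt (\<lambda>w. {w}) (\<lambda>w s t. schubert D w) w) 1))
     \<and>
     (\<exists>!tr. tr \<in> extensional (carrier (coinvariant_algebra D)) \<and>
            (\<forall>w\<in>weyl D. tr (schubert D w) = (if w = longest D then 1 else 0)) \<and>
            symmetrizing_form (coinvariant_algebra D) tr \<and>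
            homogeneous_form (coinvariant_grading D) (- 2 * int (len D (longest D))) tr)"
proof -
  interpret root_system D using assms by unfold_locales
  show ?thesis using graded_cellular_coinv has_dim_cell_module ex1_symmetrizing_form by blast
qed

end
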